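(* Let $m\ge0$ and $\ell\ge0$ be fixed integers. As $n\to\infty$, for every fixed integer $j\ge1$, $$\mathbb P[Q_n=j]=\chi_j(a_n)+o(1)=\chi_j(c_n)+o(1),$$ where $\chi_j:\mathbb R\to[0,1]$ is a continuous, $1$-periodic function, representable by the Fourier series (with $\mathrm i=\sqrt{-1}$) $$\chi_j(u)=\frac{(1-e^{-1})^j}{j}\left(1+\sum_{k\in\mathbb Z\setminus\{0\}}\frac{\Gamma(j-2\pi\mathrm i k)\,\Gamma(\ell+1-2\pi(e-1)k\mathrm i)}{(j-1)!\,\ell!}\,e^{2\pi\mathrm i ku}\right).$$
   Context: Let $(\Pi_i(t),t\ge 0)$, $i=1,2,\dots$, be i.i.d. unit-rate Poisson counting processes. For $n>\ell$ let $\tau_n:=\min\{t\ge 0:\Pi_i(t)>m\text{ for all but }\ell\text{ indices }i\in\{1,\dots,n\}\}$. Let $Q_n$ be the multiplicity of the stopped maximum: $Q_n:=\#\{i\in\{1,\dots,n\}:\Pi_i(\tau_n)=\max_{1\le h\le n}\Pi_h(\tau_n)\}$. With $L:=\log n$, put $$a_n:=eL+\Big((e-1)m-\tfrac12\Big)\log L-\log\Big((e-1)(m!)^{e-1}\sqrt{2\pi e}\Big),\quad c_n:=a_n-\lfloor a_n\rfloor .$$ Let $\Xi$ be the Poisson point process on $\mathbb R$ with intensity measure $e^{-x}\,\mathrm dx$, with atoms $\xi_1>\xi_2>\cdots$. For real $b$ let $\Xi^\uparrow_b:=\{\lceil\xi_i+b\rceil\}_{i\ge1}$, regarded as a multiset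 (point process with multiplicities) on $\mathbb Z$. Let $\tau$ be independent of $\Xi$ with the ${\rm Gumbel}(\ell+1)$ distribution, i.e. with density $\frac{1}{\ell!}\exp(-(\ell+1)s-e^{-s})$ on $\mathbb R$. For $u\in\mathbb R$ and integer $j\ge1$, $\chi_j(u)$ is defined as the probability that the rightmost atom of $\Xi^\uparrow_{(e-1)\tau+u}$ has multiplicity $j$. *)

theory Defs
  imports "HOL-Probability.Probability"
begin

text \<open>\<open>poisson_pmf\<close> is only specified for a positive parameter; the Poisson law of mean 0 is added.\<close>

definition poisson_law :: "real \<Rightarrow> nat pmf" where
  "poisson_law r = (if r = 0 then return_pmf 0 else poisson_pmf r)"

text \<open>
  A unit-rate Poisson counting process is \<open>poisson_counting_process 1 X\<close>. Only times \<open>t \<ge> 0\<close> are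
  constrained. The path properties are required for every outcome, not just almost every one; they
  make the minimum defining the stopping time below attained whenever the condition is ever met.
\<close>

definition (in prob_space) poisson_counting_process :: "real \<Rightarrow> (real \<Rightarrow> 'a \<Rightarrow> nat) \<Rightarrow> bool" where
  "poisson_counting_process r X \<longleftrightarrow>
     (\<forall>t\<ge>0. random_variable (count_space UNIV) (X t)) \<and>
     (\<forall>\<omega>\<in>space M. X 0 \<omega> = 0 \<and> mono_on {0..} (\<lambda>t. X t \<omega>) \<and>
        (\<forall>t\<ge>0. continuous (at_right t) (\<lambda>s. X s \<omega>))) \<and>
     (\<forall>s t. 0 \<le> s \<and> s \<le> t \<longrightarrow>
        distr M (count_space UNIV) (\<lambda>\<omega>. X t \<omega> - X s \<omega>) = measure_pmf (poisson_law (r * (t - s)))) \<and>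
     (\<forall>(t :: nat \<Rightarrow> real). 0 \<le> t 0 \<and> mono t \<longrightarrow>
        indep_vars (\<lambda>_. count_space UNIV) (\<lambda>k \<omega>. X (t (Suc k)) \<omega> - X (t k) \<omega>) UNIV)"

text \<open>Independence is between whole paths, i.e. with respect to the product sigma-algebra over time.\<close>

definition (in prob_space) iid_unit_poisson_processes :: "(nat \<Rightarrow> real \<Rightarrow> 'a \<Rightarrow> nat) \<Rightarrow> bool" where
  "iid_unit_poisson_processes X \<longleftrightarrow>
     (\<forall>i\<ge>1. poisson_counting_process 1 (X i)) \<and>
     indep_vars (\<lambda>_. PiM {0..} (\<lambda>_. count_space UNIV)) (\<lambda>i \<omega>. \<lambda>t\<in>{0..}. X i t \<omega>) {1..}"

text \<open>
  In the next three definitions \<open>x i t\<close> is the path of the \<open>i\<close>-th process for a fixed outcome.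
\<close>

definition all_but_exceed :: "nat \<Rightarrow> nat \<Rightarrow> (nat \<Rightarrow> real \<Rightarrow> nat) \<Rightarrow> nat \<Rightarrow> real \<Rightarrow> bool" where
  "all_but_exceed m l x n t \<longleftrightarrow> card {i \<in> {1..n}. \<not> x i t > m} = l"

definition stop_time :: "nat \<Rightarrow> nat \<Rightarrow> (nat \<Rightarrow> real \<Rightarrow> nat) \<Rightarrow> nat \<Rightarrow> real" where
  "stop_time m l x n = (LEAST t. t \<ge> 0 \<and> all_but_exceed m l x n t)"

text \<open>
  On the null event where the stopping condition is never met, \<open>stop_time\<close> is unspecified and the
  multiplicity is set to \<open>0\<close>, a value that the multiplicity of an actual maximum does not take.
\<close>

definition max_mult :: "nat \<Rightarrow> nat \<Rightarrow> (nat \<Rightarrow> real \<Rightarrow> nat) \<Rightarrow> nat \<Rightarrow> nat" where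
  "max_mult m l x n =
     (if \<exists>t\<ge>0. all_but_exceed m l x n t
      then card {i \<in> {1..n}. x i (stop_time m l x n) = Max ((\<lambda>h. x h (stop_time m l x n)) ` {1..n})}
      else 0)"

definition (in prob_space) prob_max_mult ::
  "nat \<Rightarrow> nat \<Rightarrow> (nat \<Rightarrow> real \<Rightarrow> 'a \<Rightarrow> nat) \<Rightarrow> nat \<Rightarrow> nat \<Rightarrow> real" where
  "prob_max_mult m l X n j = prob {\<omega> \<in> space M. max_mult m l (\<lambda>i t. X i t \<omega>) n = j}"

definition a_seq :: "nat \<Rightarrow> nat \<Rightarrow> real" where
  "a_seq m n =
     (let L = ln (real n) in
      exp 1 * L + ((exp 1 - 1) * real m - 1/2) * ln L
        - ln ((exp 1 - 1) * (real (fact m) powr (exp 1 - 1)) * sqrt (2 * pi * exp 1)))"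

definition c_seq :: "nat \<Rightarrow> nat \<Rightarrow> real" where
  "c_seq m n = a_seq m n - of_int \<lfloor>a_seq m n\<rfloor>"

text \<open>A point configuration is given by a sequence of points, repetitions being multiplicities.\<close>

definition num_points :: "(nat \<Rightarrow> 'b) \<Rightarrow> 'b set \<Rightarrow> enat" where
  "num_points x B = (if finite {i. x i \<in> B} then enat (card {i. x i \<in> B}) else \<infinity>)"

text \<open>
  The points \<open>\<xi> 0, \<xi> 1, \<dots>\<close> form a Poisson point process with intensity measure \<open>\<mu>\<close>. Listing
  the points by all of \<open>nat\<close> means that there are infinitely many, so \<open>\<mu>\<close> has infinite total mass.
\<close>

definition (in prob_space) poisson_point_process :: "'b measure \<Rightarrow> (nat \<Rightarrow> 'a \<Rightarrow> 'b) \<Rightarrow> bool" where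
  "poisson_point_process \<mu> \<xi> \<longleftrightarrow>
     (\<forall>i. random_variable \<mu> (\<xi> i)) \<and>
     (\<forall>B\<in>sets \<mu>. emeasure \<mu> B < \<infinity> \<longrightarrow>
        distr M (count_space UNIV) (\<lambda>\<omega>. num_points (\<lambda>i. \<xi> i \<omega>) B) =
          measure_pmf (map_pmf enat (poisson_law (measure \<mu> B)))) \<and>
     (\<forall>B\<in>sets \<mu>. emeasure \<mu> B = \<infinity> \<longrightarrow> (AE \<omega> in M. num_points (\<lambda>i. \<xi> i \<omega>) B = \<infinity>)) \<and>
     (\<forall>A. range A \<subseteq> sets \<mu> \<and> disjoint_family A \<longrightarrow>
        indep_vars (\<lambda>_. count_space UNIV) (\<lambda>(k::nat) \<omega>. num_points (\<lambda>i. \<xi> i \<omega>) (A k)) UNIV)"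

definition exp_intensity :: "real measure" where
  "exp_intensity = density lborel (\<lambda>x. ennreal (exp (- x)))"

definition gumbel_density :: "nat \<Rightarrow> real \<Rightarrow> real" where
  "gumbel_density l s = exp (- (real l + 1) * s - exp (- s)) / fact l"

text \<open>
  \<open>\<xi>\<close> enumerates the points of the Poisson process \<open>\<Xi>\<close> in decreasing order and \<open>\<tau>\<close> is an
  independent Gumbel\<open>(l + 1)\<close> variable.
\<close>

definition (in prob_space) limit_variables :: "nat \<Rightarrow> (nat \<Rightarrow> 'a \<Rightarrow> real) \<Rightarrow> ('a \<Rightarrow> real) \<Rightarrow> bool" where
  "limit_variables l \<xi> \<tau> \<longleftrightarrow>
     poisson_point_process exp_intensity \<xi> \<and>
     (AE \<omega> in M. \<forall>i. \<xi> (Suc i) \<omega> < \<xi> i \<omega>) \<and>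
     distributed M lborel \<tau> (\<lambda>s. ennreal (gumbel_density l s)) \<and>
     indep_set (sets (vimage_algebra (space M) (\<lambda>\<omega> i. \<xi> i \<omega>) (PiM UNIV (\<lambda>_. borel))))
               (sets (vimage_algebra (space M) \<tau> borel))"

definition ceil_points :: "real \<Rightarrow> (nat \<Rightarrow> real) \<Rightarrow> nat \<Rightarrow> int" where
  "ceil_points b x i = \<lceil>x i + b\<rceil>"

definition rightmost_mult :: "(nat \<Rightarrow> int) \<Rightarrow> nat \<Rightarrow> bool" where
  "rightmost_mult y j \<longleftrightarrow>
     (\<exists>z\<in>range y. (\<forall>z'\<in>range y. z' \<le> z) \<and> num_points y {z} = enat j)"

definition (in prob_space) chi :: "(nat \<Rightarrow> 'a \<Rightarrow> real) \<Rightarrow> ('a \<Rightarrow> real) \<Rightarrow> nat \<Rightarrow> real \<Rightarrow> real" where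
  "chi \<xi> \<tau> j u =
     prob {\<omega> \<in> space M. rightmost_mult (ceil_points ((exp 1 - 1) * \<tau> \<omega> + u) (\<lambda>i. \<xi> i \<omega>)) j}"

definition fourier_term :: "nat \<Rightarrow> nat \<Rightarrow> real \<Rightarrow> int \<Rightarrow> complex" where
  "fourier_term l j u k =
     Gamma (of_nat j - 2 * of_real pi * \<i> * of_int k)
       * Gamma (of_nat l + 1 - 2 * of_real pi * of_real (exp 1 - 1) * of_int k * \<i>)
       / (fact (j - 1) * fact l)
       * exp (2 * of_real pi * \<i> * of_int k * of_real u)"

end

theory Submission
  imports Defs "HOL-Real_Asymp.Real_Asymp"
begin

text \<open>
  Let \<open>T\<^sub>i\<close> be the time at which the \<open>i\<close>-th process first exceeds \<open>m\<close>. Almost surely these times are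
  distinct and every jump has size one, so the stopping time is \<open>T\<^sub>i\<close> for the unique \<open>i\<close> at which exactly
  \<open>l\<close> of the other processes are still at most \<open>m\<close>. The other processes are independent of \<open>T\<^sub>i\<close>, hence
  given \<open>T\<^sub>i = t\<close> they are independent Poisson variables of mean \<open>t\<close>. For large \<open>n\<close> the maximum has multiplicity \<open>j\<close>
  exactly when, for some level \<open>k\<close>, \<open>j\<close> of them equal \<open>k\<close>, \<open>l\<close> are at most \<open>m\<close> and the rest lie strictly
  between \<open>m\<close> and \<open>k\<close>. With the Poisson weights \<open>p\<^sub>k(t)\<close>, \<open>q(t) = p\<^sub>0(t) + \<dots> + p\<^sub>m(t)\<close> and
  \<open>w\<^sub>k(t) = \<Sum>m<i<k. p\<^sub>i(t)\<close> this gives, for \<open>n \<ge> l + j + 2\<close>,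
  the exact formula (\<open>emeasure_max_mult\<close>)

  \<open>P(Q\<^sub>n = j) = n (n-1 choose l) \<integral> p\<^sub>m(t) q(t)^l (\<Sum>k. (n-1-l choose j) p\<^sub>k(t)^j w\<^sub>k(t)^(n-1-l-j)) dt.\<close>

  Put \<open>t = log n + m log log n - log m! + s\<close>. Then \<open>n q(t) \<rightarrow> exp (-s)\<close>, and the law of the stopping time
  in the variable \<open>s\<close> converges to the Gumbel density, in \<open>L\<^sup>1\<close> by Scheffe's lemma. For integers
  \<open>k = a\<^sub>n + (e-1) s + x\<close> Stirling's formula gives \<open>n p\<^sub>k(t) \<approx> (e-1) exp (-x)\<close>, and the tail beyond \<open>k\<close> is
  geometric with ratio \<open>1/e\<close>. So the sum over \<open>k\<close> approaches \<open>exp (-exp (-s))\<close> times the \<open>lattice_sum\<close>, the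
  sum over all integers \<open>z\<close> of \<open>((e-1) exp (-x))^j / j! \<cdot> exp (-exp (1-x))\<close> at
  \<open>x = z - a\<^sub>n - (e-1) s\<close> (\<open>max_mult_series_limit\<close>). As \<open>a\<^sub>n\<close> modulo \<open>1\<close> does not converge, neither side of this
  comparison has a limit, and only the difference tends to \<open>0\<close>.

  On the side of the limit, \<open>lattice_sum\<close> at \<open>b\<close> is the probability that the rightmost nonempty cell of the
  Poisson process shifted by \<open>b\<close> has \<open>j\<close> points: the factors are the probabilities of \<open>j\<close> points
  in a cell and of none to its right. Averaging over the Gumbel variable gives \<open>chi\<close>
  (\<open>chi_eq_expectation\<close>), which is the same integral as above.

  The summand is a constant times \<open>G(x-1)\<close> with \<open>G(x) = exp (-j x - exp (-x))\<close>, whose Fourier transform is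
  Euler's integral for the Gamma function after the substitution \<open>t = exp (-x)\<close>. Poisson summation
  (\<open>log_gamma_lattice_fourier\<close>) therefore expands \<open>lattice_sum\<close> with the coefficients \<open>\<Gamma>(j - 2\<pi>ik)\<close>. The
  Gumbel density is a kernel of the same form with \<open>l+1\<close> in place of \<open>j\<close>, so averaging
  \<open>exp (2\<pi>ik(e-1)\<tau>)\<close> contributes the second Gamma factor.
\<close>

section \<open>Uniqueness of Fourier coefficients\<close>

lemma periodic_of_int:
  fixes f :: "real \<Rightarrow> 'c" and z :: int
  assumes per: "\<And>u. f (u + 1) = f u"
  shows "f (u + of_int z) = f u"
proof (induction z rule: int_induct[of _ 0])
  case (step1 i)
  thus ?case using per[of "u + of_int i"] by (simp add: add.assoc)
next
  case (step2 i)
  thus ?case using per[of "u + of_int (i - 1)"] by (simp add: algebra_simps)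
qed simp

definition char_fun :: "int \<Rightarrow> real \<Rightarrow> complex" where
  "char_fun k u = exp (2 * of_real pi * \<i> * of_int k * of_real u)"

lemma char_fun_add: "char_fun (k + l) u = char_fun k u * char_fun l u"
  by (simp add: char_fun_def algebra_simps flip: exp_add)

lemma norm_char_fun [simp]: "norm (char_fun k u) = 1"
proof -
  have "char_fun k u = exp (\<i> * of_real (2 * pi * of_int k * u))" by (simp add: char_fun_def mult_ac)
  thus ?thesis by (simp only: norm_exp_i_times)
qed

lemma char_fun_0 [simp]: "char_fun 0 u = 1" by (simp add: char_fun_def)

lemma char_fun_int: "char_fun k (of_int z) = 1"
proof -
  have "char_fun k (of_int z) = exp ((2 * of_int (k * z) * of_real pi) * \<i>)" by (simp add: char_fun_def mult_ac)
  also have "\<dots> = 1" using exp_integer_2pi[of "of_int (k * z)"] by (simp add: mult_ac)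
  finally show ?thesis .
qed

lemma char_fun_plus: "char_fun k (u + v) = char_fun k u * char_fun k v"
  by (simp add: char_fun_def algebra_simps flip: exp_add)

lemma char_fun_periodic: "char_fun k (u + 1) = char_fun k u"
  using char_fun_int[of k 1] by (simp add: char_fun_plus)

lemma continuous_on_char_fun [continuous_intros]:
  "continuous_on S f \<Longrightarrow> continuous_on S (\<lambda>x. char_fun k (f x))"
  unfolding char_fun_def by (intro continuous_intros)

lemma has_vector_derivative_char_fun:
  "(char_fun k has_vector_derivative 2 * of_real pi * \<i> * of_int k * char_fun k u) (at u within S)"
  unfolding char_fun_def [abs_def]
  by (rule has_vector_derivative_real_field) (auto intro!: derivative_eq_intros)

lemma integral_char_fun: "((\<lambda>u. char_fun k u) has_integral (if k = 0 then 1 else 0)) {0..1}"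
proof (cases "k = 0")
  case True
  thus ?thesis using has_integral_const_real[of "1::complex" 0 1] by simp
next
  case False
  define c where "c = 2 * of_real pi * \<i> * (of_int k :: complex)"
  have c: "c \<noteq> 0" using False by (simp add: c_def)
  have "((\<lambda>u. char_fun k u) has_integral char_fun k 1 / c - char_fun k 0 / c) {0..1}"
  proof (rule fundamental_theorem_of_calculus)
    fix u :: real
    have "((\<lambda>u. char_fun k u / c) has_vector_derivative (c * char_fun k u) / c) (at u within {0..1})"
      unfolding c_def by (intro has_vector_derivative_divide has_vector_derivative_char_fun)
    thus "((\<lambda>u. char_fun k u / c) has_vector_derivative char_fun k u) (at u within {0..1})" using c by simp
  qed simp
  thus ?thesis using False char_fun_int[of k 1] char_fun_int[of k 0] by simp
qed

definition fourier_coeff :: "(real \<Rightarrow> complex) \<Rightarrow> int \<Rightarrow> complex" where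
  "fourier_coeff D k = integral {0..1} (\<lambda>u. D u * char_fun (- k) u)"

lemma continuous_on_real_polynomial_char_fun:
  assumes "real_polynomial_function p"
  shows "continuous_on S (\<lambda>u. p (char_fun 1 u))"
proof (rule continuous_on_compose2[of UNIV p])
  show "continuous_on UNIV p"
    using assms by (intro continuous_on_polymonial_function) (simp add: real_polynomial_function_eq)
qed (auto intro!: continuous_intros)

text \<open>
  On the unit circle a real linear form is a combination of \<open>z\<close> and \<open>1/z\<close>, and multiplication by these
  only shifts Fourier coefficients. The claim is made for all \<open>D\<close> at once, since for a product of
  polynomials the induction hypothesis of one factor is applied to \<open>D\<close> times the other factor.
\<close>

lemma real_polynomial_annihilated:
  assumes "real_polynomial_function (p :: complex \<Rightarrow> real)"
  shows "continuous_on {0..1} D \<Longrightarrow> (\<And>k. fourier_coeff D k = 0) \<Longrightarrow>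
      fourier_coeff (\<lambda>u. D u * of_real (p (char_fun 1 u))) k = 0"
  using assms
proof (induction p arbitrary: D k rule: real_polynomial_function.induct)
  case (linear f)
  interpret bounded_linear f by fact
  define a where "a = f 1"
  define b where "b = f \<i>"
  have f_eq: "f z = a * Re z + b * Im z" for z
  proof -
    have "z = Re z *\<^sub>R 1 + Im z *\<^sub>R \<i>" by (simp add: complex_eq_iff)
    hence "f z = f (Re z *\<^sub>R 1 + Im z *\<^sub>R \<i>)" by simp
    thus ?thesis by (simp only: add scaleR a_def b_def) simp
  qed
  have conj: "cnj (char_fun 1 u) = char_fun (-1) u" for u
    by (simp add: char_fun_def exp_cnj)
  define \<alpha> \<beta> where "\<alpha> = (of_real a / 2 - \<i> * of_real b / 2)" and "\<beta> = (of_real a / 2 + \<i> * of_real b / 2)"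
  have eq: "of_real (f (char_fun 1 u)) = \<alpha> * char_fun 1 u + \<beta> * char_fun (-1) u" for u
    unfolding f_eq conj [symmetric] \<alpha>_def \<beta>_def by (simp add: complex_eq_iff field_simps)
  have "D u * of_real (f (char_fun 1 u)) * char_fun (- k) u =
     \<alpha> * (D u * char_fun (- (k - 1)) u) + \<beta> * (D u * char_fun (- (k + 1)) u)" for u
  proof -
    have "- (k - 1) = 1 + - k" "- (k + 1) = -1 + - k" by auto
    hence "char_fun (- (k - 1)) u = char_fun 1 u * char_fun (- k) u" "char_fun (- (k + 1)) u = char_fun (-1) u * char_fun (- k) u"
      by (simp_all only: char_fun_add)
    thus ?thesis unfolding eq by (simp only: ring_distribs mult_ac)
  qed
  hence "fourier_coeff (\<lambda>u. D u * of_real (f (char_fun 1 u))) k = integral {0..1} (\<lambda>u. \<alpha> * (D u * char_fun (- (k - 1)) u) + \<beta> * (D u * char_fun (- (k + 1)) u))"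
    by (simp only: fourier_coeff_def)
  also have "\<dots> = \<alpha> * fourier_coeff D (k - 1) + \<beta> * fourier_coeff D (k + 1)"
    unfolding fourier_coeff_def using linear.prems(1)
    by (subst integral_add) (auto intro!: integrable_continuous_interval continuous_intros)
  finally show ?case using linear.prems(2) by simp
next
  case (const c)
  have "fourier_coeff (\<lambda>u. D u * of_real c) k = of_real c * fourier_coeff D k"
    unfolding fourier_coeff_def by (subst integral_mult_right [symmetric]) (simp add: mult_ac)
  thus ?case using const by simp
next
  case (add f g)
  note cont = continuous_on_real_polynomial_char_fun
  have "fourier_coeff (\<lambda>u. D u * of_real (f (char_fun 1 u) + g (char_fun 1 u))) k =
      fourier_coeff (\<lambda>u. D u * of_real (f (char_fun 1 u))) k + fourier_coeff (\<lambda>u. D u * of_real (g (char_fun 1 u))) k"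
    unfolding fourier_coeff_def using add.prems(1) cont[OF add.hyps(1)] cont[OF add.hyps(2)]
    by (subst integral_add [symmetric]) (auto intro!: integrable_continuous_interval continuous_intros simp: algebra_simps)
  thus ?case using add.IH add.prems by simp
next
  case (mult f g)
  note cont = continuous_on_real_polynomial_char_fun
  have "fourier_coeff (\<lambda>u. (D u * of_real (f (char_fun 1 u))) * of_real (g (char_fun 1 u))) k = 0"
    using mult.prems cont[OF mult.hyps(1)]
    by (intro mult.IH(2)) (auto intro!: continuous_intros mult.IH(1))
  thus ?case by (simp add: mult.assoc)
qed

text \<open>
  A continuous periodic function descends to the circle. Writing it through \<open>Arg z\<close> gives continuity
  off the negative axis; writing it through \<open>Arg (-z)\<close> gives the same function with the cut on the
  positive axis.
\<close>

lemma periodic_circle_function: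
  fixes d :: "real \<Rightarrow> real"
  assumes cont: "continuous_on UNIV d" and per: "\<And>u. d (u + 1) = d u"
  obtains F where "continuous_on (sphere 0 1) F" "\<And>u. F (char_fun 1 u) = d u"
proof -
  have per_int: "d (u + of_int z) = d u" for u and z :: int
    by (rule periodic_of_int) (rule per)
  define F where "F z = d (Arg z / (2 * pi))" for z
  have F: "F (char_fun 1 u) = d u" for u
  proof -
    have "char_fun 1 u = exp (\<i> * of_real (2 * pi * u))" by (simp add: char_fun_def mult_ac)
    moreover have "char_fun 1 u = exp (\<i> * of_real (Arg (char_fun 1 u)))"
      using Arg_eq[of "char_fun 1 u"] by (simp add: char_fun_def)
    ultimately have "exp (\<i> * of_real (Arg (char_fun 1 u))) = exp (\<i> * of_real (2 * pi * u))" by simp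
    then obtain z :: int where "\<i> * of_real (Arg (char_fun 1 u)) = \<i> * of_real (2 * pi * u) + (of_int (2 * z) * pi) * \<i>"
      by (auto simp: exp_eq)
    hence "Im (\<i> * of_real (Arg (char_fun 1 u))) = Im (\<i> * of_real (2 * pi * u) + (of_int (2 * z) * pi) * \<i>)" by simp
    hence "Arg (char_fun 1 u) = 2 * pi * u + 2 * of_int z * pi" by simp
    hence "Arg (char_fun 1 u) / (2 * pi) = u + of_int z" by (simp add: field_simps)
    thus ?thesis using per_int by (simp add: F_def)
  qed
  have circle: "\<exists>u. z = char_fun 1 u" if "z \<in> sphere 0 1" for z :: complex
  proof -
    have "z = exp (\<i> * of_real (Arg z))" using Arg_eq[of z] that by (cases "z = 0") auto
    also have "\<dots> = char_fun 1 (Arg z / (2 * pi))" by (simp add: char_fun_def mult_ac)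
    finally show ?thesis by blast
  qed
  have half: "char_fun 1 (u + 1 / 2) = - char_fun 1 u" for u
  proof -
    have "char_fun 1 (1/2) = exp (of_real pi * \<i>)" by (simp add: char_fun_def)
    thus ?thesis by (simp add: char_fun_plus)
  qed
  \<comment> \<open>the same function, with the cut on the other side\<close>
  have F': "F z = d (Arg (- z) / (2 * pi) + 1 / 2)" if z: "z \<in> sphere 0 1" for z
  proof -
    obtain u where u: "z = char_fun 1 u" using circle[OF z] by blast
    have "- z = char_fun 1 (u + 1/2)" by (simp add: half u)
    have "Arg (- z) / (2 * pi) - (u + 1/2) \<in> \<int>"
    proof -
      have "- z = exp (\<i> * of_real (Arg (- z)))" using Arg_eq[of "- z"] z by (cases "z = 0") auto
      hence "exp (\<i> * of_real (Arg (- z))) = exp (\<i> * of_real (2 * pi * (u + 1/2)))"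
        using \<open>- z = char_fun 1 (u + 1/2)\<close> by (simp add: char_fun_def mult_ac)
      then obtain k :: int where "\<i> * of_real (Arg (- z)) = \<i> * of_real (2 * pi * (u + 1/2)) + (of_int (2 * k) * pi) * \<i>"
        by (auto simp only: exp_eq)
      hence "Im (\<i> * of_real (Arg (- z))) = Im (\<i> * of_real (2 * pi * (u + 1/2)) + (of_int (2 * k) * pi) * \<i>)" by simp
      hence "Arg (- z) = 2 * pi * (u + 1/2) + 2 * of_int k * pi" by simp
      hence "Arg (- z) / (2 * pi) - (u + 1/2) = of_int k" by (simp add: field_simps)
      thus ?thesis by simp
    qed
    then obtain k :: int where "Arg (- z) / (2 * pi) = u + 1/2 + of_int k" by (auto elim!: Ints_cases simp: algebra_simps)
    hence "d (Arg (- z) / (2 * pi) + 1 / 2) = d (u + of_int (1 + k))" by (simp add: algebra_simps)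
    thus ?thesis using per_int[of u "1 + k"] F[of u] u by simp
  qed
  have isCont_d: "isCont d y" for y using cont by (simp add: continuous_on_eq_continuous_at)
  have "continuous_on (sphere 0 1) F"
    unfolding continuous_on_eq_continuous_within
  proof
    fix z :: complex assume z: "z \<in> sphere 0 1"
    show "continuous (at z within sphere 0 1) F"
    proof (cases "z \<in> \<real>\<^sub>\<le>\<^sub>0")
      case False
      have "isCont (\<lambda>z. d (Arg z / (2 * pi))) z"
        by (rule isCont_o2[OF _ isCont_d]) (intro continuous_intros continuous_at_Arg False, simp)
      thus ?thesis unfolding F_def[abs_def] by (rule continuous_at_imp_continuous_within)
    next
      case True
      have "- z \<notin> \<real>\<^sub>\<le>\<^sub>0" using True z by (auto simp: complex_nonpos_Reals_iff complex_eq_iff cmod_def)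
      hence "isCont (\<lambda>z. d (Arg (- z) / (2 * pi) + 1 / 2)) z"
        by (intro isCont_o2[OF _ isCont_d] continuous_intros isCont_o2[OF _ continuous_at_Arg]) auto
      hence "continuous (at z within sphere 0 1) (\<lambda>z. d (Arg (- z) / (2 * pi) + 1 / 2))"
        by (rule continuous_at_imp_continuous_within)
      thus ?thesis
        by (rule continuous_transform_within[OF _ zero_less_one]) (use F' z in auto)
    qed
  qed
  thus ?thesis using that F by blast
qed

text \<open>
  By the Stone-Weierstrass theorem on the circle, \<open>d\<close> is a uniform limit of polynomials in
  \<open>exp (2\<pi>iu)\<close>, and \<open>D\<close> is orthogonal to each of these.
\<close>

lemma real_part_annihilated:
  fixes D :: "real \<Rightarrow> complex" and d :: "real \<Rightarrow> real"
  assumes D: "continuous_on {0..1} D" and coeff: "\<And>k. fourier_coeff D k = 0"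
    and d: "continuous_on UNIV d" "\<And>u. d (u + 1) = d u"
  shows "integral {0..1} (\<lambda>u. D u * of_real (d u)) = 0"
proof -
  obtain F where F: "continuous_on (sphere 0 1) F" "\<And>u. F (char_fun 1 u) = d u"
    using periodic_circle_function[OF d] by blast
  obtain B where B: "B > 0" "\<And>u. u \<in> {0..1} \<Longrightarrow> norm (D u) \<le> B"
    using compact_imp_bounded[OF compact_continuous_image[OF D]] by (auto simp: bounded_pos)
  have d': "continuous_on {0..1} d" using d(1) by (rule continuous_on_subset) auto
  have bd: "norm (integral {0..1} (\<lambda>u. D u * of_real (d u))) \<le> B * e" if e: "e > 0" for e
  proof -
    obtain p where p: "real_polynomial_function p" "\<And>z. z \<in> sphere 0 1 \<Longrightarrow> \<bar>F z - p z\<bar> < e"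
      using Stone_Weierstrass_real_polynomial_function[OF compact_sphere F(1) e] by blast
    have pc: "continuous_on {0..1} (\<lambda>u. p (char_fun 1 u))"
      by (rule continuous_on_real_polynomial_char_fun[OF p(1)])
    have "integral {0..1} (\<lambda>u. D u * of_real (p (char_fun 1 u))) = 0"
      using real_polynomial_annihilated[OF p(1) D coeff, of 0] by (simp add: fourier_coeff_def)
    hence "integral {0..1} (\<lambda>u. D u * of_real (d u)) = integral {0..1} (\<lambda>u. D u * of_real (d u) - D u * of_real (p (char_fun 1 u)))"
      using D d' pc by (subst integral_diff) (auto intro!: integrable_continuous_interval continuous_intros)
    also have "norm \<dots> \<le> B * e * (1 - 0)"
    proof (rule integral_bound)
      fix u :: real assume u: "u \<in> {0..1}"
      have "norm (D u * of_real (d u) - D u * of_real (p (char_fun 1 u))) = norm (D u) * \<bar>d u - p (char_fun 1 u)\<bar>"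
        by (simp flip: right_diff_distrib of_real_diff add: norm_mult)
      also have "\<dots> \<le> B * e"
        using B u p(2)[of "char_fun 1 u"] F(2)[of u] by (intro mult_mono) auto
      finally show "norm (D u * of_real (d u) - D u * of_real (p (char_fun 1 u))) \<le> B * e" .
    qed (use D d' pc in \<open>auto intro!: continuous_intros\<close>)
    finally show ?thesis by simp
  qed
  have "norm (integral {0..1} (\<lambda>u. D u * of_real (d u))) \<le> 0 + e" if "e > 0" for e
    using bd[of "e / B"] that B(1) by simp
  hence "norm (integral {0..1} (\<lambda>u. D u * of_real (d u))) \<le> 0" by (rule field_le_epsilon)
  thus ?thesis by simp
qed

text \<open>
  The function is orthogonal to its own real part and to its own imaginary part, so both have
  square integral zero.
\<close>

lemma fourier_unique:
  fixes D :: "real \<Rightarrow> complex"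
  assumes D: "continuous_on UNIV D" and per: "\<And>u. D (u + 1) = D u" and coeff: "\<And>k. fourier_coeff D k = 0"
  shows "D u = 0"
proof -
  have D': "continuous_on {0..1} D" using D by (rule continuous_on_subset) auto
  have zero: "d u = 0" if u: "u \<in> {0..1}" and d: "continuous_on {0..1} d"
      and int: "integral {0..1} (\<lambda>u. d u * d u) = 0" for d :: "real \<Rightarrow> real" and u
  proof -
    have "((\<lambda>u. d u * d u) has_integral 0) {0..1}"
      using integrable_integral[of "\<lambda>u. d u * d u" "{0..1}"] int d
      by (auto intro!: integrable_continuous_interval continuous_intros)
    hence "((\<lambda>u. d u * d u) has_integral 0) (cbox 0 1)" by simp
    hence "d u * d u = 0"
      by (rule has_integral_0_cbox_imp_0[rotated 2]) (use u d in \<open>auto intro!: continuous_intros\<close>)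
    thus ?thesis by simp
  qed
  have int: "(\<lambda>u. D u * of_real (d u)) integrable_on {0..1}" if "continuous_on UNIV d" for d
    using D' continuous_on_subset[OF that, of "{0..1}"] by (auto intro!: integrable_continuous_interval continuous_intros)
  have Re0: "integral {0..1} (\<lambda>u. Re (D u) * Re (D u)) = 0"
  proof -
    have c: "continuous_on UNIV (\<lambda>u. Re (D u))" by (intro continuous_intros D)
    have "integral {0..1} (\<lambda>u. Re (D u * of_real (Re (D u)))) = Re (integral {0..1} (\<lambda>u. D u * of_real (Re (D u))))"
      using integral_linear[OF int[OF c] bounded_linear_Re] by (simp add: o_def)
    also have "integral {0..1} (\<lambda>u. D u * of_real (Re (D u))) = 0"
      by (rule real_part_annihilated[OF D' coeff c]) (simp add: per)
    finally show ?thesis by simp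
  qed
  have Im0: "integral {0..1} (\<lambda>u. Im (D u) * Im (D u)) = 0"
  proof -
    have c: "continuous_on UNIV (\<lambda>u. Im (D u))" by (intro continuous_intros D)
    have "integral {0..1} (\<lambda>u. Im (D u * of_real (Im (D u)))) = Im (integral {0..1} (\<lambda>u. D u * of_real (Im (D u))))"
      using integral_linear[OF int[OF c] bounded_linear_Im] by (simp add: o_def)
    also have "integral {0..1} (\<lambda>u. D u * of_real (Im (D u))) = 0"
      by (rule real_part_annihilated[OF D' coeff c]) (simp add: per)
    finally show ?thesis by simp
  qed
  have D01: "D u = 0" if "u \<in> {0..1}" for u
    using zero[OF that _ Re0] zero[OF that _ Im0] D' by (auto simp: complex_eq_iff intro!: continuous_intros)
  have per_int: "D (u + of_int z) = D u" for u and z :: int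
    by (rule periodic_of_int) (rule per)
  have "D (frac u + of_int \<lfloor>u\<rfloor>) = D (frac u)" by (rule per_int)
  also have "frac u + of_int \<lfloor>u\<rfloor> = u" by (simp add: frac_def)
  also have "D (frac u) = 0" using frac_lt_1[of u] frac_ge_0[of u] by (intro D01) auto
  finally show ?thesis .
qed

section \<open>The log-gamma kernel and Poisson summation\<close>

definition log_gamma_kernel :: "real \<Rightarrow> real \<Rightarrow> real" where
  "log_gamma_kernel a x = exp (- a * x - exp (- x))"

lemma log_gamma_kernel_pos: "log_gamma_kernel a x > 0" by (simp add: log_gamma_kernel_def)

lemma continuous_on_log_gamma_kernel [continuous_intros]:
  "continuous_on S f \<Longrightarrow> continuous_on S (\<lambda>x. log_gamma_kernel a (f x))"
  unfolding log_gamma_kernel_def by (intro continuous_intros)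

text \<open>
  Substitute \<open>t = exp (-x)\<close> in Euler's integral for \<open>\<Gamma>(z)\<close>. The real linear functional \<open>L\<close> stands for the
  real or the imaginary part, each of which is a change of variables for a real function.
\<close>

lemma log_gamma_substitution:
  fixes L :: "complex \<Rightarrow> real"
  assumes L: "bounded_linear L" and z: "Re z > 0"
  shows "(\<lambda>x. L (exp (- z * of_real x - of_real (exp (- x))))) absolutely_integrable_on UNIV"
    and "integral UNIV (\<lambda>x. L (exp (- z * of_real x - of_real (exp (- x))))) = L (Gamma z)"
proof -
  interpret bounded_linear L by fact
  define f where "f t = L (of_real t powr (z - 1) / of_real (exp t))" for t :: real
  have f1: "f absolutely_integrable_on {0<..}"
    unfolding f_def using absolutely_integrable_linear[OF absolutely_integrable_Gamma_integral'[OF z] L] by (simp add: o_def)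
  have f2: "integral {0<..} f = L (Gamma z)"
    unfolding f_def using has_integral_linear[OF Gamma_integral_complex'[OF z] L] by (simp add: o_def integral_unique)
  have img: "(\<lambda>x::real. exp (- x)) ` UNIV = {0<..}"
  proof (intro equalityI subsetI)
    fix y :: real assume "y \<in> {0<..}"
    hence "y = exp (- (- ln y))" by simp
    thus "y \<in> (\<lambda>x::real. exp (- x)) ` UNIV" by blast
  qed auto
  have eq: "\<bar>- exp (- x)\<bar> * f (exp (- x)) = L (exp (- z * of_real x - of_real (exp (- x))))" for x :: real
  proof -
    have "of_real (exp (- x)) powr (z - 1) = exp ((z - 1) * of_real (- x))"
      by (simp add: powr_def Ln_of_real)
    moreover have "of_real (exp (- x)) = exp (- (of_real x :: complex))" by (metis exp_of_real of_real_minus)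
    moreover have "of_real (exp (exp (- x))) = exp (of_real (exp (- x)) :: complex)" by (simp only: exp_of_real)
    ultimately have "of_real (exp (- x)) * (of_real (exp (- x)) powr (z - 1) / of_real (exp (exp (- x)))) =
        exp (- of_real x) * (exp ((z - 1) * of_real (- x)) / exp (of_real (exp (- x))))" by metis
    also have "\<dots> = exp (- of_real x + (z - 1) * of_real (- x) - of_real (exp (- x)))" by (simp only: exp_add exp_diff times_divide_eq_right)
    also have "- of_real x + (z - 1) * of_real (- x) - of_real (exp (- x)) = - z * of_real x - of_real (exp (- x))"
      by (simp add: algebra_simps)
    finally have "of_real (exp (- x)) * (of_real (exp (- x)) powr (z - 1) / of_real (exp (exp (- x)))) = exp (- z * of_real x - of_real (exp (- x)))" .
    hence "L (exp (- z * of_real x - of_real (exp (- x)))) = L (exp (- x) *\<^sub>R (of_real (exp (- x)) powr (z - 1) / of_real (exp (exp (- x)))))"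
      by (simp add: scaleR_conv_of_real)
    thus ?thesis by (simp add: f_def scaleR)
  qed
  have "(\<lambda>x. \<bar>- exp (- x)\<bar> * f (exp (- x))) absolutely_integrable_on UNIV \<and>
           integral UNIV (\<lambda>x. \<bar>- exp (- x)\<bar> * f (exp (- x))) = L (Gamma z)"
    by (subst has_absolute_integral_change_of_variables_1'[where g = "\<lambda>x. exp (- x)"])
       (use f1 f2 img in \<open>auto intro!: derivative_eq_intros simp: inj_on_def\<close>)
  thus "(\<lambda>x. L (exp (- z * of_real x - of_real (exp (- x))))) absolutely_integrable_on UNIV"
    and "integral UNIV (\<lambda>x. L (exp (- z * of_real x - of_real (exp (- x))))) = L (Gamma z)"
    unfolding eq by auto
qed

lemma log_gamma_kernel_cis:
  "exp (- (of_real a - \<i> * of_real w) * of_real x - of_real (exp (- x))) = of_real (log_gamma_kernel a x) * exp (\<i> * of_real (w * x))"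
  by (simp add: log_gamma_kernel_def algebra_simps flip: exp_of_real exp_add)

lemma log_gamma_has_integral:
  assumes a: "a > 0"
  shows "((\<lambda>x. of_real (log_gamma_kernel a x) * exp (\<i> * of_real (w * x))) has_integral Gamma (of_real a - \<i> * of_real w)) UNIV"
proof -
  define z where "z = of_real a - \<i> * of_real w"
  have z: "Re z > 0" using a by (simp add: z_def)
  define f where "f x = exp (- z * of_real x - of_real (exp (- x)))" for x :: real
  have Re: "((\<lambda>x. Re (f x)) has_integral Re (Gamma z)) UNIV"
    using log_gamma_substitution[OF bounded_linear_Re z] unfolding f_def
    by (metis absolutely_integrable_on_def integrable_integral)
  have Im: "((\<lambda>x. Im (f x)) has_integral Im (Gamma z)) UNIV"
    using log_gamma_substitution[OF bounded_linear_Im z] unfolding f_def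
    by (metis absolutely_integrable_on_def integrable_integral)
  have "((\<lambda>x. of_real (Re (f x)) + \<i> * of_real (Im (f x))) has_integral of_real (Re (Gamma z)) + \<i> * of_real (Im (Gamma z))) UNIV"
    by (intro has_integral_add has_integral_mult_right)
       (use has_integral_linear[OF Re bounded_linear_of_real] has_integral_linear[OF Im bounded_linear_of_real] in \<open>auto simp: o_def\<close>)
  hence "(f has_integral Gamma z) UNIV" by (simp flip: complex_eq)
  thus ?thesis unfolding f_def z_def log_gamma_kernel_cis .
qed

lemma log_gamma_integrable:
  assumes a: "a > 0"
  shows "integrable lborel (log_gamma_kernel a)" "integral\<^sup>L lborel (log_gamma_kernel a) = Gamma a"
proof -
  have "(\<lambda>x. Re (exp (- of_real a * of_real x - of_real (exp (- x))))) absolutely_integrable_on UNIV"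
    by (rule log_gamma_substitution(1)[OF bounded_linear_Re, of "of_real a"]) (use a in simp)
  also have "(\<lambda>x. Re (exp (- of_real a * of_real x - of_real (exp (- x))))) = log_gamma_kernel a"
    using log_gamma_kernel_cis[of a 0] by (auto simp: fun_eq_iff)
  finally have "integrable lebesgue (log_gamma_kernel a)"
    by (simp add: set_integrable_def)
  moreover have meas: "log_gamma_kernel a \<in> borel_measurable lborel"
    unfolding log_gamma_kernel_def by measurable
  ultimately show int: "integrable lborel (log_gamma_kernel a)"
    by (simp add: integrable_completion)
  have "((\<lambda>x. log_gamma_kernel a x) has_integral Re (Gamma (of_real a))) UNIV"
    using has_integral_linear[OF log_gamma_has_integral[OF a, of 0] bounded_linear_Re] by (simp add: o_def)
  moreover have "(log_gamma_kernel a has_integral integral\<^sup>L lborel (log_gamma_kernel a)) UNIV"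
    by (rule has_integral_integral_lborel[OF int])
  ultimately show "integral\<^sup>L lborel (log_gamma_kernel a) = Gamma a"
    by (simp add: Gamma_complex_of_real) (metis has_integral_unique)
qed

lemma log_gamma_fourier:
  assumes a: "a > 0"
  shows "integrable lborel (\<lambda>x. of_real (log_gamma_kernel a x) * exp (\<i> * of_real (w * x)) :: complex)"
    and "integral\<^sup>L lborel (\<lambda>x. of_real (log_gamma_kernel a x) * exp (\<i> * of_real (w * x))) = Gamma (of_real a - \<i> * of_real w)"
proof -
  have [measurable]: "log_gamma_kernel a \<in> borel_measurable borel"
    unfolding log_gamma_kernel_def by measurable
  show int: "integrable lborel (\<lambda>x. of_real (log_gamma_kernel a x) * exp (\<i> * of_real (w * x)) :: complex)"
  proof (rule Bochner_Integration.integrable_bound[OF log_gamma_integrable(1)[OF a]])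
    show "(\<lambda>x. of_real (log_gamma_kernel a x) * exp (\<i> * of_real (w * x)) :: complex) \<in> borel_measurable lborel"
      by measurable
    show "AE x in lborel. norm (of_real (log_gamma_kernel a x) * exp (\<i> * of_real (w * x)) :: complex) \<le> norm (log_gamma_kernel a x)"
      by (simp only: norm_mult norm_exp_i_times) simp
  qed
  show "integral\<^sup>L lborel (\<lambda>x. of_real (log_gamma_kernel a x) * exp (\<i> * of_real (w * x))) = Gamma (of_real a - \<i> * of_real w)"
    by (rule has_integral_unique[OF has_integral_integral_lborel[OF int] log_gamma_has_integral[OF a]])
qed

lemma norm_Gamma_le: "a > 0 \<Longrightarrow> norm (Gamma (of_real a - \<i> * of_real w)) \<le> Gamma a"
proof -
  assume a: "a > 0"
  have "norm (Gamma (of_real a - \<i> * of_real w)) \<le> integral\<^sup>L lborel (\<lambda>x. norm (of_real (log_gamma_kernel a x) * exp (\<i> * of_real (w * x))))"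
    unfolding log_gamma_fourier(2)[OF a, symmetric] by (rule integral_norm_bound)
  also have "\<dots> = integral\<^sup>L lborel (log_gamma_kernel a)"
    by (intro Bochner_Integration.integral_cong refl) (simp only: norm_mult norm_exp_i_times, simp add: log_gamma_kernel_pos less_imp_le)
  finally show ?thesis using log_gamma_integrable(2)[OF a] by simp
qed

text \<open>
  Applying \<open>\<Gamma>(z+1) = z \<Gamma>(z)\<close> twice trades the bounded value \<open>\<Gamma>(z+2)\<close> for a factor
  \<open>\<bar>z (z+1)\<bar> \<ge> w\<^sup>2\<close>. Quadratic decay is enough for absolute convergence of the Fourier series.
\<close>

lemma norm_Gamma_decay:
  assumes a: "a > 0" and w: "w \<noteq> 0"
  shows "norm (Gamma (of_real a - \<i> * of_real w)) \<le> Gamma (a + 2) / w\<^sup>2"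
proof -
  define z where "z = of_real a - \<i> * of_real w"
  have z: "z \<notin> \<int>\<^sub>\<le>\<^sub>0" "z + 1 \<notin> \<int>\<^sub>\<le>\<^sub>0"
    using w by (auto simp: z_def complex_eq_iff elim!: nonpos_Ints_cases)
  have "Gamma (of_real (a + 2) - \<i> * of_real w) = Gamma (z + 1 + 1)" by (simp add: z_def algebra_simps)
  also have "\<dots> = (z + 1) * Gamma (z + 1)" by (rule Gamma_plus1[OF z(2)])
  also have "Gamma (z + 1) = z * Gamma z" by (rule Gamma_plus1[OF z(1)])
  finally have eq: "norm (Gamma (of_real (a + 2) - \<i> * of_real w)) = norm (z + 1) * norm z * norm (Gamma z)"
    by (simp add: norm_mult)
  have "\<bar>w\<bar> \<le> norm z" "\<bar>w\<bar> \<le> norm (z + 1)" using abs_Im_le_cmod[of z] abs_Im_le_cmod[of "z + 1"] by (auto simp: z_def)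
  hence "\<bar>w\<bar> * \<bar>w\<bar> * norm (Gamma z) \<le> norm (z + 1) * norm z * norm (Gamma z)"
    by (intro mult_right_mono mult_mono) auto
  also have "\<dots> \<le> Gamma (a + 2)" using norm_Gamma_le[of "a + 2" w] a eq by simp
  finally have "w\<^sup>2 * norm (Gamma z) \<le> Gamma (a + 2)" by (simp add: power2_eq_square)
  thus ?thesis using w by (simp add: z_def field_simps)
qed

lemma summable_on_int_halves:
  fixes f :: "int \<Rightarrow> real"
  assumes "(\<lambda>n::nat. f (int n)) summable_on UNIV" "(\<lambda>n::nat. f (- int n)) summable_on UNIV"
  shows "f summable_on UNIV"
proof -
  have "f summable_on range int" using assms(1) by (subst summable_on_reindex) (auto simp: o_def)
  moreover have "f summable_on range (\<lambda>n. - int n)" using assms(2) by (subst summable_on_reindex) (auto simp: o_def inj_on_def)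
  hence "f summable_on (range (\<lambda>n. - int n) - range int)" by (rule summable_on_subset_banach) auto
  ultimately have "f summable_on (range int \<union> (range (\<lambda>n. - int n) - range int))"
    by (rule summable_on_Un_disjoint) auto
  moreover have "range int \<union> (range (\<lambda>n. - int n) - range int) = UNIV"
  proof -
    have "z \<in> range int \<or> z \<in> range (\<lambda>n. - int n)" for z by (cases z rule: int_cases2) auto
    thus ?thesis by blast
  qed
  ultimately show ?thesis by simp
qed

lemma exp_abs_summable: "(\<lambda>z::int. exp (- \<bar>real_of_int z\<bar>)) summable_on UNIV"
proof (rule summable_on_int_halves)
  have "(\<lambda>n::nat. exp (- 1) ^ n :: real) summable_on UNIV"
    by (intro summable_nonneg_imp_summable_on summable_geometric) auto
  moreover have "exp (- 1) ^ n = exp (- \<bar>real_of_int (int n)\<bar>)" for n by (simp flip: exp_of_nat_mult)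
  ultimately show "(\<lambda>n. exp (- \<bar>real_of_int (int n)\<bar>)) summable_on UNIV"
    "(\<lambda>n. exp (- \<bar>real_of_int (- int n)\<bar>)) summable_on UNIV" by simp_all
qed

lemma inverse_square_summable: "(\<lambda>k::int. 1 / (real_of_int k)\<^sup>2) summable_on UNIV"
proof (rule summable_on_int_halves)
  have "summable (\<lambda>n. 1 / real n ^ 2)"
    using inverse_power_summable[of 2, where 'a=real] by (simp add: field_simps)
  hence "(\<lambda>n::nat. 1 / (real n)\<^sup>2) summable_on UNIV"
    by (intro summable_nonneg_imp_summable_on) auto
  thus "(\<lambda>n. 1 / (real_of_int (int n))\<^sup>2) summable_on UNIV"
    "(\<lambda>n. 1 / (real_of_int (- int n))\<^sup>2) summable_on UNIV" by simp_all
qed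

lemma fourier_series:
  fixes c :: "int \<Rightarrow> complex"
  assumes c: "(\<lambda>k. norm (c k)) summable_on UNIV"
  defines "S \<equiv> \<lambda>u. \<Sum>\<^sub>\<infinity>k. c k * char_fun k u"
  shows "((\<lambda>k. c k * char_fun k u) has_sum S u) UNIV"
    and "uniform_limit UNIV (\<lambda>F u. \<Sum>k\<in>F. c k * char_fun k u) S (finite_subsets_at_top UNIV)"
    and "continuous_on UNIV S" "S (u + 1) = S u" "fourier_coeff S k = c k"
proof -
  show "((\<lambda>k. c k * char_fun k u) has_sum S u) UNIV"
    unfolding S_def
    by (rule has_sum_infsum, rule abs_summable_summable) (use c in \<open>simp add: norm_mult\<close>)
  show ul: "uniform_limit UNIV (\<lambda>F u. \<Sum>k\<in>F. c k * char_fun k u) S (finite_subsets_at_top UNIV)"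
    unfolding S_def by (rule Weierstrass_m_test_general[OF _ c]) (simp add: norm_mult)
  show cont: "continuous_on UNIV S"
    by (rule uniform_limit_theorem[OF _ ul]) (auto intro!: always_eventually continuous_intros)
  show "S (u + 1) = S u" by (simp add: S_def char_fun_periodic)
  have ul': "uniform_limit {0..1} (\<lambda>F u. (\<Sum>l\<in>F. c l * char_fun l u) * char_fun (- k) u) (\<lambda>u. S u * char_fun (- k) u) (finite_subsets_at_top UNIV)"
  proof (rule uniform_lim_mult)
    show "uniform_limit {0..1} (\<lambda>F u. \<Sum>k\<in>F. c k * char_fun k u) S (finite_subsets_at_top UNIV)"
      using ul by (rule uniform_limit_on_subset) auto
    show "bounded (S ` {0..1})"
      by (intro compact_imp_bounded compact_continuous_image continuous_on_subset[OF cont]) auto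
    show "bounded (char_fun (- k) ` {0..1})" by (auto simp: bounded_iff)
  qed (rule uniform_limit_const)
  obtain I J where IJ: "\<And>F. ((\<lambda>u. (\<Sum>l\<in>F. c l * char_fun l u) * char_fun (- k) u) has_integral I F) {0..1}"
    "((\<lambda>u. S u * char_fun (- k) u) has_integral J) {0..1}" "(I \<longlongrightarrow> J) (finite_subsets_at_top UNIV)"
    by (rule uniform_limit_integral[OF ul']) (auto intro!: continuous_intros)
  have "I F = c k" if F: "finite F" "k \<in> F" for F
  proof -
    have "((\<lambda>u. \<Sum>l\<in>F. c l * char_fun (l - k) u) has_integral (\<Sum>l\<in>F. c l * (if l - k = 0 then 1 else 0))) {0..1}"
      by (intro has_integral_sum F has_integral_mult_right integral_char_fun)
    also have "(\<lambda>u. \<Sum>l\<in>F. c l * char_fun (l - k) u) = (\<lambda>u. (\<Sum>l\<in>F. c l * char_fun l u) * char_fun (- k) u)"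
      using char_fun_add[of _ "- k"] by (simp add: sum_distrib_right mult.assoc)
    also have "(\<Sum>l\<in>F. c l * (if l - k = 0 then 1 else 0)) = c k"
      using F by (simp add: if_distrib[of "\<lambda>x. c _ * x"] cong: if_cong)
    finally show ?thesis using IJ(1) has_integral_unique by blast
  qed
  hence "eventually (\<lambda>F. I F = c k) (finite_subsets_at_top UNIV)"
    unfolding eventually_finite_subsets_at_top by (intro exI[of _ "{k}"]) auto
  hence "(I \<longlongrightarrow> c k) (finite_subsets_at_top UNIV)" by (rule tendsto_eventually)
  hence "J = c k" using IJ(3) tendsto_unique[OF finite_subsets_at_top_neq_bot] by blast
  thus "fourier_coeff S k = c k" unfolding fourier_coeff_def using IJ(2) by (simp add: integral_unique)
qed

text \<open>
  To the left of \<open>0\<close> the double exponential wins: with \<open>y = exp (-x)\<close> the claim is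
  \<open>y^(j+1) exp (-y) \<le> (j+1)!\<close>, one term of the exponential series.
\<close>

lemma log_gamma_kernel_bound:
  assumes j: "j \<ge> 1"
  shows "log_gamma_kernel (real j) x \<le> fact (Suc j) * exp (- \<bar>x\<bar>)"
proof (cases "x \<ge> 0")
  case True
  have "log_gamma_kernel (real j) x \<le> exp (- x)"
  proof -
    have "x \<le> real j * x" using True j mult_right_mono[of 1 "real j" x] by simp
    hence "- real j * x - exp (- x) \<le> - x" using exp_ge_zero[of "- x"] by linarith
    thus ?thesis by (simp add: log_gamma_kernel_def)
  qed
  also have "\<dots> \<le> fact (Suc j) * exp (- x)"
    using fact_ge_1[of "Suc j", where 'a = real] by (simp del: fact_Suc)
  finally show ?thesis using True by simp
next
  case False
  define Y where "Y = exp (- x)"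
  have Y: "Y > 0" by (simp add: Y_def)
  have "(\<Sum>n\<in>{Suc j}. Y ^ n /\<^sub>R fact n) \<le> (\<Sum>n. Y ^ n /\<^sub>R fact n)"
    by (rule sum_le_suminf) (use Y summable_exp_generic[of Y] in auto)
  hence "Y ^ Suc j / fact (Suc j) \<le> exp Y" by (simp add: exp_def divide_inverse mult.commute del: fact_Suc power_Suc)
  hence "Y ^ Suc j * exp (- Y) \<le> fact (Suc j)"
    by (simp add: exp_minus field_simps del: fact_Suc power_Suc)
  hence "Y ^ Suc j * exp (- Y) * exp x \<le> fact (Suc j) * exp x" by (intro mult_right_mono) auto
  also have "Y ^ Suc j * exp (- Y) * exp x = log_gamma_kernel (real j) x"
    by (simp add: Y_def log_gamma_kernel_def algebra_simps flip: exp_add exp_of_nat_mult)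
  finally show ?thesis using False by simp
qed

definition log_gamma_lattice :: "nat \<Rightarrow> real \<Rightarrow> real" where
  "log_gamma_lattice j v = (\<Sum>\<^sub>\<infinity>z\<in>(UNIV::int set). log_gamma_kernel (real j) (of_int z - v))"

text \<open>
  For the coefficients, the integrals over \<open>[0,1]\<close> of the translates \<open>-K < z \<le> K\<close> add up to the integral of
  the kernel times the character over \<open>[-K,K]\<close>, because the character is invariant under integer shifts.
\<close>

lemma log_gamma_lattice:
  assumes j: "j \<ge> 1"
  shows "continuous_on UNIV (log_gamma_lattice j)" "log_gamma_lattice j (v + 1) = log_gamma_lattice j v"
    "fourier_coeff (\<lambda>v. of_real (log_gamma_lattice j v)) k = Gamma (of_nat j - \<i> * of_real (2 * pi * of_int k))"
proof -
  define g where "g = log_gamma_kernel (real j)"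
  define P where "P = log_gamma_lattice j"
  have ul: "uniform_limit {-B..B} (\<lambda>F v. \<Sum>z\<in>F. g (of_int z - v)) P (finite_subsets_at_top UNIV)" for B
    unfolding P_def log_gamma_lattice_def g_def
  proof (rule Weierstrass_m_test_general)
    show "(\<lambda>z::int. fact (Suc j) * exp B * exp (- \<bar>real_of_int z\<bar>)) summable_on UNIV"
      by (intro summable_on_cmult_right exp_abs_summable)
    fix z :: int and v assume v: "v \<in> {-B..B}"
    have "norm (log_gamma_kernel (real j) (of_int z - v)) = log_gamma_kernel (real j) (of_int z - v)"
      using log_gamma_kernel_pos[of "real j"] by (simp add: less_imp_le)
    also have "\<dots> \<le> fact (Suc j) * exp (- \<bar>of_int z - v\<bar>)" by (rule log_gamma_kernel_bound[OF j])
    also have "\<dots> \<le> fact (Suc j) * exp (B - \<bar>of_int z\<bar>)"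
      using v by (intro mult_left_mono) auto
    finally show "norm (log_gamma_kernel (real j) (of_int z - v)) \<le> fact (Suc j) * exp B * exp (- \<bar>of_int z\<bar>)"
      by (simp add: exp_diff exp_minus field_simps del: fact_Suc)
  qed
  have cont_B: "continuous_on {-B..B} P" for B
    by (rule uniform_limit_theorem[OF _ ul]) (auto intro!: always_eventually continuous_intros simp: g_def)
  have "isCont P v" for v
  proof (rule continuous_on_interior[OF cont_B[of "\<bar>v\<bar> + 1"]])
    show "v \<in> interior {- (\<bar>v\<bar> + 1)..\<bar>v\<bar> + 1}" by (auto simp: abs_if)
  qed
  hence cont: "continuous_on UNIV P" by (simp add: continuous_on_eq_continuous_at)
  thus "continuous_on UNIV (log_gamma_lattice j)" by (simp add: P_def)
  have "(\<Sum>\<^sub>\<infinity>z. g (of_int z - (v + 1))) = (\<Sum>\<^sub>\<infinity>z\<in>UNIV. g (of_int (z - 1) - v))" by (simp add: algebra_simps)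
  also have "\<dots> = (\<Sum>\<^sub>\<infinity>z. g (of_int z - v))"
    by (rule infsum_reindex_bij_betw[of "\<lambda>z. z - 1" UNIV UNIV "\<lambda>z. g (of_int z - v)"])
       (auto intro!: bij_betwI[of _ _ _ "\<lambda>z. z + 1"])
  finally show "log_gamma_lattice j (v + 1) = log_gamma_lattice j v" by (simp add: log_gamma_lattice_def g_def)

  have ul': "uniform_limit {0..1} (\<lambda>F u. of_real (\<Sum>z\<in>F. g (of_int z - u)) * char_fun (- k) u) (\<lambda>u. of_real (P u) * char_fun (- k) u) (finite_subsets_at_top UNIV)"
  proof (rule uniform_lim_mult)
    show "uniform_limit {0..1} (\<lambda>F u. complex_of_real (\<Sum>z\<in>F. g (of_int z - u))) (\<lambda>u. of_real (P u)) (finite_subsets_at_top UNIV)"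
      by (rule bounded_linear.uniform_limit[OF bounded_linear_of_real], rule uniform_limit_on_subset[OF ul[of 1]]) auto
    have "continuous_on {0..1} (\<lambda>u. complex_of_real (P u))"
      by (intro continuous_intros continuous_on_subset[OF cont]) auto
    thus "bounded ((\<lambda>u. complex_of_real (P u)) ` {0..1})"
      by (intro compact_imp_bounded compact_continuous_image) auto
    show "bounded (char_fun (- k) ` {0..1})" by (auto simp: bounded_iff)
  qed (rule uniform_limit_const)
  obtain I J where IJ: "\<And>F. ((\<lambda>u. of_real (\<Sum>z\<in>F. g (of_int z - u)) * char_fun (- k) u) has_integral I F) {0..1}"
    "((\<lambda>u. of_real (P u) * char_fun (- k) u) has_integral J) {0..1}" "(I \<longlongrightarrow> J) (finite_subsets_at_top UNIV)"
    by (rule uniform_limit_integral[OF ul']) (auto intro!: continuous_intros simp: g_def)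
  define h where "h x = of_real (g x) * char_fun k x" for x
  have h_cont: "continuous_on S h" for S unfolding h_def g_def by (intro continuous_intros)
  \<comment> \<open>The reflection \<open>u \<mapsto> z - u\<close> maps \<open>[0,1]\<close> to \<open>[z - 1, z]\<close> and turns the conjugate character into the character.\<close>
  have piece: "((\<lambda>u. of_real (g (of_int z - u)) * char_fun (- k) u) has_integral integral {of_int z - 1..of_int z} h) {0..1}" for z :: int
  proof -
    have "(h has_integral integral {of_int z - 1..of_int z} h) (cbox (of_int z - 1) (of_int z))"
      using integrable_integral[OF integrable_continuous_interval[OF h_cont]] by simp
    from has_integral_affinity[OF this, of "-1" "of_int z"]
    have "((\<lambda>u. h (of_int z - u)) has_integral integral {of_int z - 1..of_int z} h) {0..1}"
      by (simp add: image_affinity_atLeastAtMost_diff algebra_simps)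
    moreover have "h (of_int z - u) = of_real (g (of_int z - u)) * char_fun (- k) u" for u
    proof -
      have "char_fun k (of_int z - u) = char_fun k (of_int z) * char_fun k (- u)" using char_fun_plus[of k "of_int z" "- u"] by simp
      also have "char_fun k (- u) = char_fun (- k) u" by (simp add: char_fun_def)
      finally show ?thesis by (simp add: h_def char_fun_int)
    qed
    ultimately show ?thesis by simp
  qed
  have I_eq: "I {- int K<..int K} = integral {- real K..real K} h" for K
  proof -
    have "((\<lambda>u. \<Sum>z\<in>{- int K<..int K}. of_real (g (of_int z - u)) * char_fun (- k) u) has_integral
           (\<Sum>z\<in>{- int K<..int K}. integral {of_int z - 1..of_int z} h)) {0..1}"
      by (intro has_integral_sum piece) auto
    hence "((\<lambda>u. of_real (\<Sum>z\<in>{- int K<..int K}. g (of_int z - u)) * char_fun (- k) u) has_integral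
           (\<Sum>z\<in>{- int K<..int K}. integral {of_int z - 1..of_int z} h)) {0..1}"
      by (simp add: sum_distrib_right)
    hence "I {- int K<..int K} = (\<Sum>z\<in>{- int K<..int K}. integral {of_int z - 1..of_int z} h)"
      using IJ(1) has_integral_unique by blast
    also have "\<dots> = integral {- real K..real K} h"
    proof (induction K)
      case (Suc K)
      have "{- int (Suc K)<..int (Suc K)} = insert (- int K) (insert (int K + 1) {- int K<..int K})" by auto
      hence "(\<Sum>z\<in>{- int (Suc K)<..int (Suc K)}. integral {of_int z - 1..of_int z} h) =
         integral {- real K - 1..- real K} h + (integral {real K..real K + 1} h + integral {- real K..real K} h)"
        using Suc by simp
      also have "integral {real K..real K + 1} h + integral {- real K..real K} h = integral {- real K..real K + 1} h"
        by (subst add.commute, rule Henstock_Kurzweil_Integration.integral_combine) (auto intro!: integrable_continuous_interval h_cont)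
      also have "integral {- real K - 1..- real K} h + integral {- real K..real K + 1} h = integral {- real K - 1..real K + 1} h"
        by (rule Henstock_Kurzweil_Integration.integral_combine) (auto intro!: integrable_continuous_interval h_cont)
      also have "- real K - 1 = - real (Suc K)" by simp
      also have "real K + 1 = real (Suc K)" by simp
      finally show ?case .
    qed simp
    finally show ?thesis .
  qed
  have "filterlim (\<lambda>K. {- int K<..int K}) (finite_subsets_at_top UNIV) sequentially"
    unfolding filterlim_finite_subsets_at_top
  proof safe
    fix X :: "int set" assume X: "finite X"
    define B where "B = Max (insert 0 (abs ` X)) + 1"
    have "\<bar>x\<bar> < B" if "x \<in> X" for x using X that by (simp add: B_def le_imp_less_Suc)
    hence "\<And>K x. nat B \<le> K \<Longrightarrow> x \<in> X \<Longrightarrow> x \<in> {- int K<..int K}" by fastforce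
    thus "\<forall>\<^sub>F y in sequentially. finite {- int y<..int y} \<and> X \<subseteq> {- int y<..int y} \<and> {- int y<..int y} \<subseteq> UNIV"
      by (auto intro!: eventually_sequentiallyI[of "nat B"])
  qed
  from filterlim_compose[OF IJ(3) this] have lim1: "(\<lambda>K. integral {- real K..real K} h) \<longlonglongrightarrow> J"
    by (simp add: I_eq)
  have "(h has_integral Gamma (of_nat j - \<i> * of_real (2 * pi * of_int k))) UNIV"
  proof -
    have "h = (\<lambda>x. of_real (log_gamma_kernel (real j) x) * exp (\<i> * of_real ((2 * pi * of_int k) * x)))"
      by (simp add: h_def g_def char_fun_def mult_ac fun_eq_iff)
    thus ?thesis using log_gamma_has_integral[of "real j" "2 * pi * of_int k"] j by simp
  qed
  hence alt: "\<And>e. e > 0 \<Longrightarrow> \<exists>B>0. \<forall>a b. ball 0 B \<subseteq> cbox a b \<longrightarrow> norm (integral (cbox a b) h - Gamma (of_nat j - \<i> * of_real (2 * pi * of_int k))) < e"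
    by (subst (asm) has_integral_alt') auto
  have lim2: "(\<lambda>K. integral {- real K..real K} h) \<longlonglongrightarrow> Gamma (of_nat j - \<i> * of_real (2 * pi * of_int k))"
  proof (rule LIMSEQ_I)
    fix e :: real assume "e > 0"
    then obtain B where B: "B > 0" "\<And>a b. ball 0 B \<subseteq> cbox a b \<Longrightarrow> norm (integral (cbox a b) h - Gamma (of_nat j - \<i> * of_real (2 * pi * of_int k))) < e"
      using alt by blast
    have "norm (integral {- real K..real K} h - Gamma (of_nat j - \<i> * of_real (2 * pi * of_int k))) < e" if "K \<ge> nat \<lceil>B\<rceil>" for K
    proof -
      have "B \<le> real K" using that by linarith
      hence "ball 0 B \<subseteq> cbox (- real K) (real K)" by (auto simp: dist_real_def)
      thus ?thesis using B(2)[of "- real K" "real K"] by simp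
    qed
    thus "\<exists>no. \<forall>K\<ge>no. norm (integral {- real K..real K} h - Gamma (of_nat j - \<i> * of_real (2 * pi * of_int k))) < e" by blast
  qed
  have "J = Gamma (of_nat j - \<i> * of_real (2 * pi * of_int k))" by (rule LIMSEQ_unique[OF lim1 lim2])
  thus "fourier_coeff (\<lambda>v. of_real (log_gamma_lattice j v)) k = Gamma (of_nat j - \<i> * of_real (2 * pi * of_int k))"
    unfolding fourier_coeff_def using IJ(2) by (simp add: integral_unique P_def)
qed

definition lattice_coeff :: "nat \<Rightarrow> int \<Rightarrow> complex" where
  "lattice_coeff j k = Gamma (of_nat j - \<i> * of_real (2 * pi * of_int k))"

lemma lattice_coeff_summable:
  assumes j: "j \<ge> 1"
  shows "(\<lambda>k. norm (lattice_coeff j k)) summable_on UNIV"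
proof -
  define b where "b k = (if k = 0 then norm (lattice_coeff j 0) else 0) + Gamma (real j + 2) / (2 * pi)\<^sup>2 * (1 / (real_of_int k)\<^sup>2)" for k
  have "(\<lambda>k::int. if k = 0 then norm (lattice_coeff j 0) else 0) summable_on {0}" by (rule summable_on_finite) simp
  hence "(\<lambda>k::int. if k = 0 then norm (lattice_coeff j 0) else 0) summable_on UNIV"
    by (rule summable_on_cong_neutral[THEN iffD1, rotated -1]) auto
  hence "b summable_on UNIV" unfolding b_def
    by (intro summable_on_add summable_on_cmult_right inverse_square_summable)
  thus ?thesis
  proof (rule summable_on_comparison_test)
    fix k :: int
    show "norm (lattice_coeff j k) \<le> b k"
    proof (cases "k = 0")
      case False
      have "norm (lattice_coeff j k) \<le> Gamma (real j + 2) / (2 * pi * of_int k)\<^sup>2"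
        using norm_Gamma_decay[of "real j" "2 * pi * of_int k"] j False by (simp add: lattice_coeff_def)
      thus ?thesis using False by (simp add: b_def power_mult_distrib)
    qed (simp add: b_def)
  qed auto
qed

text \<open>
  Poisson summation: both sides are continuous, periodic, and have the same Fourier coefficients.
\<close>

theorem log_gamma_lattice_fourier:
  assumes j: "j \<ge> 1"
  shows "((\<lambda>k. lattice_coeff j k * char_fun k u) has_sum of_real (log_gamma_lattice j u)) UNIV"
    and "uniform_limit UNIV (\<lambda>F u. \<Sum>k\<in>F. lattice_coeff j k * char_fun k u) (\<lambda>u. of_real (log_gamma_lattice j u)) (finite_subsets_at_top UNIV)"
proof -
  define S where "S u = (\<Sum>\<^sub>\<infinity>k. lattice_coeff j k * char_fun k u)" for u
  note FS = fourier_series[OF lattice_coeff_summable[OF j], folded S_def]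
  define P where "P u = complex_of_real (log_gamma_lattice j u)" for u
  have P: "continuous_on UNIV P" unfolding P_def by (intro continuous_intros log_gamma_lattice j)
  have "P u - S u = 0" for u
  proof (rule fourier_unique)
    show "continuous_on UNIV (\<lambda>u. P u - S u)" by (intro continuous_intros P FS)
    show "P (u + 1) - S (u + 1) = P u - S u" for u using FS(4) log_gamma_lattice(2)[OF j] by (simp add: P_def)
    show "fourier_coeff (\<lambda>u. P u - S u) k = 0" for k
    proof -
      have "continuous_on {0..1} P" "continuous_on {0..1} S"
        using P FS(3) by (auto intro: continuous_on_subset)
      hence "fourier_coeff (\<lambda>u. P u - S u) k = fourier_coeff P k - fourier_coeff S k"
        unfolding fourier_coeff_def
        by (subst integral_diff [symmetric]) (auto intro!: integrable_continuous_interval continuous_intros simp: algebra_simps)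
      thus ?thesis using FS(5)[of k] log_gamma_lattice(3)[OF j, of k] by (simp add: P_def[abs_def] lattice_coeff_def)
    qed
  qed
  hence "S = (\<lambda>u. of_real (log_gamma_lattice j u))" by (auto simp: P_def)
  thus "((\<lambda>k. lattice_coeff j k * char_fun k u) has_sum of_real (log_gamma_lattice j u)) UNIV"
    and "uniform_limit UNIV (\<lambda>F u. \<Sum>k\<in>F. lattice_coeff j k * char_fun k u) (\<lambda>u. of_real (log_gamma_lattice j u)) (finite_subsets_at_top UNIV)"
    using FS(1,2) by auto
qed

section \<open>Poisson weights\<close>

text \<open>
  The Poisson weight as an explicit function, so that it can be differentiated in \<open>t\<close>.
\<close>

definition poi :: "real \<Rightarrow> nat \<Rightarrow> real" where "poi t k = exp (- t) * t ^ k / fact k"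

definition poi_up :: "real \<Rightarrow> nat \<Rightarrow> real" where "poi_up t k = 1 - (\<Sum>i<k. poi t i)"

definition poi_low :: "real \<Rightarrow> nat \<Rightarrow> real" where "poi_low t m = (\<Sum>i\<le>m. poi t i)"

definition poi_mid :: "nat \<Rightarrow> real \<Rightarrow> nat \<Rightarrow> real" where
  "poi_mid m t k = (\<Sum>i\<in>{m<..<k}. poi t i)"

text \<open>
  For \<open>1 \<le> j < N\<close>, the probability that \<open>N\<close> independent Poisson variables of mean \<open>t\<close> all exceed \<open>m\<close> and
  that exactly \<open>j\<close> of them share the largest value \<open>k\<close>.
\<close>

definition max_mult_series :: "nat \<Rightarrow> nat \<Rightarrow> nat \<Rightarrow> real \<Rightarrow> real" where
  "max_mult_series m N j t = (\<Sum>k. real (N choose j) * poi t k ^ j * poi_mid m t k ^ (N - j))"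

lemma poi_nonneg: "t \<ge> 0 \<Longrightarrow> poi t k \<ge> 0" by (simp add: poi_def)

lemma poi_sums: "poi t sums 1"
proof -
  have "(\<lambda>k. exp (-t) * (t ^ k /\<^sub>R fact k)) sums (exp (-t) * exp t)"
    by (intro sums_mult exp_converges)
  thus ?thesis by (simp add: poi_def[abs_def] exp_minus field_simps)
qed

lemma poi_up_sums: "(\<lambda>i. poi t (i + k)) sums poi_up t k"
  unfolding poi_up_def by (rule sums_split_initial_segment[OF poi_sums])

lemma poi_up_nonneg: "t \<ge> 0 \<Longrightarrow> poi_up t k \<ge> 0"
  using sums_le[OF _ sums_zero poi_up_sums, of t k] poi_nonneg by auto

lemma poi_low_nonneg: "t \<ge> 0 \<Longrightarrow> poi_low t m \<ge> 0"
  by (simp add: poi_low_def sum_nonneg poi_nonneg)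

lemma poi_low_up: "poi_low t m = 1 - poi_up t (Suc m)"
  by (simp add: poi_low_def poi_up_def lessThan_Suc_atMost)

lemma poi_low_le_1: "t \<ge> 0 \<Longrightarrow> poi_low t m \<le> 1"
  using poi_up_nonneg[of t "Suc m"] by (simp add: poi_low_up)

lemma poi_Suc: "poi t (Suc k) = poi t k * (t / real (Suc k))"
  by (simp add: poi_def field_simps)

text \<open>
  The left side is one term of the binomial expansion of \<open>(w+p)^N\<close>, and \<open>w^N\<close> is another one.
\<close>

lemma binomial_term_le_increment:
  fixes p w :: real
  assumes "p \<ge> 0" "w \<ge> 0" "1 \<le> j" "j \<le> N"
  shows "real (N choose j) * p ^ j * w ^ (N - j) \<le> (w + p) ^ N - w ^ N"
proof -
  have "(\<Sum>k\<in>{0,j}. real (N choose k) * p ^ k * w ^ (N - k)) \<le> (\<Sum>k\<le>N. real (N choose k) * p ^ k * w ^ (N - k))"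
    by (rule sum_mono2) (use assms in auto)
  also have "\<dots> = (p + w) ^ N" by (simp add: binomial_ring)
  finally show ?thesis using assms by (simp add: add.commute)
qed

lemma poi_mid_nonneg: "t \<ge> 0 \<Longrightarrow> poi_mid m t k \<ge> 0"
  by (simp add: poi_mid_def sum_nonneg poi_nonneg)

lemma poi_mid_Suc: "poi_mid m t (Suc k) = poi_mid m t k + (if m < k then poi t k else 0)"
proof -
  have "{m<..<Suc k} = (if m < k then insert k {m<..<k} else {m<..<k})" by auto
  thus ?thesis by (simp add: poi_mid_def)
qed

lemma poi_mid_eq_0: "k \<le> Suc m \<Longrightarrow> poi_mid m t k = 0"
  by (auto simp: poi_mid_def intro!: sum.neutral)

lemma poi_mid_eq: "m < k \<Longrightarrow> poi_mid m t k = 1 - (poi_low t m + poi_up t k)"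
proof -
  assume "m < k"
  hence "{..<k} = {..m} \<union> {m<..<k}" by auto
  hence "(\<Sum>i<k. poi t i) = (\<Sum>i\<in>{..m} \<union> {m<..<k}. poi t i)" by simp
  also have "\<dots> = poi_low t m + poi_mid m t k"
    unfolding poi_low_def poi_mid_def by (rule sum.union_disjoint) auto
  finally show ?thesis by (simp add: poi_up_def)
qed

lemma poi_mid_le: "t \<ge> 0 \<Longrightarrow> poi_mid m t k \<le> 1 - poi_low t m"
  using poi_mid_eq[of m k t] poi_mid_eq_0[of k m t] poi_up_nonneg[of t k] poi_low_le_1[of t m]
  by (cases "m < k") auto

text \<open>
  Having the maximum at \<open>k\<close> with multiplicity \<open>j\<close> is less likely than having the maximum at \<open>k\<close>, whose
  probability is an increment of \<open>poi_mid ^ N\<close>. Hence the series converges by telescoping. Its terms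
  with \<open>k \<le> m + 1\<close> vanish because \<open>j < N\<close>, so the sum may start at \<open>0\<close>.
\<close>

lemma max_mult_term_bounds:
  fixes t :: real and j N m :: nat
  assumes "t \<ge> 0" "1 \<le> j" "j < N"
  defines "f \<equiv> \<lambda>k. real (N choose j) * poi t k ^ j * poi_mid m t k ^ (N - j)"
  shows "0 \<le> f k" "f k \<le> poi_mid m t (Suc k) ^ N - poi_mid m t k ^ N" "f 0 = 0" "f sums max_mult_series m N j t"
    "max_mult_series m N j t \<le> (1 - poi_low t m) ^ N" "0 \<le> max_mult_series m N j t"
proof -
  show 0: "0 \<le> f k" for k unfolding f_def using assms by (intro mult_nonneg_nonneg zero_le_power poi_nonneg poi_mid_nonneg) auto
  show 1: "f k \<le> poi_mid m t (Suc k) ^ N - poi_mid m t k ^ N" for k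
  proof (cases "m < k")
    case True
    thus ?thesis unfolding poi_mid_Suc f_def
      using binomial_term_le_increment[of "poi t k" "poi_mid m t k" j N] assms poi_nonneg poi_mid_nonneg by auto
  next
    case False
    thus ?thesis using assms by (simp add: f_def poi_mid_eq_0 power_0_left)
  qed
  show "f 0 = 0" using assms by (simp add: f_def poi_mid_eq_0)
  have bd: "(\<Sum>i<k. f i) \<le> (1 - poi_low t m) ^ N" for k
  proof -
    have "(\<Sum>i<k. f i) \<le> (\<Sum>i<k. poi_mid m t (Suc i) ^ N - poi_mid m t i ^ N)"
      by (intro sum_mono 1)
    also have "\<dots> = poi_mid m t k ^ N - poi_mid m t 0 ^ N" by (rule sum_lessThan_telescope)
    also have "\<dots> \<le> (1 - poi_low t m) ^ N - 0"
      by (intro diff_mono power_mono poi_mid_le poi_mid_nonneg zero_le_power assms)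
    finally show ?thesis by simp
  qed
  hence summ: "summable f" by (intro summableI_nonneg_bounded 0)
  thus "f sums max_mult_series m N j t" unfolding max_mult_series_def f_def by (rule summable_sums)
  show "max_mult_series m N j t \<le> (1 - poi_low t m) ^ N"
    using suminf_le_const[OF summ bd] unfolding max_mult_series_def f_def .
  show "0 \<le> max_mult_series m N j t"
    using suminf_nonneg[OF summ 0] unfolding max_mult_series_def f_def .
qed

section \<open>Stirling asymptotics near the maximum\<close>

text \<open>
  The logarithmic error in \<open>n! \<approx> n^(n+1/2) exp (-n)\<close>.
\<close>

definition stirling_error :: "nat \<Rightarrow> real" where
  "stirling_error n = ln (fact n) - (real n + 1/2) * ln (real n) + real n"

text \<open>
  Consecutive differences are \<open>O(1/n\<^sup>2)\<close>.
\<close>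

lemma convergent_stirling_error: "convergent stirling_error"
proof -
  define d where "d n = (real n + 1/2) * ln (1 + 1 / real n) - 1" for n :: nat
  have "d \<in> O(\<lambda>n. 1 / real n ^ 2)"
    unfolding d_def by real_asymp
  moreover have "summable (\<lambda>n. 1 / real n ^ 2)"
    using inverse_power_summable[of 2, where 'a=real] by (simp add: field_simps)
  ultimately have "summable d"
    by (intro summable_comparison_test_bigo[where g = "\<lambda>n. 1 / real n ^ 2" and f = d]) simp_all
  hence "summable (\<lambda>n. d (Suc n))"
    by (subst summable_Suc_iff)
  hence "(\<lambda>n. \<Sum>i<n. d (Suc i)) \<longlonglongrightarrow> (\<Sum>i. d (Suc i))"
    by (rule summable_LIMSEQ)
  moreover have "d (Suc i) = stirling_error (Suc i) - stirling_error (Suc (Suc i))" for i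
  proof -
    have "ln (1 + 1 / real (Suc i)) = ln (real (Suc (Suc i))) - ln (real (Suc i))"
    proof -
      have "1 + 1 / real (Suc i) = real (Suc (Suc i)) / real (Suc i)" by (simp add: field_simps)
      thus ?thesis by (simp add: ln_div del: of_nat_Suc)
    qed
    moreover have "ln (fact (Suc (Suc i)) :: real) = ln (real (Suc (Suc i))) + ln (fact (Suc i))"
      by (subst fact_Suc) (simp add: ln_mult del: fact_Suc)
    moreover have "real (Suc (Suc i)) = real (Suc i) + 1" by simp
    moreover have "(a + 1/2) * (y - x) - 1 = z - (a + 1/2) * x + a - (y + z - (b + 1/2) * y + b)"
      if "b = a + 1" for a b x y z :: real
      using that by (simp add: field_simps)
    ultimately show ?thesis
      unfolding d_def stirling_error_def by metis
  qed
  hence "(\<Sum>i<n. d (Suc i)) = stirling_error (Suc 0) - stirling_error (Suc n)" for n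
    by (induction n) (auto simp: d_def)
  ultimately have "(\<lambda>n. stirling_error (Suc 0) - (stirling_error (Suc 0) - stirling_error (Suc n))) \<longlonglongrightarrow> stirling_error (Suc 0) - (\<Sum>i. d (Suc i))"
    by (intro tendsto_intros) simp
  hence "(\<lambda>n. stirling_error (Suc n)) \<longlonglongrightarrow> stirling_error (Suc 0) - (\<Sum>i. d (Suc i))"
    by simp
  hence "stirling_error \<longlonglongrightarrow> stirling_error (Suc 0) - (\<Sum>i. d (Suc i))"
    by (subst (asm) filterlim_sequentially_Suc)
  thus ?thesis by (auto simp: convergent_def)
qed

lemma wallis_product_fact:
  "(\<Prod>k=1..n. (4*real k^2) / (4*real k^2 - 1)) = 2 ^ (4*n) * fact n ^ 4 / (fact (2*n) ^ 2 * (2 * real n + 1))"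
proof (induction n)
  case (Suc n)
  have "(\<Prod>k=1..Suc n. (4*real k^2) / (4*real k^2 - 1)) =
     2 ^ (4*n) * fact n ^ 4 / (fact (2*n) ^ 2 * (2 * real n + 1)) * ((4*real (Suc n)^2) / (4*real (Suc n)^2 - 1))"
    using Suc by simp
  also have "4*real (Suc n)^2 - 1 = (2 * real n + 1) * (2 * real n + 3)"
    by (simp add: algebra_simps power2_eq_square)
  also have "2 ^ (4*n) * fact n ^ 4 / (fact (2*n) ^ 2 * (2 * real n + 1)) *
       ((4*real (Suc n)^2) / ((2 * real n + 1) * (2 * real n + 3))) =
     2 ^ (4*Suc n) * fact (Suc n) ^ 4 / (fact (2*Suc n) ^ 2 * (2 * real (Suc n) + 1))"
  proof -
    have 1: "(fact (2 * Suc n) :: real) = 2 * real (Suc n) * (2 * real n + 1) * fact (2*n)"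
      by (simp add: algebra_simps)
    have 2: "(fact (Suc n) :: real) = real (Suc n) * fact n" by simp
    show ?thesis unfolding 1 2
      by (simp add: divide_simps power_mult_distrib del: of_nat_Suc fact_Suc)
         (simp add: algebra_simps power4_eq_xxxx power2_eq_square power_add)
  qed
  finally show ?case .
qed auto

text \<open>
  The combination \<open>2 d\<^sub>n - d\<^sub>2\<^sub>n\<close> of the errors has the same limit as \<open>d\<^sub>n\<close> itself, and up to elementary terms it
  is half the logarithm of the \<open>n\<close>-th Wallis product.
\<close>

lemma stirling_ln_fact: "stirling_error \<longlonglongrightarrow> ln (2 * pi) / 2"
proof -
  obtain D where D: "stirling_error \<longlonglongrightarrow> D" using convergent_stirling_error by (auto simp: convergent_def)
  define W where "W n = (\<Prod>k=1..n. (4*real k^2) / (4*real k^2 - 1))" for n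
  have W: "W \<longlonglongrightarrow> pi / 2" unfolding W_def by (rule wallis)
  have "(\<lambda>n. ln (W n) / 2 + (ln (2 * real n + 1) / 2 + ln 2 / 2 - ln (real n) / 2)) \<longlonglongrightarrow> ln (pi/2) / 2 + ln 2"
    by (intro tendsto_add tendsto_divide tendsto_ln W) (auto, real_asymp)
  moreover have "eventually (\<lambda>n. ln (W n) / 2 + (ln (2 * real n + 1) / 2 + ln 2 / 2 - ln (real n) / 2)
       = 2 * stirling_error n - stirling_error (2 * n)) sequentially"
    using eventually_gt_at_top[of 0]
  proof eventually_elim
    case (elim n)
    have "ln (W n) = 4 * n * ln 2 + 4 * ln (fact n) - (2 * ln (fact (2*n)) + ln (2 * real n + 1))"
      unfolding W_def wallis_product_fact
      by (subst ln_div) (auto simp: ln_mult ln_realpow add_nonneg_pos)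
    thus ?case using elim unfolding stirling_error_def by (simp add: ln_mult algebra_simps)
  qed
  ultimately have "(\<lambda>n. 2 * stirling_error n - stirling_error (2 * n)) \<longlonglongrightarrow> ln (pi/2) / 2 + ln 2"
    using Lim_transform_eventually by fast
  moreover have "(\<lambda>n. 2 * stirling_error n - stirling_error (2 * n)) \<longlonglongrightarrow> 2 * D - D"
    by (intro tendsto_intros D filterlim_compose[OF D]) (auto intro!: filterlim_subseq simp: strict_mono_def)
  ultimately have "D = ln (pi/2) / 2 + ln 2" using LIMSEQ_unique by fastforce
  also have "ln (pi / 2) = ln pi - ln 2" by (simp add: ln_div)
  also have "(ln pi - ln 2) / 2 + ln 2 = (ln 2 + ln pi) / 2" by (simp add: field_simps)
  also have "ln 2 + ln pi = ln (2 * pi)" by (simp add: ln_mult)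
  finally show ?thesis using D by blast
qed

text \<open>
  The centring of the stopping time: about \<open>exp (-s)\<close> of the \<open>n\<close> processes are still at most \<open>m\<close> at time
  \<open>stop_scale m n + s\<close>.
\<close>

definition stop_scale :: "nat \<Rightarrow> nat \<Rightarrow> real" where
  "stop_scale m n = ln (real n) + real m * ln (ln (real n)) - ln (fact m)"

lemma stop_scale_at_top: "filterlim (\<lambda>n. stop_scale m n + s) at_top sequentially"
  unfolding stop_scale_def by real_asymp

lemma stop_scale_ratio: "(\<lambda>n. (stop_scale m n + s) / ln (real n)) \<longlonglongrightarrow> 1"
  unfolding stop_scale_def by real_asymp

text \<open>
  Here \<open>n exp (-t) = exp (-s) m! / L^m\<close> with \<open>L = ln n\<close> and \<open>t \<sim> L\<close>, so only the weight of order \<open>t^m\<close> survives.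
\<close>

lemma poi_stop_scale_le:
  assumes "i \<le> m"
  shows "(\<lambda>n. real n * poi (stop_scale m n + s) i) \<longlonglongrightarrow> (if i = m then exp (-s) else 0)"
proof -
  define R where "R n = (stop_scale m n + s) / ln (real n)" for n
  have R: "R \<longlonglongrightarrow> 1" using stop_scale_ratio by (simp add: R_def[abs_def])
  have "eventually (\<lambda>n. exp (-s) * fact m / fact i * R n ^ i * (1 / ln (real n)) ^ (m - i) =
       real n * poi (stop_scale m n + s) i) sequentially"
    using eventually_gt_at_top[of 3]
  proof eventually_elim
    case (elim n)
    have "1 < real n" using elim by simp
    hence L: "ln (real n) > 0" by simp
    have "exp (- (stop_scale m n + s)) = exp (-s) * fact m / (real n * ln (real n) ^ m)"
    proof -
      have "exp (- (stop_scale m n + s)) = exp (-s) * exp (ln (fact m)) / (exp (ln (real n)) * exp (real m * ln (ln (real n))))"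
        unfolding stop_scale_def by (simp add: exp_add exp_diff exp_minus field_simps)
      also have "exp (real m * ln (ln (real n))) = ln (real n) ^ m"
        using L by (simp add: exp_of_nat_mult)
      also have "exp (ln (real n)) = real n" using elim by simp
      finally show ?thesis by simp
    qed
    moreover have "ln (real n) ^ m = ln (real n) ^ (m - i) * ln (real n) ^ i"
      using assms by (simp flip: power_add)
    ultimately show ?case using L elim
      by (simp add: poi_def R_def power_divide field_simps)
  qed
  moreover have "(\<lambda>n. exp (-s) * fact m / fact i * R n ^ i * (1 / ln (real n)) ^ (m - i)) \<longlonglongrightarrow>
      exp (-s) * fact m / fact i * 1 ^ i * 0 ^ (m - i)"
    by (intro tendsto_intros R) real_asymp
  moreover have "exp (-s) * fact m / fact i * 1 ^ i * 0 ^ (m - i) = (if i = m then exp (-s) else 0)"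
    using assms by auto
  ultimately show ?thesis using Lim_transform_eventually by fastforce
qed

lemma poi_low_stop_scale: "(\<lambda>n. real n * poi_low (stop_scale m n + s) m) \<longlonglongrightarrow> exp (-s)"
proof -
  have "(\<lambda>n. \<Sum>i\<le>m. real n * poi (stop_scale m n + s) i) \<longlonglongrightarrow> (\<Sum>i\<le>m. if i = m then exp (-s) else 0)"
    by (intro tendsto_sum poi_stop_scale_le) auto
  thus ?thesis by (simp add: poi_low_def sum_distrib_left)
qed

lemma mult_ln_ratio_bounds:
  assumes "(k::real) > 0" "(T::real) > 0"
  shows "k - T \<le> k * ln (k / T)" "k * ln (k / T) \<le> k - T + (k - T)\<^sup>2 / T"
proof -
  have "ln (T / k) \<le> T / k - 1" using assms by (intro ln_le_minus_one) auto
  hence "1 - T / k \<le> ln (k / T)" using assms by (simp add: ln_div)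
  from mult_left_mono[OF this, of k] have "k * (1 - T / k) \<le> k * ln (k / T)"
    using assms by simp
  also have "k * (1 - T / k) = k - T" using assms by (simp add: field_simps)
  finally show "k - T \<le> k * ln (k / T)" .
  have "ln (k / T) \<le> k / T - 1" using assms by (intro ln_le_minus_one) auto
  from mult_left_mono[OF this, of k] show "k * ln (k / T) \<le> k - T + (k - T)\<^sup>2 / T"
    using assms by (simp add: field_simps power2_eq_square)
qed

lemma a_seq_alt:
  "a_seq m n = exp 1 * ln (real n) + ((exp 1 - 1) * real m - 1/2) * ln (ln (real n))
     - (ln (exp 1 - 1) + (exp 1 - 1) * ln (fact m) + (ln (2 * pi) + 1) / 2)"
proof -
  have 1: "exp (1::real) - 1 > 0" by simp
  have "ln ((exp 1 - 1) * (real (fact m) powr (exp 1 - 1)) * sqrt (2 * pi * exp 1)) =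
    ln (exp 1 - 1) + ln (real (fact m) powr (exp 1 - 1)) + ln (sqrt (2 * pi * exp 1))"
    using 1 by (subst ln_mult ln_mult_pos; simp)+
  also have "ln (sqrt (2 * pi * exp 1)) = (ln (2 * pi) + 1) / 2"
    by (simp add: ln_sqrt ln_mult)
  also have "ln (real (fact m) powr (exp 1 - 1)) = (exp 1 - 1) * ln (fact m)"
    by (simp add: ln_powr)
  finally show ?thesis by (simp add: a_seq_def Let_def)
qed

lemma a_seq_at_top: "filterlim (a_seq m) at_top sequentially"
proof -
  define c1 where "c1 = (exp 1 - 1) * real m - 1/2"
  define c2 where "c2 = ln (exp 1 - 1) + (exp 1 - 1) * ln (fact m) + (ln (2 * pi) + 1) / (2::real)"
  have "filterlim (\<lambda>n. exp 1 * ln (real n) + c1 * ln (ln (real n)) - c2) at_top sequentially"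
    by real_asymp
  thus ?thesis unfolding a_seq_alt[abs_def] c1_def c2_def .
qed

text \<open>
  Write \<open>k = e T + \<delta>\<close>. Since \<open>\<delta> = O(log T)\<close>, the bounds on \<open>k ln (k / (e T))\<close> give \<open>\<delta> + o(1)\<close> for it, and
  Stirling's formula turns \<open>ln (n p\<^sub>k)\<close> into explicit terms. The sequence \<open>a_seq\<close> is the one for which
  these terms add up to \<open>ln (e - 1) - x\<close>.
\<close>

lemma poi_near_max:
  fixes k :: "nat \<Rightarrow> nat" and s B :: real and m :: nat
  defines "x \<equiv> \<lambda>n. real (k n) - (a_seq m n + (exp 1 - 1) * s)"
  defines "T \<equiv> \<lambda>n. stop_scale m n + s"
  assumes bounded: "eventually (\<lambda>n. \<bar>x n\<bar> \<le> B) sequentially"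
  shows "(\<lambda>n. real (k n) / T n) \<longlonglongrightarrow> exp 1"
    and "filterlim k at_top sequentially"
    and "(\<lambda>n. real n * poi (T n) (k n) * exp (x n)) \<longlonglongrightarrow> exp 1 - 1"
proof -
  define c where "c = (real m + 1/2)"
  define d where "d = (exp 1 - 1) * s - exp 1 * s + exp 1 * ln (fact m)
     - (ln (exp 1 - 1) + (exp 1 - 1) * ln (fact m) + (ln (2 * pi) + 1) / (2::real))"
  define b where "b = ln (fact m) - s"
  have T_eq: "T n = ln (real n) + real m * ln (ln (real n)) - b" for n
    by (simp add: T_def stop_scale_def b_def)
  have T_top: "filterlim T at_top sequentially"
    unfolding T_def by (rule stop_scale_at_top)
  have k_eq: "real (k n) - exp 1 * T n = - c * ln (ln (real n)) + d + x n" for n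
    unfolding x_def a_seq_alt T_eq c_def d_def b_def by (simp add: algebra_simps)
  have x0: "(\<lambda>n. x n * y n) \<longlonglongrightarrow> 0" if "y \<longlonglongrightarrow> 0" for y
    by (rule lim_null_mult_left_bounded[where B = B, OF _ that]) (use bounded in auto)

  \<comment> \<open>\<open>D\<close> is \<open>\<delta> / sqrt T\<close>; it tends to \<open>0\<close> since \<open>\<delta>\<close> is of order \<open>log log n\<close> only.\<close>
  define D where "D n = (- c * ln (ln (real n)) + d) / sqrt (T n) + x n / sqrt (T n)" for n
  have D: "D \<longlonglongrightarrow> 0"
  proof -
    have "(\<lambda>n. (- c * ln (ln (real n)) + d) / sqrt (T n)) \<longlonglongrightarrow> 0"
      unfolding T_eq by real_asymp
    moreover have "(\<lambda>n. 1 / sqrt (T n)) \<longlonglongrightarrow> 0"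
      unfolding T_eq by real_asymp
    from x0[OF this] have "(\<lambda>n. x n / sqrt (T n)) \<longlonglongrightarrow> 0" by simp
    ultimately have "D \<longlonglongrightarrow> 0 + 0" unfolding D_def by (intro tendsto_add)
    thus ?thesis by simp
  qed
  have ev_T: "eventually (\<lambda>n. T n > 0) sequentially"
    using T_top by (auto simp: filterlim_at_top_dense)
  have D_eq: "real (k n) - exp 1 * T n = D n * sqrt (T n)" if "T n > 0" for n
    using that unfolding k_eq D_def by (simp add: field_simps)

  have "(\<lambda>n. exp 1 + D n * (1 / sqrt (T n))) \<longlonglongrightarrow> exp 1 + 0 * 0"
    by (intro tendsto_intros D) (unfold T_eq, real_asymp)
  moreover have "eventually (\<lambda>n. exp 1 + D n * (1 / sqrt (T n)) = real (k n) / T n) sequentially"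
    using ev_T
  proof eventually_elim
    case (elim n)
    have "real (k n) = exp 1 * T n + D n * sqrt (T n)" using D_eq[OF elim] by simp
    hence "real (k n) / T n = exp 1 + D n * (sqrt (T n) / T n)" using elim by (simp add: field_simps)
    also have "sqrt (T n) / T n = 1 / sqrt (T n)" using elim by (simp add: field_simps)
    finally show ?case by simp
  qed
  ultimately show kT: "(\<lambda>n. real (k n) / T n) \<longlonglongrightarrow> exp 1"
    using Lim_transform_eventually by fastforce

  have "filterlim (\<lambda>n. real (k n) / T n * T n) at_top sequentially"
    by (rule filterlim_tendsto_pos_mult_at_top[OF kT _ T_top]) simp
  moreover have "eventually (\<lambda>n. real (k n) / T n * T n = real (k n)) sequentially"
    using ev_T by eventually_elim auto
  ultimately have k_real: "filterlim (\<lambda>n. real (k n)) at_top sequentially"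
    using filterlim_cong by force
  thus k_top: "filterlim k at_top sequentially"
    by (simp add: filterlim_sequentially_iff_filterlim_real)

  define E where "E n = real (k n) * ln (real (k n) / (exp 1 * T n)) - (real (k n) - exp 1 * T n)" for n
  have ev_k: "eventually (\<lambda>n. k n > 0) sequentially"
    by (rule eventually_compose_filterlim[OF eventually_gt_at_top k_top])
  have E: "E \<longlonglongrightarrow> 0"
  proof (rule tendsto_sandwich)
    show "eventually (\<lambda>n. 0 \<le> E n) sequentially"
      using ev_T ev_k by eventually_elim (use mult_ln_ratio_bounds(1) in \<open>auto simp: E_def\<close>)
    show "eventually (\<lambda>n. E n \<le> D n ^ 2 / exp 1) sequentially"
      using ev_T ev_k
    proof eventually_elim
      case (elim n)
      have "E n \<le> (real (k n) - exp 1 * T n)\<^sup>2 / (exp 1 * T n)"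
        using mult_ln_ratio_bounds(2)[of "real (k n)" "exp 1 * T n"] elim by (simp add: E_def)
      also have "\<dots> = D n ^ 2 / exp 1" using elim by (simp add: D_eq power_mult_distrib)
      finally show ?case .
    qed
    have "(\<lambda>n. D n ^ 2 / exp 1) \<longlonglongrightarrow> 0 ^ 2 / exp 1" by (intro tendsto_intros D) auto
    thus "(\<lambda>n. D n ^ 2 / exp 1) \<longlonglongrightarrow> 0" by simp
  qed simp

  have "(\<lambda>n. (ln (ln (real n)) - ln (T n)) / 2 + ln (exp 1 - 1) + ln (2 * pi) / 2
       - E n - ln (real (k n) / T n / exp 1) / 2 - stirling_error (k n))
     \<longlonglongrightarrow> 0 + ln (exp 1 - 1) + ln (2 * pi) / 2 - 0 - ln (exp 1 / exp 1) / 2 - ln (2 * pi) / 2"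
  proof (intro tendsto_intros E kT filterlim_compose[OF stirling_ln_fact k_top])
    show "(\<lambda>n. (ln (ln (real n)) - ln (T n)) / 2) \<longlonglongrightarrow> 0"
      unfolding T_eq by real_asymp
  qed auto
  hence lim: "(\<lambda>n. (ln (ln (real n)) - ln (T n)) / 2 + ln (exp 1 - 1) + ln (2 * pi) / 2
       - E n - ln (real (k n) / T n / exp 1) / 2 - stirling_error (k n)) \<longlonglongrightarrow> ln (exp 1 - 1)"
    by simp
  have "eventually (\<lambda>n. exp ((ln (ln (real n)) - ln (T n)) / 2 + ln (exp 1 - 1) + ln (2 * pi) / 2
       - E n - ln (real (k n) / T n / exp 1) / 2 - stirling_error (k n)) = real n * poi (T n) (k n) * exp (x n)) sequentially"
    using ev_T ev_k eventually_gt_at_top[of 3]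
  proof eventually_elim
    case (elim n)
    have pos: "poi (T n) (k n) > 0" using elim by (simp add: poi_def)
    have lnk': "ln (real (k n) / (exp 1 * T n)) = ln (real (k n)) - ln (T n) - 1"
    proof -
      have "ln (exp 1 * T n) = ln (exp 1) + ln (T n)" by (rule ln_mult_pos) (use elim in auto)
      thus ?thesis using elim by (simp add: ln_div)
    qed
    have "real (k n) / T n / exp 1 = real (k n) / (exp 1 * T n)" by (simp add: field_simps)
    hence lnk: "ln (real (k n) / T n / exp 1) = ln (real (k n)) - ln (T n) - 1" by (simp only: lnk')
    have "ln (real n * poi (T n) (k n) * exp (x n)) = ln (real n) + ln (poi (T n) (k n)) + x n"
      using pos elim by (simp add: ln_mult)
    also have "ln (poi (T n) (k n)) = - T n + k n * ln (T n) - ln (fact (k n))"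
      using elim by (simp add: poi_def ln_div ln_mult ln_realpow)
    also have "ln (real n) + (- T n + k n * ln (T n) - ln (fact (k n))) + x n =
       (ln (ln (real n)) - ln (T n)) / 2 + ln (exp 1 - 1) + ln (2 * pi) / 2
       - E n - ln (real (k n) / T n / exp 1) / 2 - stirling_error (k n)"
      unfolding E_def stirling_error_def lnk lnk' x_def a_seq_alt
      by (simp add: T_eq b_def field_simps)
    finally show ?case using pos elim by (metis exp_ln mult_pos_pos exp_gt_zero of_nat_0_less_iff gr_implies_not0 gr0I)
  qed
  moreover have "(\<lambda>n. exp ((ln (ln (real n)) - ln (T n)) / 2 + ln (exp 1 - 1) + ln (2 * pi) / 2
       - E n - ln (real (k n) / T n / exp 1) / 2 - stirling_error (k n))) \<longlonglongrightarrow> exp (ln (exp 1 - 1))"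
    by (rule tendsto_exp[OF lim])
  ultimately have "(\<lambda>n. real n * poi (T n) (k n) * exp (x n)) \<longlonglongrightarrow> exp (ln (exp 1 - 1))"
    using Lim_transform_eventually by fast
  thus "(\<lambda>n. real n * poi (T n) (k n) * exp (x n)) \<longlonglongrightarrow> exp 1 - 1" by simp
qed

text \<open>
  Near \<open>k \<sim> e T\<close> the ratio of consecutive weights tends to \<open>1/e\<close> and is eventually at most \<open>1/2\<close>, so the
  tail behaves like a geometric series.
\<close>

lemma poi_up_ratio:
  fixes k :: "nat \<Rightarrow> nat" and T :: "nat \<Rightarrow> real"
  assumes kT: "(\<lambda>n. real (k n) / T n) \<longlonglongrightarrow> exp 1"
    and T: "filterlim T at_top sequentially"
  shows "(\<lambda>n. poi_up (T n) (k n) / poi (T n) (k n)) \<longlonglongrightarrow> exp 1 / (exp 1 - 1)"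
proof -
  define a where "a i n = poi (T n) (i + k n) / poi (T n) (k n)" for i n
  have ev_T: "eventually (\<lambda>n. T n > 0) sequentially"
    using T by (auto simp: filterlim_at_top_dense)
  have step: "a (Suc i) n = a i n * (T n / real (Suc (i + k n)))" for i n
    by (simp add: a_def poi_Suc field_simps)
  have ratio: "(\<lambda>n. T n / real (Suc (i + k n))) \<longlonglongrightarrow> exp (-1)" for i
  proof -
    have "(\<lambda>n. 1 / (real (k n) / T n + real (Suc i) * (1 / T n))) \<longlonglongrightarrow> 1 / (exp 1 + real (Suc i) * 0)"
    proof (intro tendsto_intros kT)
      show "(\<lambda>n. 1 / T n) \<longlonglongrightarrow> 0" using T by (intro tendsto_divide_0[OF tendsto_const]) (simp add: filterlim_at_top_imp_at_infinity)
    qed auto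
    moreover have "eventually (\<lambda>n. 1 / (real (k n) / T n + real (Suc i) * (1 / T n)) = T n / real (Suc (i + k n))) sequentially"
      using ev_T by eventually_elim (simp add: field_simps)
    ultimately have "(\<lambda>n. T n / real (Suc (i + k n))) \<longlonglongrightarrow> 1 / (exp 1 + real (Suc i) * 0)"
      using Lim_transform_eventually by fast
    thus ?thesis by (simp add: exp_minus inverse_eq_divide)
  qed
  have lim: "(\<lambda>n. a i n) \<longlonglongrightarrow> exp (-1) ^ i" for i
  proof (induction i)
    case 0
    have "eventually (\<lambda>n. a 0 n = exp (-1) ^ 0) sequentially"
      using ev_T by eventually_elim (simp add: a_def poi_def)
    thus ?case by (rule tendsto_eventually)
  next
    case (Suc i)
    have "(\<lambda>n. a i n * (T n / real (Suc (i + k n)))) \<longlonglongrightarrow> exp (-1) ^ i * exp (-1)"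
      by (rule tendsto_mult[OF Suc ratio])
    thus ?case by (simp only: step power_Suc2)
  qed
  have "eventually (\<lambda>n. real (k n) / T n > 2) sequentially"
    using exp_lower_Taylor_quadratic[of 1] by (intro order_tendstoD(1)[OF kT]) auto
  hence "eventually (\<lambda>n. \<forall>i. norm (a i n) \<le> (1/2) ^ i) sequentially"
    using ev_T
  proof eventually_elim
    case (elim n)
    have pos: "a i n \<ge> 0" for i using elim by (simp add: a_def poi_nonneg)
    have r: "T n / real (Suc (i + k n)) \<le> 1/2" for i
      using elim by (simp add: field_simps)
    have "a i n \<le> (1/2) ^ i" for i
    proof (induction i)
      case (Suc i)
      have "a i n * (T n / real (Suc (i + k n))) \<le> (1/2)^i * (1/2)"
        by (intro mult_mono Suc r) (use elim in auto)
      thus ?case by (simp add: step)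
    qed (simp add: a_def)
    thus ?case using pos by simp
  qed
  hence bound: "eventually (\<lambda>(i,n). norm (a i n) \<le> (1/2) ^ i) (at_top \<times>\<^sub>F sequentially)"
    by (intro eventually_mono[OF eventually_prod2[THEN iffD2]]) auto
  have "(\<lambda>n. suminf (\<lambda>i. a i n)) \<longlonglongrightarrow> suminf (\<lambda>i. exp (-1) ^ i :: real)"
    using tannerys_theorem[OF lim bound] by simp
  moreover have "suminf (\<lambda>i. exp (-1) ^ i :: real) = exp 1 / (exp 1 - 1)"
    by (subst suminf_geometric) (auto simp: exp_minus field_simps)
  moreover have "suminf (\<lambda>i. a i n) = poi_up (T n) (k n) / poi (T n) (k n)" for n
    unfolding a_def using sums_divide[OF poi_up_sums] by (simp add: sums_iff)
  ultimately show ?thesis by simp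
qed

lemma poi_up_near_max:
  fixes k :: "nat \<Rightarrow> nat" and s B :: real and m :: nat
  defines "x \<equiv> \<lambda>n. real (k n) - (a_seq m n + (exp 1 - 1) * s)"
  defines "T \<equiv> \<lambda>n. stop_scale m n + s"
  assumes bounded: "eventually (\<lambda>n. \<bar>x n\<bar> \<le> B) sequentially"
  shows "(\<lambda>n. real n * poi_up (T n) (k n) * exp (x n)) \<longlonglongrightarrow> exp 1"
proof -
  have near: "(\<lambda>n. real (k n) / T n) \<longlonglongrightarrow> exp 1"
      "(\<lambda>n. real n * poi (T n) (k n) * exp (x n)) \<longlonglongrightarrow> exp 1 - 1"
    using poi_near_max(1,3)[of k m s B] bounded unfolding x_def T_def by auto
  have T_top: "filterlim T at_top sequentially"
    unfolding T_def by (rule stop_scale_at_top)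
  have ev_T: "eventually (\<lambda>n. T n > 0) sequentially"
    using T_top by (auto simp: filterlim_at_top_dense)
  have "(\<lambda>n. (real n * poi (T n) (k n) * exp (x n)) * (poi_up (T n) (k n) / poi (T n) (k n)))
        \<longlonglongrightarrow> (exp 1 - 1) * (exp 1 / (exp 1 - 1))"
    by (intro tendsto_mult near(2) poi_up_ratio near(1) T_top)
  moreover have "eventually (\<lambda>n. (real n * poi (T n) (k n) * exp (x n)) * (poi_up (T n) (k n) / poi (T n) (k n))
      = real n * poi_up (T n) (k n) * exp (x n)) sequentially"
    using ev_T by eventually_elim (simp add: poi_def)
  ultimately show ?thesis using Lim_transform_eventually by fastforce
qed

text \<open>
  A form of \<open>(1 - y/n)^n \<rightarrow> exp (-y)\<close> in which \<open>y\<close> may vary with \<open>n\<close> without converging.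
\<close>

lemma power_one_minus_limit:
  fixes x y :: "nat \<Rightarrow> real"
  assumes x: "eventually (\<lambda>n. 0 \<le> x n \<and> x n \<le> 1) sequentially"
    and lim: "(\<lambda>n. real n * x n - y n) \<longlonglongrightarrow> 0" and y: "\<And>n. \<bar>y n\<bar> \<le> B"
  shows "(\<lambda>n. (1 - x n) ^ (n - c) - exp (- y n)) \<longlonglongrightarrow> 0"
proof -
  have y0: "(\<lambda>n. y n * z n) \<longlonglongrightarrow> 0" if "z \<longlonglongrightarrow> 0" for z
    by (rule lim_null_mult_left_bounded[where B = B, OF _ that]) (use y in auto)
  have inv: "(\<lambda>n. 1 / real n) \<longlonglongrightarrow> 0" by real_asymp
  have x0: "x \<longlonglongrightarrow> 0"
  proof -
    have "(\<lambda>n. (real n * x n - y n) * (1 / real n) + y n * (1 / real n)) \<longlonglongrightarrow> 0 * 0 + 0"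
      by (intro tendsto_intros lim y0 inv)
    moreover have "eventually (\<lambda>n. (real n * x n - y n) * (1 / real n) + y n * (1 / real n) = x n) sequentially"
      using eventually_gt_at_top[of 0] by eventually_elim (simp add: field_simps)
    ultimately show ?thesis using Lim_transform_eventually by fastforce
  qed
  have nxx: "(\<lambda>n. real n * x n * x n) \<longlonglongrightarrow> 0"
  proof -
    have "(\<lambda>n. (real n * x n - y n) * x n + y n * x n) \<longlonglongrightarrow> 0 * 0 + 0"
      by (intro tendsto_intros lim y0 x0)
    thus ?thesis by (simp add: algebra_simps)
  qed
  have 1: "(\<lambda>n. (1 - x n) ^ (n - c) - exp (- x n) ^ (n - c)) \<longlonglongrightarrow> 0"
  proof (rule Lim_null_comparison[OF _ nxx])
    show "eventually (\<lambda>n. norm ((1 - x n) ^ (n - c) - exp (- x n) ^ (n - c)) \<le> real n * x n * x n) sequentially"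
      using x
    proof eventually_elim
      case (elim n)
      have "norm ((1 - x n) ^ (n - c) - exp (- x n) ^ (n - c)) \<le> real (n - c) * norm (1 - x n - exp (- x n))"
        by (rule norm_power_diff) (use elim in auto)
      also have "norm (1 - x n - exp (- x n)) \<le> x n * x n"
      proof -
        have "1 - x n \<le> exp (- x n)" using exp_ge_add_one_self[of "- x n"] by simp
        moreover have "exp (- x n) \<le> 1 - x n + x n * x n"
        proof -
          have "exp (x n) \<ge> 1 + x n" by simp
          hence "exp (- x n) \<le> 1 / (1 + x n)" using elim by (simp add: exp_minus inverse_eq_divide frac_le)
          also have "\<dots> \<le> 1 - x n + x n * x n" using elim by (simp add: field_simps power2_eq_square)
          finally show ?thesis .
        qed
        ultimately show ?thesis by simp
      qed
      hence "real (n - c) * norm (1 - x n - exp (- x n)) \<le> real n * (x n * x n)"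
        by (intro mult_mono) auto
      finally show ?case by (simp add: mult.assoc)
    qed
  qed
  have 2: "(\<lambda>n. exp (- x n) ^ (n - c) - exp (- y n)) \<longlonglongrightarrow> 0"
  proof -
    have d: "(\<lambda>n. real (n - c) * x n - y n) \<longlonglongrightarrow> 0"
    proof -
      have "(\<lambda>n. (real n * x n - y n) - real c * x n) \<longlonglongrightarrow> 0 - real c * 0"
        by (intro tendsto_intros lim x0)
      moreover have "eventually (\<lambda>n. (real n * x n - y n) - real c * x n = real (n - c) * x n - y n) sequentially"
        using eventually_ge_at_top[of c] by eventually_elim (simp add: of_nat_diff algebra_simps)
      ultimately show ?thesis using Lim_transform_eventually by fastforce
    qed
    have "(\<lambda>n. exp (- (real (n - c) * x n - y n)) - 1) \<longlonglongrightarrow> exp (- 0) - 1"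
      by (intro tendsto_intros d)
    hence "(\<lambda>n. exp (- (real (n - c) * x n - y n)) - 1) \<longlonglongrightarrow> 0" by simp
    hence "(\<lambda>n. exp (- y n) * (exp (- (real (n - c) * x n - y n)) - 1)) \<longlonglongrightarrow> 0"
    proof (rule lim_null_mult_left_bounded[where B = "exp B", rotated])
      show "eventually (\<lambda>n. norm (exp (- y n)) \<le> exp B) sequentially"
        using y by (auto simp: abs_le_iff)
    qed
    moreover have "exp (- x n) ^ (n - c) - exp (- y n) = exp (- y n) * (exp (- (real (n - c) * x n - y n)) - 1)" for n
      by (simp add: algebra_simps flip: exp_add exp_of_nat_mult)
    ultimately show ?thesis by simp
  qed
  show ?thesis using tendsto_add[OF 1 2] by simp
qed

lemma sum_increments_int:
  fixes A :: "int \<Rightarrow> real"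
  assumes "lo \<le> hi"
  shows "(\<Sum>r\<in>{lo<..hi}. A r - A (r - 1)) = A hi - A lo"
  using assms
proof (induction hi rule: int_ge_induct)
  case (step i)
  have "{lo<..i+1} = insert (i+1) {lo<..i}" using step by auto
  thus ?case using step by simp
qed auto

text \<open>
  A nonnegative sequence dominated by the increments of a bounded function \<open>A\<close> has tails that are controlled,
  by telescoping, through the values of \<open>A\<close> at the two ends.
\<close>

lemma has_sum_increments_tail:
  fixes a A :: "int \<Rightarrow> real"
  assumes a: "\<And>r. 0 \<le> a r" "\<And>r. a r \<le> A r - A (r - 1)"
    and A: "\<And>r. 0 \<le> A r" "\<And>r. A r \<le> U" and sum: "(a has_sum S) UNIV" and K: "K \<ge> 0"
  shows "(\<Sum>r\<in>{-K<..K}. a r) \<le> S" "S \<le> (\<Sum>r\<in>{-K<..K}. a r) + A (-K) + U - A K"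
proof -
  show "(\<Sum>r\<in>{-K<..K}. a r) \<le> S"
    by (rule finite_sum_le_has_sum[OF sum]) (use a in auto)
  show "S \<le> (\<Sum>r\<in>{-K<..K}. a r) + A (-K) + U - A K"
  proof (rule has_sum_le_finite_sums[OF sum])
    fix F :: "int set" assume F: "finite F" "F \<subseteq> UNIV"
    obtain L where L: "L \<ge> K" "F \<subseteq> {-L<..L}"
    proof
      show "max K (Max (insert 0 (abs ` F)) + 1) \<ge> K" by simp
      have "\<bar>x\<bar> \<le> Max (insert 0 (abs ` F))" if "x \<in> F" for x
        using F that by (intro Max_ge) auto
      thus "F \<subseteq> {- max K (Max (insert 0 (abs ` F)) + 1)<..max K (Max (insert 0 (abs ` F)) + 1)}"
        by (fastforce simp: abs_le_iff)
    qed
    have le: "(\<Sum>r\<in>{lo<..hi}. a r) \<le> A hi - A lo" if "lo \<le> hi" for lo hi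
      using sum_mono[of "{lo<..hi}" a "\<lambda>r. A r - A (r - 1)"] a(2) sum_increments_int[OF that, of A] by simp
    have "sum a F \<le> sum a {-L<..L}"
      by (intro sum_mono2) (use L a in auto)
    also have "{-L<..L} = {-L<..-K} \<union> ({-K<..K} \<union> {K<..L})" using L K by auto
    also have "sum a \<dots> = sum a {-L<..-K} + (sum a {-K<..K} + sum a {K<..L})"
      using L K by (subst sum.union_disjoint; (subst sum.union_disjoint)?) auto
    also have "\<dots> \<le> (A (-K) - A (-L)) + (sum a {-K<..K} + (A L - A K))"
      using L K by (intro add_mono le order_refl) auto
    also have "\<dots> \<le> sum a {-K<..K} + A (-K) + U - A K"
      using A(1)[of "-L"] A(2)[of L] by simp
    finally show "sum a F \<le> sum a {-K<..K} + A (-K) + U - A K" .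
  qed
qed

text \<open>
  Termwise convergence of a difference implies convergence of the difference of the sums. Domination by a
  fixed summable sequence is replaced by domination by the increments of \<open>A n\<close> and \<open>B n\<close>, where only
  \<open>B\<close> is required to be tight: \<open>A\<close> inherits it.
\<close>

lemma series_difference_limit:
  fixes a b A B :: "nat \<Rightarrow> int \<Rightarrow> real" and U Sa Sb :: "nat \<Rightarrow> real"
  assumes a: "eventually (\<lambda>n. (\<forall>r. 0 \<le> a n r \<and> a n r \<le> A n r - A n (r - 1) \<and> 0 \<le> A n r \<and> A n r \<le> U n)
                \<and> (a n has_sum Sa n) UNIV) sequentially"
    and b: "\<And>n r. 0 \<le> b n r" "\<And>n r. b n r \<le> B n r - B n (r - 1)" "\<And>n r. 0 \<le> B n r" "\<And>n r. B n r \<le> U0"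
      "\<And>n. (b n has_sum Sb n) UNIV"
    and U: "U \<longlonglongrightarrow> U0"
    and ab: "\<And>r. (\<lambda>n. a n r - b n r) \<longlonglongrightarrow> 0" and AB: "\<And>r. (\<lambda>n. A n r - B n r) \<longlonglongrightarrow> 0"
    and tight: "\<And>e. e > 0 \<Longrightarrow> \<exists>K\<ge>0. \<forall>n. B n (-K) \<le> e \<and> U0 - e \<le> B n K"
  shows "(\<lambda>n. Sa n - Sb n) \<longlonglongrightarrow> 0"
proof (rule LIMSEQ_I)
  fix e :: real assume e: "e > 0"
  \<comment> \<open>The tails of \<open>B\<close> enter twice, and each has two ends.\<close>
  obtain K where K: "K \<ge> 0" "\<And>n. B n (-K) \<le> e / 8" "\<And>n. U0 - e / 8 \<le> B n K"
    using tight[of "e/8"] e by auto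
  \<comment> \<open>\<open>Z\<close> collects the errors inside the window and the errors made when the tail bounds for \<open>A\<close> are replaced by those for \<open>B\<close>.\<close>
  define Z where "Z n = (\<Sum>r\<in>{-K<..K}. \<bar>a n r - b n r\<bar>) + \<bar>A n (-K) - B n (-K)\<bar> + \<bar>A n K - B n K\<bar> + \<bar>U n - U0\<bar>" for n
  have "Z \<longlonglongrightarrow> (\<Sum>r\<in>{-K<..K}. \<bar>0\<bar>) + \<bar>0\<bar> + \<bar>0\<bar> + \<bar>U0 - U0\<bar>"
    unfolding Z_def by (intro tendsto_intros ab AB U)
  hence "Z \<longlonglongrightarrow> 0" by simp
  hence "eventually (\<lambda>n. Z n < e / 4) sequentially"
    using e by (intro order_tendstoD) auto
  hence "eventually (\<lambda>n. norm (Sa n - Sb n - 0) < e) sequentially"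
    using a
  proof eventually_elim
    case (elim n)
    have 1: "(\<Sum>r\<in>{-K<..K}. a n r) \<le> Sa n" "Sa n \<le> (\<Sum>r\<in>{-K<..K}. a n r) + A n (-K) + U n - A n K"
      using has_sum_increments_tail[of "a n" "A n" "U n" "Sa n" K] elim K by auto
    have 2: "(\<Sum>r\<in>{-K<..K}. b n r) \<le> Sb n" "Sb n \<le> (\<Sum>r\<in>{-K<..K}. b n r) + B n (-K) + U0 - B n K"
      using has_sum_increments_tail[of "b n" "B n" U0 "Sb n" K] b K by auto
    have 3: "\<bar>(\<Sum>r\<in>{-K<..K}. a n r) - (\<Sum>r\<in>{-K<..K}. b n r)\<bar> \<le> (\<Sum>r\<in>{-K<..K}. \<bar>a n r - b n r\<bar>)"
      unfolding sum_subtractf [symmetric] by (rule sum_abs)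
    show ?case using 1 2 3 K(2,3)[of n] elim(1) unfolding Z_def real_norm_def by linarith
  qed
  thus "\<exists>no. \<forall>n\<ge>no. norm (Sa n - Sb n - 0) < e" by (simp add: eventually_sequentially)
qed

text \<open>
  For a Poisson process of intensity \<open>exp (-x) dx\<close> this is the probability of finding \<open>j\<close> points in
  \<open>(x - 1, x]\<close> and none to the right of \<open>x\<close>.
\<close>

definition lattice_term :: "nat \<Rightarrow> real \<Rightarrow> real" where
  "lattice_term j x = ((exp 1 - 1) * exp (- x)) ^ j / fact j * exp (- exp (1 - x))"

definition lattice_sum :: "nat \<Rightarrow> real \<Rightarrow> real" where
  "lattice_sum j v = (\<Sum>\<^sub>\<infinity>z\<in>(UNIV::int set). lattice_term j (of_int z - v))"

lemma lattice_term_nonneg: "lattice_term j x \<ge> 0"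
proof -
  have "exp (1::real) - 1 \<ge> 0" by simp
  thus ?thesis unfolding lattice_term_def by (intro mult_nonneg_nonneg divide_nonneg_nonneg zero_le_power) auto
qed

text \<open>
  With \<open>y = (e - 1) exp (-x)\<close>, the increment is \<open>(exp y - 1) exp (- exp (1 - x))\<close>, and \<open>y^j / j!\<close> is one term of
  \<open>exp y - 1\<close>.
\<close>

lemma lattice_term_le_increment:
  assumes "1 \<le> j"
  shows "lattice_term j x \<le> exp (- exp (- x)) - exp (- exp (- (x - 1)))"
proof -
  define y where "y = (exp 1 - 1) * exp (- x)"
  have y: "y \<ge> 0" unfolding y_def by (intro mult_nonneg_nonneg) auto
  have "(\<Sum>n\<in>{0,j}. y ^ n /\<^sub>R fact n) \<le> (\<Sum>n. y ^ n /\<^sub>R fact n)"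
    by (rule sum_le_suminf) (use y summable_exp_generic[of y] in auto)
  hence "1 + y ^ j / fact j \<le> exp y" using assms by (simp add: exp_def divide_inverse mult.commute)
  hence "y ^ j / fact j * exp (- exp (1 - x)) \<le> (exp y - 1) * exp (- exp (1 - x))"
    by (intro mult_right_mono) auto
  also have "\<dots> = exp (y - exp (1 - x)) - exp (- exp (1 - x))"
    by (simp add: left_diff_distrib flip: exp_add)
  also have "y - exp (1 - x) = - exp (- x)"
    by (simp add: y_def left_diff_distrib flip: exp_add)
  finally show ?thesis by (simp add: lattice_term_def y_def)
qed

lemma summable_on_increments:
  fixes a A :: "int \<Rightarrow> real"
  assumes a: "\<And>r. 0 \<le> a r" "\<And>r. a r \<le> A r - A (r - 1)"
    and A: "\<And>r. 0 \<le> A r" "\<And>r. A r \<le> U"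
  shows "a summable_on UNIV" "infsum a UNIV \<le> U"
proof -
  have fin: "sum a F \<le> U" if F: "finite F" for F
  proof -
    have bd: "\<bar>x\<bar> \<le> Max (insert 0 (abs ` F))" if "x \<in> F" for x
      using F that by (intro Max_ge) auto
    define L where "L = Max (insert 0 (abs ` F)) + 1"
    have "0 \<le> Max (insert 0 (abs ` F))" using F by (intro Max_ge) auto
    hence L: "-L \<le> L" by (simp add: L_def)
    have "x \<in> {-L<..L}" if "x \<in> F" for x using bd[OF that] by (auto simp: L_def abs_le_iff)
    hence L': "F \<subseteq> {-L<..L}" by blast
    have "sum a F \<le> sum a {-L<..L}"
      by (intro sum_mono2) (use L' a in auto)
    also have "\<dots> \<le> A L - A (-L)"
      using sum_mono[of "{-L<..L}" a "\<lambda>r. A r - A (r - 1)"] a(2) sum_increments_int[OF L, of A] by simp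
    also have "\<dots> \<le> U" using A(1)[of "-L"] A(2)[of L] by simp
    finally show ?thesis .
  qed
  show "a summable_on UNIV"
    by (rule nonneg_bdd_above_summable_on) (use a fin in \<open>auto intro!: bdd_aboveI2\<close>)
  thus "infsum a UNIV \<le> U" by (rule infsum_le_finite_sums) (use fin in auto)
qed

lemma lattice_summable: "1 \<le> j \<Longrightarrow> (\<lambda>z::int. lattice_term j (of_int z - v)) summable_on UNIV"
  and lattice_sum_le_1: "1 \<le> j \<Longrightarrow> lattice_sum j v \<le> 1"
proof -
  assume j: "1 \<le> j"
  have incr: "lattice_term j (of_int r - v) \<le> exp (- exp (- (of_int r - v))) - exp (- exp (- (of_int (r - 1) - v)))" for r
    using lattice_term_le_increment[OF j, of "of_int r - v"] by (simp add: algebra_simps)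
  have "(\<lambda>z::int. lattice_term j (of_int z - v)) summable_on UNIV \<and> lattice_sum j v \<le> 1"
    unfolding lattice_sum_def
    using summable_on_increments[where a = "\<lambda>z::int. lattice_term j (of_int z - v)"
        and A = "\<lambda>z. exp (- exp (- (of_int z - v)))" and U = 1, OF lattice_term_nonneg incr] by simp
  thus "(\<lambda>z::int. lattice_term j (of_int z - v)) summable_on UNIV" "lattice_sum j v \<le> 1" by auto
qed

lemma lattice_sum_nonneg: "lattice_sum j v \<ge> 0"
  unfolding lattice_sum_def by (intro infsum_nonneg lattice_term_nonneg)

lemma has_sum_int_shift:
  fixes f :: "nat \<Rightarrow> real"
  assumes f: "\<And>k. f k \<ge> 0" "f 0 = 0" "f sums S"
  shows "((\<lambda>r. f (nat (c + r))) has_sum S) (UNIV :: int set)"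
proof -
  have "(f has_sum S) UNIV"
    using sums_nonneg_imp_has_sum[of f] f by auto
  hence "((\<lambda>z. f (nat z)) has_sum S) {0..}"
    by (subst has_sum_reindex_bij_betw[of int UNIV "{0..}", symmetric])
       (auto simp: bij_betw_def image_def intro: nonneg_int_cases)
  hence "((\<lambda>z. f (nat z)) has_sum S) UNIV"
    by (rule has_sum_cong_neutral[THEN iffD1, rotated -1]) (auto simp: f(2))
  thus ?thesis
    by (subst has_sum_reindex_bij_betw[of "\<lambda>r. c + r" UNIV UNIV "\<lambda>z. f (nat z)"])
       (auto intro!: bij_plus)
qed

lemma lim_diff_mult:
  fixes x x' y y' :: "nat \<Rightarrow> real"
  assumes "(\<lambda>n. x n - x' n) \<longlonglongrightarrow> 0" "(\<lambda>n. y n - y' n) \<longlonglongrightarrow> 0"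
    and "\<And>n. \<bar>x' n\<bar> \<le> B" "\<And>n. \<bar>y' n\<bar> \<le> C"
  shows "(\<lambda>n. x n * y n - x' n * y' n) \<longlonglongrightarrow> 0"
proof -
  have "(\<lambda>n. (x n - x' n) * (y n - y' n) + x' n * (y n - y' n) + (x n - x' n) * y' n) \<longlonglongrightarrow> 0 * 0 + 0 + 0"
    by (intro tendsto_add tendsto_mult assms(1,2)
        lim_null_mult_left_bounded[where B = B] lim_null_mult_right_bounded[where B = C]) (use assms in auto)
  thus ?thesis by (simp add: algebra_simps)
qed

lemma lim_diff_power:
  fixes x x' :: "nat \<Rightarrow> real"
  assumes "(\<lambda>n. x n - x' n) \<longlonglongrightarrow> 0" "\<And>n. \<bar>x' n\<bar> \<le> B"
  shows "(\<lambda>n. x n ^ k - x' n ^ k) \<longlonglongrightarrow> 0"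
proof (induction k)
  case (Suc k)
  have "\<bar>x' n ^ k\<bar> \<le> B ^ k" for n unfolding power_abs by (intro power_mono assms) auto
  from lim_diff_mult[OF assms(1) Suc assms(2) this] show ?case by simp
qed simp

lemma binomial_shift_limit:
  "(\<lambda>n. real ((n - c) choose j) / real n ^ j) \<longlonglongrightarrow> 1 / fact j"
proof -
  have "(\<lambda>n. (\<Prod>i<j. (real n - real c - real i) / real n) / fact j) \<longlonglongrightarrow> (\<Prod>i<j. 1) / fact j"
    by (intro tendsto_divide tendsto_prod tendsto_const) (real_asymp | simp)+
  moreover have "eventually (\<lambda>n. (\<Prod>i<j. (real n - real c - real i) / real n) / fact j = real ((n - c) choose j) / real n ^ j) sequentially"
    using eventually_gt_at_top[of c]
  proof eventually_elim
    case (elim n)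
    have "real ((n - c) choose j) = (\<Prod>i<j. real n - real c - real i) / fact j"
      using elim by (simp add: binomial_gbinomial gbinomial_prod_rev lessThan_atLeast0 of_nat_diff)
    thus ?case by (simp add: prod_dividef)
  qed
  ultimately show ?thesis using Lim_transform_eventually by fastforce
qed

lemma has_sum_lattice_shift:
  assumes "1 \<le> j"
  shows "((\<lambda>r. lattice_term j (of_int r - (v - of_int c))) has_sum lattice_sum j v) (UNIV :: int set)"
proof -
  have "((\<lambda>z. lattice_term j (of_int z - v)) has_sum lattice_sum j v) (UNIV :: int set)"
    unfolding lattice_sum_def by (rule has_sum_infsum[OF lattice_summable[OF assms]])
  hence "((\<lambda>r. lattice_term j (of_int (c + r) - v)) has_sum lattice_sum j v) (UNIV :: int set)"
    by (subst has_sum_reindex_bij_betw[of "\<lambda>r. c + r" UNIV UNIV "\<lambda>z. lattice_term j (of_int z - v)"])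
       (auto intro!: bij_plus)
  thus ?thesis by (simp add: algebra_simps)
qed

text \<open>
  Index the series by \<open>r\<close>, where the level is \<open>\<lfloor>a_seq m n + (e - 1) s\<rfloor> + r\<close>. For fixed \<open>r\<close> the terms are given
  by the local asymptotics above. Both series are dominated by increments: on the left of the distribution
  function of the maximum, on the right of the Gumbel function \<open>exp (- exp (- x))\<close>.
\<close>

lemma max_mult_series_limit:
  fixes m l j :: nat and s :: real
  assumes j: "1 \<le> j"
  shows "(\<lambda>n. max_mult_series m (n - 1 - l) j (stop_scale m n + s)
           - exp (- exp (- s)) * lattice_sum j (a_seq m n + (exp 1 - 1) * s)) \<longlonglongrightarrow> 0"
proof -
  define T where "T n = stop_scale m n + s" for n
  define v where "v n = a_seq m n + (exp 1 - 1) * s" for n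
  \<comment> \<open>The integer part of the centring, so that \<open>x n r\<close> below stays in \<open>[r - 1, r]\<close>.\<close>
  define \<kappa> where "\<kappa> n = \<lfloor>v n\<rfloor>" for n
  define E where "E = exp (- exp (- s))"
  define x where "x n r = of_int r - (v n - of_int (\<kappa> n))" for n and r :: int
  define k where "k r n = nat (\<kappa> n + r)" for n r
  define f where "f n k = real (n - 1 - l choose j) * poi (T n) k ^ j * poi_mid m (T n) k ^ (n - 1 - l - j)" for n k
  define a where "a n r = f n (k r n)" for n r
  define A where "A n r = poi_mid m (T n) (nat (\<kappa> n + r + 1)) ^ (n - 1 - l)" for n r
  define b where "b n r = E * lattice_term j (x n r)" for n r
  define B where "B n r = E * exp (- exp (- x n r))" for n r
  define U where "U n = (1 - poi_low (T n) m) ^ (n - 1 - l)" for n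

  have T_top: "filterlim T at_top sequentially" unfolding T_def by (rule stop_scale_at_top)
  hence ev_T: "eventually (\<lambda>n. T n > 0) sequentially" by (auto simp: filterlim_at_top_dense)
  have v_top: "filterlim v at_top sequentially"
    unfolding v_def using filterlim_tendsto_add_at_top[OF tendsto_const[of "(exp 1 - 1) * s"] a_seq_at_top[of m]] by (simp add: add.commute)
  have x_bd: "of_int r - 1 \<le> x n r" "x n r \<le> of_int r" for n r
    unfolding x_def \<kappa>_def by linarith+
  have ev_k: "eventually (\<lambda>n. \<kappa> n + r \<ge> c) sequentially" for r c
  proof -
    have "eventually (\<lambda>n. v n \<ge> of_int (c - r)) sequentially"
      using v_top by (auto simp: filterlim_at_top)
    thus ?thesis
    proof eventually_elim
      case (elim n)
      hence "c - r \<le> \<lfloor>v n\<rfloor>" by (simp only: le_floor_iff)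
      thus ?case by (simp add: \<kappa>_def)
    qed
  qed
  have k_eq: "real (k r n) - v n = x n r" if "\<kappa> n + r \<ge> 0" for n r
    using that by (simp add: k_def x_def)
  have bdd: "eventually (\<lambda>n. \<bar>real (k r n) - (a_seq m n + (exp 1 - 1) * s)\<bar> \<le> \<bar>of_int r\<bar> + 1) sequentially" for r
    using ev_k[of 0 r]
  proof eventually_elim
    case (elim n)
    thus ?case using k_eq[of n r] x_bd[where r = r and n = n] unfolding v_def [symmetric] by linarith
  qed
  have exp_bd: "\<bar>exp (c - x n r)\<bar> \<le> exp (c + 1 - of_int r)" for c n r
    using x_bd[where r = r and n = n] by simp
  \<comment> \<open>As \<open>x n r\<close> is bounded but need not converge, limits of \<open>z n * exp (x n r)\<close> are restated for differences.\<close>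
  have transfer: "(\<lambda>n. z n - L * exp (- x n r)) \<longlonglongrightarrow> 0"
    if "(\<lambda>n. z n * exp (real (k r n) - (a_seq m n + (exp 1 - 1) * s))) \<longlonglongrightarrow> L" for z L r
  proof -
    have "(\<lambda>n. z n * exp (real (k r n) - (a_seq m n + (exp 1 - 1) * s)) - L) \<longlonglongrightarrow> L - L"
      by (intro tendsto_intros that)
    hence "(\<lambda>n. (z n * exp (real (k r n) - (a_seq m n + (exp 1 - 1) * s)) - L) * exp (0 - x n r)) \<longlonglongrightarrow> 0"
      by (intro lim_null_mult_right_bounded[where B = "exp (0 + 1 - of_int r)"]) (use exp_bd[of 0] in auto)
    moreover have "eventually (\<lambda>n. (z n * exp (real (k r n) - (a_seq m n + (exp 1 - 1) * s)) - L) * exp (0 - x n r)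
         = z n - L * exp (- x n r)) sequentially"
      using ev_k[of 0 r]
    proof eventually_elim
      case (elim n)
      have "real (k r n) - (a_seq m n + (exp 1 - 1) * s) = x n r" using k_eq[OF elim] by (simp add: v_def)
      thus ?case by (simp add: left_diff_distrib mult.assoc flip: exp_add)
    qed
    ultimately show ?thesis using Lim_transform_eventually by fast
  qed
  have lim_p: "(\<lambda>n. real n * poi (T n) (k r n) - (exp 1 - 1) * exp (- x n r)) \<longlonglongrightarrow> 0" for r
    unfolding T_def by (intro transfer poi_near_max(3)[OF bdd])
  have lim_up: "(\<lambda>n. real n * poi_up (T n) (k r n) - exp 1 * exp (- x n r)) \<longlonglongrightarrow> 0" for r
    unfolding T_def by (intro transfer poi_up_near_max[OF bdd])
  have lim_low: "(\<lambda>n. real n * poi_low (T n) m - exp (- s)) \<longlonglongrightarrow> 0"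
    unfolding T_def using poi_low_stop_scale by (rule LIM_zero)

  have lim_mid: "(\<lambda>n. poi_mid m (T n) (k r n) ^ (n - c) - E * exp (- exp (1 - x n r))) \<longlonglongrightarrow> 0" for r c
  proof -
    have "(\<lambda>n. (real n * poi_low (T n) m - exp (- s)) + (real n * poi_up (T n) (k r n) - exp 1 * exp (- x n r))) \<longlonglongrightarrow> 0 + 0"
      by (intro tendsto_add lim_low lim_up)
    hence lim: "(\<lambda>n. real n * (poi_low (T n) m + poi_up (T n) (k r n)) - (exp (- s) + exp (1 - x n r))) \<longlonglongrightarrow> 0"
      by (simp add: algebra_simps exp_diff exp_minus field_simps)
    have km: "eventually (\<lambda>n. m < k r n) sequentially"
      using ev_k[of "int m + 1" r] by eventually_elim (simp add: k_def)
    have "(\<lambda>n. (1 - (poi_low (T n) m + poi_up (T n) (k r n))) ^ (n - c) - exp (- (exp (- s) + exp (1 - x n r)))) \<longlonglongrightarrow> 0"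
    proof (rule power_one_minus_limit[OF _ lim, where B = "exp (- s) + exp (1 + 1 - of_int r)"])
      show "eventually (\<lambda>n. 0 \<le> poi_low (T n) m + poi_up (T n) (k r n) \<and> poi_low (T n) m + poi_up (T n) (k r n) \<le> 1) sequentially"
        using ev_T km
      proof eventually_elim
        case (elim n)
        thus ?case using poi_low_nonneg[of "T n" m] poi_up_nonneg[of "T n" "k r n"]
          poi_mid_nonneg[of "T n" m "k r n"] poi_mid_eq[of m "k r n" "T n"] by auto
      qed
      show "\<bar>exp (- s) + exp (1 - x n r)\<bar> \<le> exp (- s) + exp (1 + 1 - of_int r)" for n
        using exp_bd[of 1 n r] by simp
    qed
    moreover have "eventually (\<lambda>n. (1 - (poi_low (T n) m + poi_up (T n) (k r n))) ^ (n - c) - exp (- (exp (- s) + exp (1 - x n r)))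
       = poi_mid m (T n) (k r n) ^ (n - c) - E * exp (- exp (1 - x n r))) sequentially"
      using km by eventually_elim (simp add: poi_mid_eq E_def flip: exp_add)
    ultimately show ?thesis using Lim_transform_eventually by fast
  qed

  have E01: "0 \<le> E" "E \<le> 1" by (auto simp: E_def)
  have "(\<lambda>n. max_mult_series m (n - 1 - l) j (T n) - E * lattice_sum j (v n)) \<longlonglongrightarrow> 0"
  proof (rule series_difference_limit[where a = a and A = A and b = b and B = B and U = U and ?U0.0 = E])
    show "eventually (\<lambda>n. (\<forall>r. 0 \<le> a n r \<and> a n r \<le> A n r - A n (r - 1) \<and> 0 \<le> A n r \<and> A n r \<le> U n)
                \<and> (a n has_sum max_mult_series m (n - 1 - l) j (T n)) UNIV) sequentially"
      using ev_T eventually_gt_at_top[of "l + j + 1"]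
    proof eventually_elim
      case (elim n)
      have N: "j < n - 1 - l" and T0: "0 \<le> T n" using elim by auto
      note bounds = max_mult_term_bounds[OF T0 j N, where m = m, folded f_def]
      have "a n r \<le> A n r - A n (r - 1)" for r
      proof (cases "\<kappa> n + r \<ge> 0")
        case True
        hence "nat (\<kappa> n + r + 1) = Suc (k r n)" by (simp add: k_def)
        thus ?thesis using bounds(2)[of "k r n"] by (simp add: a_def A_def k_def)
      next
        case False
        hence "k r n = 0" "nat (\<kappa> n + r + 1) = 0" by (auto simp: k_def)
        thus ?thesis using bounds(3) by (simp add: a_def A_def k_def)
      qed
      moreover have "(a n has_sum max_mult_series m (n - 1 - l) j (T n)) UNIV"
        unfolding a_def k_def by (rule has_sum_int_shift) (use bounds in auto)
      ultimately show ?case using bounds(1) T0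
        by (auto simp: a_def A_def U_def poi_mid_nonneg intro!: power_mono poi_mid_le)
    qed
    show "0 \<le> b n r" for n r using E01 lattice_term_nonneg by (simp add: b_def)
    show "0 \<le> B n r" for n r using E01 by (simp add: B_def)
    show "B n r \<le> E" for n r using E01 by (simp add: B_def mult_left_le)
    show "b n r \<le> B n r - B n (r - 1)" for n r
    proof -
      have "x n (r - 1) = x n r - 1" by (simp add: x_def)
      thus ?thesis unfolding b_def B_def right_diff_distrib [symmetric]
        by (simp only:) (intro mult_left_mono lattice_term_le_increment j E01)
    qed
    show "(b n has_sum E * lattice_sum j (v n)) UNIV" for n
      unfolding b_def x_def by (intro has_sum_cmult_right has_sum_lattice_shift j)
    show "U \<longlonglongrightarrow> E"
    proof -
      have "(\<lambda>n. (1 - poi_low (T n) m) ^ (n - (1 + l)) - exp (- exp (- s))) \<longlonglongrightarrow> 0"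
      proof (rule power_one_minus_limit[OF _ lim_low, where B = "exp (- s)"])
        show "eventually (\<lambda>n. 0 \<le> poi_low (T n) m \<and> poi_low (T n) m \<le> 1) sequentially"
          using ev_T by eventually_elim (simp add: poi_low_nonneg poi_low_le_1)
      qed simp
      hence "(\<lambda>n. U n - E) \<longlonglongrightarrow> 0" by (simp add: U_def E_def)
      thus ?thesis by (rule LIM_zero_cancel)
    qed
    show "(\<lambda>n. A n r - B n r) \<longlonglongrightarrow> 0" for r
    proof -
      have "x n (r + 1) = x n r + 1" for n by (simp add: x_def)
      thus ?thesis using lim_mid[of "r + 1" "1 + l"] by (simp add: A_def B_def k_def add.assoc)
    qed
    show "(\<lambda>n. a n r - b n r) \<longlonglongrightarrow> 0" for r
    proof -
      have bd1: "\<bar>(exp 1 - 1) * exp (- x n r)\<bar> \<le> (exp 1 - 1) * exp (1 - of_int r)" for n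
        using exp_bd[of 0 n r] by (simp add: abs_mult mult_left_mono)
      have p: "(\<lambda>n. (real n * poi (T n) (k r n)) ^ j - ((exp 1 - 1) * exp (- x n r)) ^ j) \<longlonglongrightarrow> 0"
        by (rule lim_diff_power[OF lim_p bd1])
      have bd2: "\<bar>((exp 1 - 1) * exp (- x n r)) ^ j\<bar> \<le> ((exp 1 - 1) * exp (1 - of_int r)) ^ j" for n
        unfolding power_abs by (intro power_mono bd1) auto
      have C: "(\<lambda>n. real (n - (1 + l) choose j) / real n ^ j - 1 / fact j) \<longlonglongrightarrow> 0"
        using binomial_shift_limit by (rule LIM_zero)
      have Cp: "(\<lambda>n. real (n - (1 + l) choose j) / real n ^ j * (real n * poi (T n) (k r n)) ^ j
             - 1 / fact j * ((exp 1 - 1) * exp (- x n r)) ^ j) \<longlonglongrightarrow> 0"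
        by (rule lim_diff_mult[OF C p _ bd2, of "1 / fact j"]) simp
      have bd3: "\<bar>1 / fact j * ((exp 1 - 1) * exp (- x n r)) ^ j\<bar> \<le> 1 / fact j * ((exp 1 - 1) * exp (1 - of_int r)) ^ j" for n
        unfolding abs_mult using bd2[of n] by (intro mult_mono) auto
      have "(\<lambda>n. (real (n - (1 + l) choose j) / real n ^ j * (real n * poi (T n) (k r n)) ^ j) * poi_mid m (T n) (k r n) ^ (n - (1 + l + j))
             - (1 / fact j * ((exp 1 - 1) * exp (- x n r)) ^ j) * (E * exp (- exp (1 - x n r)))) \<longlonglongrightarrow> 0"
        by (rule lim_diff_mult[OF Cp lim_mid[of r "1 + l + j"] bd3, where C = 1]) (use E01 in \<open>simp add: abs_mult mult_le_one\<close>)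
      moreover have "eventually (\<lambda>n. (real (n - (1 + l) choose j) / real n ^ j * (real n * poi (T n) (k r n)) ^ j) * poi_mid m (T n) (k r n) ^ (n - (1 + l + j))
             - (1 / fact j * ((exp 1 - 1) * exp (- x n r)) ^ j) * (E * exp (- exp (1 - x n r))) = a n r - b n r) sequentially"
        using eventually_gt_at_top[of 0]
      proof eventually_elim
        case (elim n)
        have "real (n - (1 + l) choose j) / real n ^ j * (real n * poi (T n) (k r n)) ^ j =
              real (n - 1 - l choose j) * poi (T n) (k r n) ^ j"
          using elim by (simp add: power_mult_distrib)
        thus ?case by (simp add: a_def f_def b_def lattice_term_def)
      qed
      ultimately show ?thesis using Lim_transform_eventually by fast
    qed
    show "\<exists>K\<ge>0. \<forall>n. B n (-K) \<le> e \<and> E - e \<le> B n K" if "e > 0" for e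
    proof -
      have 1: "((\<lambda>y::real. exp (- exp y)) \<longlongrightarrow> 0) at_top" by real_asymp
      have 2: "((\<lambda>y::real. exp (- exp (1 - y))) \<longlongrightarrow> 1) at_top" by real_asymp
      have "eventually (\<lambda>y. exp (- exp y) < e) at_top"
        by (rule order_tendstoD(2)[OF 1 that])
      moreover have "eventually (\<lambda>y. exp (- exp (1 - y)) > 1 - e) at_top"
        by (rule order_tendstoD(1)[OF 2]) (use that in auto)
      ultimately have "eventually (\<lambda>y. exp (- exp y) < e \<and> exp (- exp (1 - y)) > 1 - e) at_top"
        by eventually_elim auto
      then obtain y0 where y0: "\<And>y. y \<ge> y0 \<Longrightarrow> exp (- exp y) < e \<and> exp (- exp (1 - y)) > 1 - e"
        by (auto simp: eventually_at_top_linorder)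
      define K where "K = max 0 \<lceil>y0\<rceil>"
      have K: "K \<ge> 0" "of_int K \<ge> y0" by (auto simp: K_def le_max_iff_disj; linarith)+
      have "B n (-K) \<le> e" for n
      proof -
        have "B n (-K) \<le> 1 * exp (- exp (of_int K))"
          unfolding B_def using x_bd(2)[of n "-K"] E01 by (intro mult_mono) auto
        thus ?thesis using y0[OF K(2)] by simp
      qed
      moreover have "E - e \<le> B n K" for n
      proof -
        have "E * (1 - exp (- exp (1 - of_int K))) \<le> 1 * e"
          using y0[OF K(2)] E01 by (intro mult_mono) auto
        hence "E - e \<le> E * exp (- exp (1 - of_int K))" by (simp add: algebra_simps)
        also have "\<dots> \<le> B n K" unfolding B_def using x_bd(1)[of K n] E01 by (intro mult_left_mono) auto
        finally show ?thesis .
      qed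
      ultimately show ?thesis using K by blast
    qed
  qed
  thus ?thesis by (simp add: T_def v_def E_def)
qed

section \<open>The limit law in terms of the Poisson point process\<close>

text \<open>
  One has \<open>(e - 1) exp (- x) = (1 - exp (- 1)) exp (1 - x)\<close>, and the remaining shift by \<open>1\<close> is absorbed by periodicity.
\<close>

lemma lattice_sum_eq_log_gamma:
  assumes j: "j \<ge> 1"
  shows "lattice_sum j v = (1 - exp (-1)) ^ j / fact j * log_gamma_lattice j v"
proof -
  have kernel: "lattice_term j x = (1 - exp (-1)) ^ j / fact j * log_gamma_kernel (real j) (x - 1)" for x
  proof -
    have "(exp 1 - 1) * exp (- x) = (1 - exp (-1)) * exp (1 - x)" by (simp add: left_diff_distrib flip: exp_add)
    hence "lattice_term j x = (1 - exp (-1)) ^ j / fact j * (exp (1 - x) ^ j * exp (- exp (1 - x)))"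
      by (simp add: lattice_term_def power_mult_distrib)
    also have "exp (1 - x) ^ j * exp (- exp (1 - x)) = log_gamma_kernel (real j) (x - 1)"
      by (simp add: log_gamma_kernel_def algebra_simps flip: exp_add exp_of_nat_mult)
    finally show ?thesis .
  qed
  have "lattice_sum j v = (\<Sum>\<^sub>\<infinity>z\<in>UNIV. (1 - exp (-1)) ^ j / fact j * log_gamma_kernel (real j) (of_int z - (v + 1)))"
    unfolding lattice_sum_def kernel by (simp add: algebra_simps)
  also have "\<dots> = (1 - exp (-1)) ^ j / fact j * log_gamma_lattice j (v + 1)"
    unfolding log_gamma_lattice_def by (rule infsum_cmult_right')
  finally show ?thesis using log_gamma_lattice(2)[OF j] by simp
qed

lemma continuous_on_lattice_sum: "1 \<le> j \<Longrightarrow> continuous_on UNIV (lattice_sum j)"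
  by (subst continuous_on_cong[OF refl lattice_sum_eq_log_gamma])
     (auto intro!: continuous_intros log_gamma_lattice(1))

lemma lattice_sum_borel: "1 \<le> j \<Longrightarrow> lattice_sum j \<in> borel_measurable borel"
  by (intro borel_measurable_continuous_onI continuous_on_lattice_sum)

lemma emeasure_exp_intensity_interval:
  assumes "a \<le> b"
  shows "emeasure exp_intensity {a<..b} = ennreal (exp (- a) - exp (- b))"
proof -
  have "emeasure exp_intensity {a<..b} = (\<integral>\<^sup>+x. ennreal (exp (- x)) * indicator {a<..b} x \<partial>lborel)"
    unfolding exp_intensity_def by (subst emeasure_density) auto
  also have "\<dots> = (\<integral>\<^sup>+x. ennreal (exp (- x)) * indicator {a..b} x \<partial>lborel)"
    by (rule nn_integral_cong_AE) (use AE_lborel_singleton[of a] in eventually_elim, auto simp: indicator_def)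
  also have "\<dots> = - exp (- b) - (- exp (- a))"
    by (rule nn_integral_FTC_Icc[where F = "\<lambda>x. - exp (- x)"])
       (use assms in \<open>auto intro!: derivative_eq_intros\<close>)
  finally show ?thesis by simp
qed

lemma emeasure_exp_intensity_ray: "emeasure exp_intensity {a<..} = ennreal (exp (- a))"
proof -
  have "emeasure exp_intensity {a<..} = (\<integral>\<^sup>+x. ennreal (exp (- x)) * indicator {a<..} x \<partial>lborel)"
    unfolding exp_intensity_def by (subst emeasure_density) auto
  also have "\<dots> = (\<integral>\<^sup>+x. ennreal (exp (- x)) * indicator {a..} x \<partial>lborel)"
    by (rule nn_integral_cong_AE) (use AE_lborel_singleton[of a] in eventually_elim, auto simp: indicator_def)
  also have "\<dots> = 0 - (- exp (- a))"
  proof (rule nn_integral_FTC_atLeast[where F = "\<lambda>x. - exp (- x)"])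
    show "((\<lambda>x::real. - exp (- x)) \<longlongrightarrow> 0) at_top" by real_asymp
  qed (auto intro!: derivative_eq_intros)
  finally show ?thesis by simp
qed

lemma sets_exp_intensity [simp]: "sets exp_intensity = sets borel"
  by (simp add: exp_intensity_def)

text \<open>
  The points that \<open>ceil_points b\<close> sends to \<open>z\<close> are those in \<open>(z - 1 - b, z - b]\<close>.
\<close>

definition top_cell :: "nat \<Rightarrow> real \<Rightarrow> (nat \<Rightarrow> real) \<Rightarrow> int \<Rightarrow> bool" where
  "top_cell j b x z \<longleftrightarrow> num_points x {of_int z - 1 - b<..of_int z - b} = enat j \<and> num_points x {of_int z - b<..} = 0"

lemma num_points_eq_0_iff: "num_points x B = 0 \<longleftrightarrow> (\<forall>i. x i \<notin> B)"
  by (auto simp: num_points_def zero_enat_def dest: infinite_imp_nonempty)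

lemma rightmost_mult_iff_top_cell:
  assumes j: "j \<ge> 1"
  shows "rightmost_mult (ceil_points b x) j \<longleftrightarrow> (\<exists>z. top_cell j b x z)"
proof -
  have cell: "num_points (ceil_points b x) {z} = num_points x {of_int z - 1 - b<..of_int z - b}" for z
  proof -
    have "{i. ceil_points b x i \<in> {z}} = {i. x i \<in> {of_int z - 1 - b<..of_int z - b}}"
      by (auto simp: ceil_points_def ceiling_eq_iff)
    thus ?thesis by (simp add: num_points_def)
  qed
  have above: "(\<forall>z'\<in>range (ceil_points b x). z' \<le> z) \<longleftrightarrow> num_points x {of_int z - b<..} = 0" for z
    unfolding num_points_eq_0_iff by (auto simp: ceil_points_def ceiling_le_iff not_less algebra_simps)
  have ne: "z \<in> range (ceil_points b x)" if "num_points (ceil_points b x) {z} = enat j" for z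
  proof (rule ccontr)
    assume "z \<notin> range (ceil_points b x)"
    hence "num_points (ceil_points b x) {z} = 0" unfolding num_points_eq_0_iff by auto
    thus False using that j by (simp add: zero_enat_def)
  qed
  show ?thesis unfolding rightmost_mult_def top_cell_def using cell above ne by metis
qed

lemma top_cell_unique:
  assumes j: "j \<ge> 1" and "top_cell j b x z" "top_cell j b x z'"
  shows "z = z'"
proof -
  have "\<not> z < z'" if "top_cell j b x z" "top_cell j b x z'" for z z'
  proof
    assume less: "z < z'"
    hence le: "real_of_int z \<le> of_int z' - 1" by linarith
    have "num_points x {of_int z' - 1 - b<..of_int z' - b} = 0"
      unfolding num_points_eq_0_iff
    proof
      fix i
      have "x i \<le> of_int z - b" using that(1) by (auto simp: top_cell_def num_points_eq_0_iff not_less)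
      thus "x i \<notin> {of_int z' - 1 - b<..of_int z' - b}" using le by auto
    qed
    thus False using that(2) j by (simp add: top_cell_def zero_enat_def)
  qed
  from this[of z z'] this[of z' z] assms show ?thesis by force
qed

text \<open>
  The random set of indices is compared with each of the countably many finite sets.
\<close>

lemma pred_num_points:
  fixes Q :: "nat \<Rightarrow> 'c \<Rightarrow> bool"
  assumes "\<And>i. Measurable.pred L (Q i)"
  shows "Measurable.pred L (\<lambda>w. (if finite {i. Q i w} then enat (card {i. Q i w}) else \<infinity>) = enat j)"
proof -
  have "(if finite {i. Q i w} then enat (card {i. Q i w}) else \<infinity>) = enat j \<longleftrightarrow>
     (\<exists>F\<in>{F :: nat set. finite F \<and> card F = j}. \<forall>i. Q i w \<longleftrightarrow> i \<in> F)" for w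
  proof
    assume "(if finite {i. Q i w} then enat (card {i. Q i w}) else \<infinity>) = enat j"
    thus "\<exists>F\<in>{F :: nat set. finite F \<and> card F = j}. \<forall>i. Q i w \<longleftrightarrow> i \<in> F"
      by (intro bexI[of _ "{i. Q i w}"]) (auto split: if_splits)
  next
    assume "\<exists>F\<in>{F :: nat set. finite F \<and> card F = j}. \<forall>i. Q i w \<longleftrightarrow> i \<in> F"
    then obtain F where F: "finite F" "card F = j" "\<forall>i. Q i w \<longleftrightarrow> i \<in> F" by blast
    hence "{i. Q i w} = F" by auto
    thus "(if finite {i. Q i w} then enat (card {i. Q i w}) else \<infinity>) = enat j" using F by simp
  qed
  moreover have "countable {F :: nat set. finite F \<and> card F = j}"
    by (rule countable_subset[OF _ countable_Collect_finite]) auto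
  ultimately show ?thesis
    using assms by (simp only:) (intro measurable_pred_countable, measurable)
qed

locale limit_vars = prob_space N for N :: "'b measure" +
  fixes l :: nat and \<xi> :: "nat \<Rightarrow> 'b \<Rightarrow> real" and \<tau> :: "'b \<Rightarrow> real"
  assumes limit: "limit_variables l \<xi> \<tau>"
begin

lemma ppp: "poisson_point_process exp_intensity \<xi>"
  using limit by (simp add: limit_variables_def)

lemma \<xi>_measurable [measurable]: "\<xi> i \<in> borel_measurable N"
  using ppp measurable_cong_sets[OF refl sets_exp_intensity] by (auto simp: poisson_point_process_def)

lemma \<tau>_distributed: "distributed N lborel \<tau> (\<lambda>s. ennreal (gumbel_density l s))"
  using limit by (simp add: limit_variables_def)

lemma \<tau>_measurable [measurable]: "\<tau> \<in> borel_measurable N"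
  using distributed_measurable[OF \<tau>_distributed] by simp

lemma prob_num_points:
  assumes B: "B \<in> sets borel" and mu: "emeasure exp_intensity B = ennreal r" "r > 0"
  shows "prob {\<omega>\<in>space N. num_points (\<lambda>i. \<xi> i \<omega>) B = enat k} = poi r k"
    and "(\<lambda>\<omega>. num_points (\<lambda>i. \<xi> i \<omega>) B) \<in> measurable N (count_space UNIV)"
proof -
  show meas: "(\<lambda>\<omega>. num_points (\<lambda>i. \<xi> i \<omega>) B) \<in> measurable N (count_space UNIV)"
  proof -
    have "range (\<lambda>k::nat. if k = 0 then B else {}) \<subseteq> sets exp_intensity \<and> disjoint_family (\<lambda>k::nat. if k = 0 then B else {})"
      using B by (auto simp: disjoint_family_on_def)
    hence "indep_vars (\<lambda>_. count_space UNIV) (\<lambda>(k::nat) \<omega>. num_points (\<lambda>i. \<xi> i \<omega>) (if k = 0 then B else {})) UNIV"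
      using ppp unfolding poisson_point_process_def by blast
    hence "random_variable (count_space UNIV) (\<lambda>\<omega>. num_points (\<lambda>i. \<xi> i \<omega>) (if (0::nat) = 0 then B else {}))"
      unfolding indep_vars_def by blast
    thus ?thesis by simp
  qed
  have "distr N (count_space UNIV) (\<lambda>\<omega>. num_points (\<lambda>i. \<xi> i \<omega>) B) = measure_pmf (map_pmf enat (poisson_law (measure exp_intensity B)))"
    using ppp B mu unfolding poisson_point_process_def by auto
  also have "measure exp_intensity B = r" using mu by (simp add: measure_def)
  finally have d: "distr N (count_space UNIV) (\<lambda>\<omega>. num_points (\<lambda>i. \<xi> i \<omega>) B) = measure_pmf (map_pmf enat (poisson_law r))" .
  have "prob {\<omega>\<in>space N. num_points (\<lambda>i. \<xi> i \<omega>) B = enat k} = measure (distr N (count_space UNIV) (\<lambda>\<omega>. num_points (\<lambda>i. \<xi> i \<omega>) B)) {enat k}"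
    by (subst measure_distr[OF meas]) (auto intro!: arg_cong[where f = prob])
  also have "\<dots> = pmf (map_pmf enat (poisson_law r)) (enat k)" unfolding d by (simp add: pmf.rep_eq)
  also have "\<dots> = pmf (poisson_law r) k" by (rule pmf_map_inj') (auto simp: inj_def)
  also have "\<dots> = poi r k" using mu(2) by (simp add: poisson_law_def poi_def)
  finally show "prob {\<omega>\<in>space N. num_points (\<lambda>i. \<xi> i \<omega>) B = enat k} = poi r k" .
qed

lemma prob_top_cell:
  shows "{\<omega>\<in>space N. top_cell j b (\<lambda>i. \<xi> i \<omega>) z} \<in> events"
    and "prob {\<omega>\<in>space N. top_cell j b (\<lambda>i. \<xi> i \<omega>) z} = lattice_term j (of_int z - b)"
proof -
  define B where "B = {of_int z - 1 - b<..of_int z - b}"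
  define R where "R = {of_int z - b<..}"
  define y where "y = exp (- (of_int z - b))"
  have y: "y > 0" by (simp add: y_def)
  have mB: "emeasure exp_intensity B = ennreal ((exp 1 - 1) * y)"
    unfolding B_def by (subst emeasure_exp_intensity_interval) (auto simp: y_def algebra_simps simp flip: exp_add)
  have mR: "emeasure exp_intensity R = ennreal y"
    unfolding R_def y_def by (rule emeasure_exp_intensity_ray)
  have pos: "(exp 1 - 1) * y > 0" using y by simp
  note B = prob_num_points[OF _ mB pos] and R = prob_num_points[OF _ mR y]
  define A where "A k = (if k = 0 then B else if k = 1 then R else {})" for k :: nat
  have "range A \<subseteq> sets exp_intensity \<and> disjoint_family A"
    by (auto simp: A_def B_def R_def disjoint_family_on_def)
  hence ind: "indep_vars (\<lambda>_. count_space UNIV) (\<lambda>(k::nat) \<omega>. num_points (\<lambda>i. \<xi> i \<omega>) (A k)) UNIV"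
    using ppp unfolding poisson_point_process_def by blast
  have eq: "{\<omega>\<in>space N. top_cell j b (\<lambda>i. \<xi> i \<omega>) z} =
    (\<Inter>k\<in>{0,1}. (\<lambda>\<omega>. num_points (\<lambda>i. \<xi> i \<omega>) (A k)) -` (if k = 0 then {enat j} else {enat 0}) \<inter> space N)"
    by (auto simp: top_cell_def A_def B_def R_def zero_enat_def)
  have "prob {\<omega>\<in>space N. top_cell j b (\<lambda>i. \<xi> i \<omega>) z} =
    (\<Prod>k\<in>{0,1}. prob ((\<lambda>\<omega>. num_points (\<lambda>i. \<xi> i \<omega>) (A k)) -` (if k = 0 then {enat j} else {enat 0}) \<inter> space N))"
    unfolding eq by (rule indep_varsD[OF ind]) auto
  also have "\<dots> = prob {\<omega>\<in>space N. num_points (\<lambda>i. \<xi> i \<omega>) B = enat j} * prob {\<omega>\<in>space N. num_points (\<lambda>i. \<xi> i \<omega>) R = enat 0}"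
    by (simp add: A_def vimage_def Int_def conj_commute)
  also have "\<dots> = poi ((exp 1 - 1) * y) j * poi y 0"
    using B(1)[of j] R(1)[of 0] by (simp add: B_def R_def)
  also have "\<dots> = ((exp 1 - 1) * y) ^ j / fact j * exp (- ((exp 1 - 1) * y + y))"
    unfolding poi_def minus_add_distrib exp_add by simp
  also have "(exp 1 - 1) * y + y = exp (1 - (of_int z - b))"
    by (simp add: y_def algebra_simps flip: exp_add)
  finally show "prob {\<omega>\<in>space N. top_cell j b (\<lambda>i. \<xi> i \<omega>) z} = lattice_term j (of_int z - b)"
    by (simp add: lattice_term_def y_def)
  have "{\<omega>\<in>space N. top_cell j b (\<lambda>i. \<xi> i \<omega>) z} =
     ((\<lambda>\<omega>. num_points (\<lambda>i. \<xi> i \<omega>) B) -` {enat j} \<inter> space N) \<inter> ((\<lambda>\<omega>. num_points (\<lambda>i. \<xi> i \<omega>) R) -` {0} \<inter> space N)"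
    by (auto simp: top_cell_def B_def R_def)
  also have "\<dots> \<in> events"
    by (rule sets.Int; rule measurable_sets[OF B(2)] measurable_sets[OF R(2)]) (auto simp: B_def R_def)
  finally show "{\<omega>\<in>space N. top_cell j b (\<lambda>i. \<xi> i \<omega>) z} \<in> events" .
qed

lemma emeasure_rightmost_fixed:
  assumes j: "j \<ge> 1"
  shows "emeasure N {\<omega>\<in>space N. rightmost_mult (ceil_points b (\<lambda>i. \<xi> i \<omega>)) j} = ennreal (lattice_sum j b)"
proof -
  define E where "E z = {\<omega>\<in>space N. top_cell j b (\<lambda>i. \<xi> i \<omega>) z}" for z :: int
  have E: "E z \<in> events" "prob (E z) = lattice_term j (of_int z - b)" for z
    unfolding E_def by (rule prob_top_cell)+
  have disj: "disjoint_family E"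
    using top_cell_unique[OF j] unfolding disjoint_family_on_def E_def by blast
  have "{\<omega>\<in>space N. rightmost_mult (ceil_points b (\<lambda>i. \<xi> i \<omega>)) j} = (\<Union>z. E z)"
    by (auto simp: rightmost_mult_iff_top_cell[OF j] E_def)
  also have "emeasure N \<dots> = (\<integral>\<^sup>+z. emeasure N (E z) \<partial>count_space UNIV)"
    by (rule emeasure_UN_countable) (use E disj in auto)
  also have "\<dots> = (\<integral>\<^sup>+z. ennreal (lattice_term j (of_int z - b)) \<partial>count_space UNIV)"
    by (intro nn_integral_cong) (simp add: emeasure_eq_measure E)
  also have "\<dots> = ennreal (\<Sum>\<^sub>\<infinity>z\<in>UNIV. lattice_term j (of_int z - b))"
  proof -
    define f where "f z = lattice_term j (of_int z - b)" for z :: int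
    have "(\<lambda>z. norm (f z)) = f" using lattice_term_nonneg by (auto simp: f_def)
    hence s: "Infinite_Set_Sum.abs_summable_on f UNIV"
      using abs_summable_equivalent[of f UNIV] lattice_summable[OF j, of b] by (simp add: f_def[abs_def])
    hence int: "integrable (count_space UNIV) f" by (simp add: Infinite_Set_Sum.abs_summable_on_def)
    have "(\<integral>\<^sup>+z. ennreal (f z) \<partial>count_space UNIV) = ennreal (integral\<^sup>L (count_space UNIV) f)"
      by (rule nn_integral_eq_integral[OF int]) (use lattice_term_nonneg in \<open>auto simp: f_def\<close>)
    also have "integral\<^sup>L (count_space UNIV) f = infsum f UNIV"
      using infsetsum_infsum[OF s] by (simp add: infsetsum_def)
    finally show ?thesis by (simp add: f_def[abs_def])
  qed
  finally show ?thesis by (simp add: lattice_sum_def)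
qed

text \<open>
  The independence of \<open>\<xi>\<close> and \<open>\<tau>\<close> as a product formula for their joint law, in the form needed for
  Fubini's theorem.
\<close>

lemma joint_distribution:
  defines "P \<equiv> PiM UNIV (\<lambda>_::nat. borel :: real measure)"
  shows "distr N (P \<Otimes>\<^sub>M borel) (\<lambda>\<omega>. (\<lambda>i. \<xi> i \<omega>, \<tau> \<omega>)) = distr N P (\<lambda>\<omega> i. \<xi> i \<omega>) \<Otimes>\<^sub>M distr N borel \<tau>"
    and "(\<lambda>\<omega> i. \<xi> i \<omega>) \<in> measurable N P"
proof -
  show seq: "(\<lambda>\<omega> i. \<xi> i \<omega>) \<in> measurable N P"
    unfolding P_def by (rule measurable_PiM_single') auto
  have ind: "indep_set (sets (vimage_algebra (space N) (\<lambda>\<omega> i. \<xi> i \<omega>) P)) (sets (vimage_algebra (space N) \<tau> borel))"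
    using limit by (simp add: limit_variables_def P_def)
  have \<tau>m: "\<tau> \<in> measurable N borel" by measurable
  have pair: "(\<lambda>\<omega>. (\<lambda>i. \<xi> i \<omega>, \<tau> \<omega>)) \<in> measurable N (P \<Otimes>\<^sub>M borel)"
    using seq by measurable
  interpret D: prob_space "distr N P (\<lambda>\<omega> i. \<xi> i \<omega>)" by (rule prob_space_distr[OF seq])
  interpret G: prob_space "distr N borel \<tau>" by (rule prob_space_distr[OF \<tau>m])
  show "distr N (P \<Otimes>\<^sub>M borel) (\<lambda>\<omega>. (\<lambda>i. \<xi> i \<omega>, \<tau> \<omega>)) = distr N P (\<lambda>\<omega> i. \<xi> i \<omega>) \<Otimes>\<^sub>M distr N borel \<tau>"
  proof (rule pair_measure_eqI [symmetric])
    show "sets (distr N P (\<lambda>\<omega> i. \<xi> i \<omega>) \<Otimes>\<^sub>M distr N borel \<tau>) = sets (distr N (P \<Otimes>\<^sub>M borel) (\<lambda>\<omega>. (\<lambda>i. \<xi> i \<omega>, \<tau> \<omega>)))"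
      unfolding sets_distr by (rule sets_pair_measure_cong) (rule sets_distr)+
    fix A B assume "A \<in> sets (distr N P (\<lambda>\<omega> i. \<xi> i \<omega>))" "B \<in> sets (distr N borel \<tau>)"
    hence A: "A \<in> sets P" and B: "B \<in> sets borel" by auto
    define A' where "A' = (\<lambda>\<omega> i. \<xi> i \<omega>) -` A \<inter> space N"
    define B' where "B' = \<tau> -` B \<inter> space N"
    have "prob (A' \<inter> B') = prob A' * prob B'"
      by (rule indep_setD[OF ind]) (auto simp: A'_def B'_def intro!: in_vimage_algebra A B)
    moreover have "A' \<inter> B' = (\<lambda>\<omega>. (\<lambda>i. \<xi> i \<omega>, \<tau> \<omega>)) -` (A \<times> B) \<inter> space N"
      by (auto simp: A'_def B'_def)
    ultimately show "emeasure (distr N P (\<lambda>\<omega> i. \<xi> i \<omega>)) A * emeasure (distr N borel \<tau>) B =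
        emeasure (distr N (P \<Otimes>\<^sub>M borel) (\<lambda>\<omega>. (\<lambda>i. \<xi> i \<omega>, \<tau> \<omega>))) (A \<times> B)"
      using A B seq \<tau>m pair
      by (simp add: emeasure_distr emeasure_eq_measure A'_def B'_def ennreal_mult'' [symmetric])
  qed (rule D.sigma_finite_measure_axioms G.sigma_finite_measure_axioms)+
qed

text \<open>
  Fubini's theorem: for a fixed value of \<open>\<tau>\<close> the shift is deterministic and \<open>emeasure_rightmost_fixed\<close> applies.
\<close>

lemma chi_eq_expectation:
  assumes j: "j \<ge> 1"
  shows "chi \<xi> \<tau> j u = (\<integral>s. gumbel_density l s * lattice_sum j ((exp 1 - 1) * s + u) \<partial>lborel)"
    and "integrable lborel (\<lambda>s. gumbel_density l s * lattice_sum j ((exp 1 - 1) * s + u))"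
proof -
  define P where "P = PiM UNIV (\<lambda>_::nat. borel :: real measure)"
  define b where "b s = (exp 1 - 1) * s + u" for s
  define C where "C = {p \<in> space (P \<Otimes>\<^sub>M borel). rightmost_mult (ceil_points (b (snd p)) (fst p)) j}"
  have seq: "(\<lambda>\<omega> i. \<xi> i \<omega>) \<in> measurable N P" unfolding P_def by (rule joint_distribution(2))
  have [measurable]: "(\<lambda>p. fst p i) \<in> borel_measurable (P \<Otimes>\<^sub>M (borel :: real measure))" for i
    unfolding P_def by measurable
  have [measurable]: "(\<lambda>p. b (snd p)) \<in> borel_measurable (P \<Otimes>\<^sub>M borel)" unfolding b_def by measurable
  have C: "C \<in> sets (P \<Otimes>\<^sub>M borel)"
  proof -
    have "Measurable.pred (P \<Otimes>\<^sub>M borel) (\<lambda>p. top_cell j (b (snd p)) (fst p) z)" for z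
    proof -
      have 1: "Measurable.pred (P \<Otimes>\<^sub>M borel) (\<lambda>p. num_points (fst p) {of_int z - 1 - b (snd p)<..of_int z - b (snd p)} = enat j)"
        unfolding num_points_def by (rule pred_num_points) (simp, measurable)
      have 2: "Measurable.pred (P \<Otimes>\<^sub>M borel) (\<lambda>p. num_points (fst p) {of_int z - b (snd p)<..} = enat 0)"
        unfolding num_points_def by (rule pred_num_points) (simp, measurable)
      show ?thesis unfolding top_cell_def zero_enat_def using 1 2 by (rule pred_intros_logic)
    qed
    hence "Measurable.pred (P \<Otimes>\<^sub>M borel) (\<lambda>p. \<exists>z. top_cell j (b (snd p)) (fst p) z)" by measurable
    thus ?thesis unfolding C_def rightmost_mult_iff_top_cell[OF j] by (simp add: pred_def)
  qed
  define D where "D = distr N P (\<lambda>\<omega> i. \<xi> i \<omega>)"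
  define G where "G = distr N borel \<tau>"
  interpret D: prob_space D unfolding D_def by (rule prob_space_distr[OF seq])
  interpret G: prob_space G unfolding G_def by (rule prob_space_distr) measurable
  interpret DG: pair_sigma_finite D G ..
  have sets_DG: "sets (D \<Otimes>\<^sub>M G) = sets (P \<Otimes>\<^sub>M borel)"
    by (intro sets_pair_measure_cong) (auto simp: D_def G_def)
  have joint: "distr N (P \<Otimes>\<^sub>M borel) (\<lambda>\<omega>. (\<lambda>i. \<xi> i \<omega>, \<tau> \<omega>)) = D \<Otimes>\<^sub>M G"
    unfolding D_def G_def P_def by (rule joint_distribution(1))
  have pair_meas: "(\<lambda>\<omega>. (\<lambda>i. \<xi> i \<omega>, \<tau> \<omega>)) \<in> measurable N (P \<Otimes>\<^sub>M borel)"
    using seq by measurable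
  have "emeasure N {\<omega>\<in>space N. rightmost_mult (ceil_points (b (\<tau> \<omega>)) (\<lambda>i. \<xi> i \<omega>)) j} =
      emeasure (distr N (P \<Otimes>\<^sub>M borel) (\<lambda>\<omega>. (\<lambda>i. \<xi> i \<omega>, \<tau> \<omega>))) C"
    by (subst emeasure_distr[OF pair_meas C])
       (auto intro!: arg_cong[where f = "emeasure N"] simp: C_def space_pair_measure P_def space_PiM)
  also have "\<dots> = emeasure (D \<Otimes>\<^sub>M G) C" by (simp add: joint)
  also have "\<dots> = (\<integral>\<^sup>+s. emeasure D ((\<lambda>x. (x, s)) -` C) \<partial>G)"
    by (rule DG.emeasure_pair_measure_alt2) (use C sets_DG in simp)
  also have "\<dots> = (\<integral>\<^sup>+s. ennreal (lattice_sum j (b s)) \<partial>G)"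
  proof (rule nn_integral_cong)
    fix s
    have "(\<lambda>x. (x, s)) -` C \<in> sets P"
      using sets_Pair2[of C P borel s] C by (simp add: vimage_def)
    hence "emeasure D ((\<lambda>x. (x, s)) -` C) = emeasure N ((\<lambda>\<omega> i. \<xi> i \<omega>) -` ((\<lambda>x. (x, s)) -` C) \<inter> space N)"
      unfolding D_def by (intro emeasure_distr seq)
    also have "(\<lambda>\<omega> i. \<xi> i \<omega>) -` ((\<lambda>x. (x, s)) -` C) \<inter> space N = {\<omega>\<in>space N. rightmost_mult (ceil_points (b s) (\<lambda>i. \<xi> i \<omega>)) j}"
      by (auto simp: C_def space_pair_measure P_def space_PiM)
    finally show "emeasure D ((\<lambda>x. (x, s)) -` C) = ennreal (lattice_sum j (b s))"
      by (simp add: emeasure_rightmost_fixed[OF j])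
  qed
  also have "G = distr N lborel \<tau>" unfolding G_def by (rule distr_cong) simp_all
  also have "distr N lborel \<tau> = density lborel (\<lambda>s. ennreal (gumbel_density l s))"
    by (rule distributed_distr_eq_density[OF \<tau>_distributed])
  also have "(\<integral>\<^sup>+s. ennreal (lattice_sum j (b s)) \<partial>density lborel (\<lambda>s. ennreal (gumbel_density l s))) =
     (\<integral>\<^sup>+s. ennreal (gumbel_density l s) * ennreal (lattice_sum j (b s)) \<partial>lborel)"
  proof (rule nn_integral_density)
    show "(\<lambda>s. ennreal (gumbel_density l s)) \<in> borel_measurable lborel" unfolding gumbel_density_def by measurable
    have "(\<lambda>s. lattice_sum j (b s)) \<in> borel_measurable borel"
      using measurable_compose[OF _ lattice_sum_borel[OF j], of b borel] unfolding b_def by measurable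
    thus "(\<lambda>s. ennreal (lattice_sum j (b s))) \<in> borel_measurable lborel" by simp
  qed
  also have "\<dots> = (\<integral>\<^sup>+s. ennreal (gumbel_density l s * lattice_sum j (b s)) \<partial>lborel)"
    by (intro nn_integral_cong ennreal_mult' [symmetric]) (simp add: gumbel_density_def)
  finally have main: "emeasure N {\<omega>\<in>space N. rightmost_mult (ceil_points (b (\<tau> \<omega>)) (\<lambda>i. \<xi> i \<omega>)) j} =
     (\<integral>\<^sup>+s. ennreal (gumbel_density l s * lattice_sum j (b s)) \<partial>lborel)" .
  have nonneg: "0 \<le> gumbel_density l s * lattice_sum j (b s)" for s
    by (intro mult_nonneg_nonneg lattice_sum_nonneg) (simp add: gumbel_density_def)
  have [measurable]: "(\<lambda>s. gumbel_density l s * lattice_sum j (b s)) \<in> borel_measurable borel"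
  proof -
    have [measurable]: "(\<lambda>s. lattice_sum j (b s)) \<in> borel_measurable borel"
      using measurable_compose[OF _ lattice_sum_borel[OF j], of b borel] unfolding b_def by measurable
    show ?thesis unfolding gumbel_density_def by measurable
  qed
  have eq: "ennreal (chi \<xi> \<tau> j u) = (\<integral>\<^sup>+s. ennreal (gumbel_density l s * lattice_sum j (b s)) \<partial>lborel)"
    using main by (simp add: chi_def b_def emeasure_eq_measure)
  have int: "integrable lborel (\<lambda>s. gumbel_density l s * lattice_sum j (b s))"
    by (rule integrableI_nonneg) (use nonneg eq[symmetric] in auto)
  thus "integrable lborel (\<lambda>s. gumbel_density l s * lattice_sum j ((exp 1 - 1) * s + u))" by (simp add: b_def)
  have "ennreal (chi \<xi> \<tau> j u) = ennreal (integral\<^sup>L lborel (\<lambda>s. gumbel_density l s * lattice_sum j (b s)))"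
    using eq nn_integral_eq_integral[OF int] nonneg by simp
  thus "chi \<xi> \<tau> j u = (\<integral>s. gumbel_density l s * lattice_sum j ((exp 1 - 1) * s + u) \<partial>lborel)"
    using nonneg by (subst (asm) ennreal_inj) (auto simp: chi_def b_def intro!: Bochner_Integration.integral_nonneg)
qed

end

section \<open>Poisson processes observed at an independent hitting time\<close>

text \<open>
  Meaningful only for paths that exceed \<open>m\<close> at some time; otherwise it is the infimum of the empty set.
\<close>

definition hit :: "nat \<Rightarrow> (real \<Rightarrow> nat) \<Rightarrow> real" where
  "hit m x = Inf {t. t \<ge> 0 \<and> x t > m}"

definition counting_path :: "(real \<Rightarrow> nat) \<Rightarrow> bool" where
  "counting_path x \<longleftrightarrow> x 0 = 0 \<and> mono_on {0..} x \<and> (\<forall>t\<ge>0. continuous (at_right t) x)"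

lemma counting_path_right_constant:
  assumes "counting_path x" "t \<ge> 0"
  obtains d where "d > 0" "\<And>s. t \<le> s \<Longrightarrow> s < t + d \<Longrightarrow> x s = x t"
proof -
  have "(x \<longlongrightarrow> x t) (at_right t)"
    using assms by (auto simp: counting_path_def continuous_within)
  hence "eventually (\<lambda>s. x s = x t) (at_right t)" by (simp add: tendsto_discrete)
  then obtain b where b: "b > t" "\<And>s. t < s \<Longrightarrow> s < b \<Longrightarrow> x s = x t"
    by (auto simp: eventually_at_right_field)
  show ?thesis
  proof (rule that[of "b - t"])
    fix s assume "t \<le> s" "s < t + (b - t)"
    thus "x s = x t" using b by (cases "s = t") auto
  qed (use b in auto)
qed

lemma counting_path_mono: "counting_path x \<Longrightarrow> 0 \<le> s \<Longrightarrow> s \<le> t \<Longrightarrow> x s \<le> x t"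
  by (auto simp: counting_path_def mono_on_def)

text \<open>
  Right continuity makes the infimum attained, so that the event that the time is at most \<open>t\<close> depends on the
  path at time \<open>t\<close> only.
\<close>

lemma hit_le_iff:
  assumes x: "counting_path x" and ex: "\<exists>t\<ge>0. x t > m" and t: "t \<ge> 0"
  shows "hit m x \<le> t \<longleftrightarrow> x t > m"
proof
  have bdd: "bdd_below {t. t \<ge> 0 \<and> x t > m}" by (auto intro: bdd_belowI[of _ 0])
  have ne: "{t. t \<ge> 0 \<and> x t > m} \<noteq> {}" using ex by auto
  show "hit m x \<le> t" if "x t > m"
    unfolding hit_def using that t by (intro cInf_lower bdd) auto
  show "x t > m" if "hit m x \<le> t"
  proof (rule ccontr)
    assume not: "\<not> x t > m"
    obtain d where d: "d > 0" "\<And>s. t \<le> s \<Longrightarrow> s < t + d \<Longrightarrow> x s = x t"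
      using counting_path_right_constant[OF x t] by blast
    have "t + d \<le> s" if "s \<ge> 0" "x s > m" for s
    proof (rule ccontr)
      assume "\<not> t + d \<le> s"
      hence "x s \<le> x t" using counting_path_mono[OF x, of s t] d(2)[of s] that by (cases "s \<le> t") auto
      thus False using not that by simp
    qed
    hence "t + d \<le> hit m x" unfolding hit_def by (intro cInf_greatest[OF ne]) auto
    thus False using that d by simp
  qed
qed

lemma hit_pos:
  assumes x: "counting_path x" and ex: "\<exists>t\<ge>0. x t > m"
  shows "hit m x > 0"
proof -
  have "hit m x \<ge> 0" unfolding hit_def using ex by (intro cInf_greatest) auto
  moreover have "\<not> hit m x \<le> 0" using hit_le_iff[OF x ex, of 0] x by (simp add: counting_path_def)
  ultimately show ?thesis by simp
qed

definition pois :: "real \<Rightarrow> nat set \<Rightarrow> real" where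
  "pois t S = measure (measure_pmf (poisson_law t)) S"

lemma pmf_poisson_law: "t \<ge> 0 \<Longrightarrow> pmf (poisson_law t) k = poi t k"
  by (auto simp: poisson_law_def poi_def pmf_return power_0_left)

lemma pois_nonneg: "pois t S \<ge> 0" and pois_le_1: "pois t S \<le> 1"
  by (auto simp: pois_def)

lemma pois_finite: "t \<ge> 0 \<Longrightarrow> finite S \<Longrightarrow> pois t S = (\<Sum>k\<in>S. poi t k)"
  by (simp add: pois_def measure_measure_pmf_finite pmf_poisson_law)

lemma pois_atMost: "t \<ge> 0 \<Longrightarrow> pois t {..m} = poi_low t m"
  by (simp add: pois_finite poi_low_def)

lemma pois_Compl: "pois t (- S) = 1 - pois t S"
  unfolding pois_def using measure_pmf.prob_compl[of S "poisson_law t"] by (simp add: Compl_eq_Diff_UNIV)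

lemma pois_greaterThan: "t \<ge> 0 \<Longrightarrow> pois t {m<..} = 1 - poi_low t m"
proof -
  assume "t \<ge> 0"
  have "{m<..} = - {..m}" by auto
  thus ?thesis using \<open>t \<ge> 0\<close> by (simp only: pois_Compl pois_atMost)
qed

lemma continuous_on_poi: "continuous_on S (\<lambda>t. poi t k)"
  unfolding poi_def by (intro continuous_intros) auto

lemma continuous_on_pois_finite: "finite S \<Longrightarrow> continuous_on {0..} (\<lambda>t. pois t S)"
  by (subst continuous_on_cong[OF refl pois_finite]) (auto intro!: continuous_intros continuous_on_poi)

lemma DERIV_poi_low: "((\<lambda>t. poi_low t m) has_field_derivative - poi t m) (at t)"
proof (induction m)
  case 0
  show ?case unfolding poi_low_def poi_def by (auto intro!: derivative_eq_intros)
next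
  case (Suc m)
  have "((\<lambda>t. poi t (Suc m)) has_field_derivative (poi t m - poi t (Suc m))) (at t)"
  proof -
    have "((\<lambda>t. exp (- t) * t ^ Suc m) has_field_derivative real (Suc m) * (exp (- t) * t ^ m) - exp (- t) * t ^ Suc m) (at t)"
      by (rule derivative_eq_intros refl | simp del: power_Suc of_nat_Suc)+
    from DERIV_cdivide[OF this, of "fact (Suc m)"] show ?thesis
      unfolding poi_def by (simp add: diff_divide_distrib del: power_Suc of_nat_Suc)
  qed
  from DERIV_add[OF Suc this] show ?case by (simp add: poi_low_def)
qed

lemma poi_low_at_top: "((\<lambda>t. poi_low t m) \<longlongrightarrow> 0) at_top"
proof -
  have "((\<lambda>t. poi t k) \<longlongrightarrow> 0) at_top" for k unfolding poi_def by real_asymp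
  hence "((\<lambda>t. \<Sum>i\<le>m. poi t i) \<longlongrightarrow> (\<Sum>i\<le>m. 0)) at_top" by (intro tendsto_sum) auto
  thus ?thesis by (simp add: poi_low_def)
qed

lemma poi_borel [measurable]: "(\<lambda>t. poi t k) \<in> borel_measurable borel"
  and poi_low_borel [measurable]: "(\<lambda>t. poi_low t m) \<in> borel_measurable borel"
  unfolding poi_def poi_low_def by measurable

lemma nn_integral_poi: "(\<integral>\<^sup>+t. ennreal (poi t m) * indicator {0..} t \<partial>lborel) = 1"
proof -
  have "(\<integral>\<^sup>+t. ennreal (poi t m) * indicator {0..} t \<partial>lborel) = 0 - (- poi_low 0 m)"
    by (rule nn_integral_FTC_atLeast[where F = "\<lambda>t. - poi_low t m"])
       (auto intro!: poi_nonneg DERIV_minus[OF DERIV_poi_low, simplified] tendsto_minus[OF poi_low_at_top, simplified])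
  also have "poi_low 0 m = 1" unfolding poi_low_def poi_def
    by (subst sum.remove[of _ 0]) (auto intro!: sum.neutral)
  finally show ?thesis by simp
qed

lemma nn_integral_poi_low: "(\<integral>\<^sup>+t. ennreal (poi t m * poi_low t m) * indicator {0..} t \<partial>lborel) = ennreal (1 / 2)"
proof -
  have d: "((\<lambda>t. - ((poi_low t m)\<^sup>2 / 2)) has_field_derivative poi t m * poi_low t m) (at t)" for t
    by (rule derivative_eq_intros DERIV_poi_low refl | simp)+
  have "(\<integral>\<^sup>+t. ennreal (poi t m * poi_low t m) * indicator {0..} t \<partial>lborel) = 0 - (- ((poi_low 0 m)\<^sup>2 / 2))"
  proof (rule nn_integral_FTC_atLeast)
    show "((\<lambda>t. - ((poi_low t m)\<^sup>2 / 2)) \<longlongrightarrow> 0) at_top"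
      using tendsto_divide[OF tendsto_minus[OF tendsto_power[OF poi_low_at_top[of m], of 2]] tendsto_const[of 2]] by simp
  qed (auto intro!: d mult_nonneg_nonneg poi_nonneg poi_low_nonneg)
  also have "poi_low 0 m = 1" unfolding poi_low_def poi_def
    by (subst sum.remove[of _ 0]) (auto intro!: sum.neutral)
  finally show ?thesis by simp
qed

lemma nn_integral_poi_interval:
  assumes "0 \<le> a" "a \<le> b"
  shows "(\<integral>\<^sup>+t. ennreal (poi t m) * indicator {a<..b} t \<partial>lborel) = ennreal (poi_low a m - poi_low b m)"
proof -
  have "(\<integral>\<^sup>+t. ennreal (poi t m) * indicator {a<..b} t \<partial>lborel) = (\<integral>\<^sup>+t. ennreal (poi t m) * indicator {a..b} t \<partial>lborel)"
    by (rule nn_integral_cong_AE) (use AE_lborel_singleton[of a] in eventually_elim, auto simp: indicator_def)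
  also have "\<dots> = (- poi_low b m) - (- poi_low a m)"
    by (rule nn_integral_FTC_Icc[where F = "\<lambda>t. - poi_low t m"])
       (use assms in \<open>auto intro!: poi_nonneg has_field_derivative_at_within DERIV_minus[OF DERIV_poi_low, simplified]\<close>)
  finally show ?thesis by simp
qed

locale iid_paths = prob_space M for M :: "'a measure" +
  fixes X :: "nat \<Rightarrow> real \<Rightarrow> 'a \<Rightarrow> nat"
  assumes iid: "iid_unit_poisson_processes X"
begin

abbreviation path :: "nat \<Rightarrow> 'a \<Rightarrow> real \<Rightarrow> nat" where "path i \<omega> \<equiv> \<lambda>t. X i t \<omega>"

lemma X_measurable [measurable]: "i \<ge> 1 \<Longrightarrow> t \<ge> 0 \<Longrightarrow> X i t \<in> measurable M (count_space UNIV)"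
  using iid by (auto simp: iid_unit_poisson_processes_def poisson_counting_process_def)

lemma counting_path: "i \<ge> 1 \<Longrightarrow> \<omega> \<in> space M \<Longrightarrow> counting_path (path i \<omega>)"
  using iid by (auto simp: iid_unit_poisson_processes_def poisson_counting_process_def counting_path_def)

lemma events_X: "i \<ge> 1 \<Longrightarrow> t \<ge> 0 \<Longrightarrow> {\<omega>\<in>space M. X i t \<omega> \<in> S} \<in> events"
  using measurable_sets[OF X_measurable, of i t S] by (simp add: vimage_def Int_def conj_commute)

lemma prob_increment:
  assumes "i \<ge> 1" "0 \<le> s" "s \<le> t"
  shows "prob {\<omega>\<in>space M. X i t \<omega> - X i s \<omega> \<in> S} = pois (t - s) S"
proof -
  have meas: "(\<lambda>\<omega>. X i t \<omega> - X i s \<omega>) \<in> measurable M (count_space UNIV)"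
  proof -
    have [measurable]: "X i s \<in> measurable M (count_space UNIV)" "X i t \<in> measurable M (count_space UNIV)"
      using assms by auto
    show ?thesis by measurable
  qed
  have "distr M (count_space UNIV) (\<lambda>\<omega>. X i t \<omega> - X i s \<omega>) = measure_pmf (poisson_law (1 * (t - s)))"
    using iid assms unfolding iid_unit_poisson_processes_def poisson_counting_process_def by blast
  hence "pois (t - s) S = measure (distr M (count_space UNIV) (\<lambda>\<omega>. X i t \<omega> - X i s \<omega>)) S"
    by (simp add: pois_def)
  also have "\<dots> = prob ((\<lambda>\<omega>. X i t \<omega> - X i s \<omega>) -` S \<inter> space M)"
    by (rule measure_distr[OF meas]) auto
  also have "(\<lambda>\<omega>. X i t \<omega> - X i s \<omega>) -` S \<inter> space M = {\<omega>\<in>space M. X i t \<omega> - X i s \<omega> \<in> S}" by auto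
  finally show ?thesis by simp
qed

lemma prob_X:
  assumes "i \<ge> 1" "0 \<le> t"
  shows "prob {\<omega>\<in>space M. X i t \<omega> \<in> S} = pois t S"
proof -
  have "{\<omega>\<in>space M. X i t \<omega> - X i 0 \<omega> \<in> S} = {\<omega>\<in>space M. X i t \<omega> \<in> S}"
    using counting_path[OF assms(1)] by (auto simp: counting_path_def)
  thus ?thesis using prob_increment[OF assms(1) order_refl assms(2), of S] by simp
qed

lemma prob_crossing:
  assumes "i \<ge> 1" "0 \<le> a" "a \<le> b"
  shows "prob {\<omega>\<in>space M. X i a \<omega> \<le> m \<and> m < X i b \<omega>} = poi_low a m - poi_low b m"
proof -
  have "{\<omega>\<in>space M. X i a \<omega> \<le> m \<and> m < X i b \<omega>} = {\<omega>\<in>space M. X i a \<omega> \<in> {..m}} - {\<omega>\<in>space M. X i b \<omega> \<in> {..m}}"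
    by auto
  also have "prob \<dots> = prob {\<omega>\<in>space M. X i a \<omega> \<in> {..m}} - prob {\<omega>\<in>space M. X i b \<omega> \<in> {..m}}"
  proof (rule finite_measure_Diff)
    show "{\<omega>\<in>space M. X i b \<omega> \<in> {..m}} \<subseteq> {\<omega>\<in>space M. X i a \<omega> \<in> {..m}}"
      using counting_path_mono[OF counting_path[OF assms(1)] assms(2,3)] by (auto intro: order_trans)
  qed (use assms events_X in auto)
  finally show ?thesis using assms by (simp only: prob_X pois_atMost)
qed

text \<open>
  Two fixed times suffice, so the independence of the whole paths applies. As the path of process \<open>i\<close> is
  monotone, its crossing probability is the difference of two probabilities at fixed times.
\<close>

lemma prob_crossing_indep:
  assumes i: "i \<ge> 1" and I: "finite I" "i \<notin> I" "\<And>h. h \<in> I \<Longrightarrow> h \<ge> 1" and ab: "0 \<le> a" "a \<le> b"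
  shows "prob {\<omega>\<in>space M. X i a \<omega> \<le> m \<and> m < X i b \<omega> \<and> (\<forall>h\<in>I. X h b \<omega> \<in> S h)} =
     (poi_low a m - poi_low b m) * (\<Prod>h\<in>I. pois b (S h))"
proof -
  define N where "N = PiM {0::real..} (\<lambda>_. count_space (UNIV::nat set))"
  define P where "P h \<omega> = (\<lambda>t\<in>{0..}. X h t \<omega>)" for h \<omega>
  have indep: "indep_vars (\<lambda>_. N) P {1..}"
    using iid unfolding iid_unit_poisson_processes_def P_def N_def by blast
  define B where "B h = (if h = i then {x\<in>space N. x a \<le> m \<and> m < x b} else {x\<in>space N. x b \<in> S h})" for h
  have N1 [measurable]: "(\<lambda>x. x t) \<in> measurable N (count_space UNIV)" if "t \<ge> 0" for t
    unfolding N_def using that by (intro measurable_component_singleton) auto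
  have B: "B h \<in> sets N" for h
    unfolding B_def using ab N1[of a] N1[of b] by (cases "h = i") (simp_all, measurable)
  have pre: "P h -` B h \<inter> space M = (if h = i then {\<omega>\<in>space M. X i a \<omega> \<le> m \<and> m < X i b \<omega>} else {\<omega>\<in>space M. X h b \<omega> \<in> S h})" for h
    using ab by (auto simp: B_def P_def N_def space_PiM)
  have "prob (\<Inter>h\<in>insert i I. P h -` B h \<inter> space M) = (\<Prod>h\<in>insert i I. prob (P h -` B h \<inter> space M))"
    by (rule indep_varsD[OF indep]) (use i I B in auto)
  also have "\<dots> = prob (P i -` B i \<inter> space M) * (\<Prod>h\<in>I. prob (P h -` B h \<inter> space M))"
    using I by simp
  also have "(\<Prod>h\<in>I. prob (P h -` B h \<inter> space M)) = (\<Prod>h\<in>I. pois b (S h))"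
    using I ab by (intro prod.cong refl) (auto simp: pre prob_X)
  also have "prob (P i -` B i \<inter> space M) = poi_low a m - poi_low b m"
    using prob_crossing[OF i ab] by (simp add: pre)
  also have "(\<Inter>h\<in>insert i I. P h -` B h \<inter> space M) = {\<omega>\<in>space M. X i a \<omega> \<le> m \<and> m < X i b \<omega> \<and> (\<forall>h\<in>I. X h b \<omega> \<in> S h)}"
    using I by (auto simp: pre split: if_splits)
  finally show ?thesis .
qed

definition hits :: "nat \<Rightarrow> nat \<Rightarrow> 'a \<Rightarrow> bool" where
  "hits m i \<omega> \<longleftrightarrow> (\<exists>t\<ge>0. X i t \<omega> > m)"

definition hit_event :: "nat \<Rightarrow> nat \<Rightarrow> nat set \<Rightarrow> (nat \<Rightarrow> nat set) \<Rightarrow> 'a set" where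
  "hit_event m i I S = {\<omega>\<in>space M. hits m i \<omega> \<and> (\<forall>h\<in>I. X h (hit m (path i \<omega>)) \<omega> \<in> S h)}"

text \<open>
  The next grid point of mesh \<open>1 / Suc r\<close> at or after \<open>t\<close>; rounding upwards lets right continuity
  recover the path at \<open>t\<close> in the limit.
\<close>

definition grid_up :: "nat \<Rightarrow> real \<Rightarrow> real" where
  "grid_up r t = of_int \<lceil>t * real (Suc r)\<rceil> / real (Suc r)"

lemma grid_up_bounds: "t \<le> grid_up r t" "grid_up r t < t + 1 / real (Suc r)"
proof -
  have "t * real (Suc r) \<le> of_int \<lceil>t * real (Suc r)\<rceil>" by simp
  thus "t \<le> grid_up r t" by (simp add: grid_up_def field_simps del: of_nat_Suc)
  have "of_int \<lceil>t * real (Suc r)\<rceil> < t * real (Suc r) + 1" by linarith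
  thus "grid_up r t < t + 1 / real (Suc r)" by (simp add: grid_up_def field_simps del: of_nat_Suc)
qed

lemma grid_up_tendsto: "(\<lambda>r. grid_up r t) \<longlonglongrightarrow> t"
proof (rule tendsto_sandwich[of "\<lambda>_. t" _ _ "\<lambda>r. t + 1 / real (Suc r)"])
  show "(\<lambda>r. t + 1 / real (Suc r)) \<longlonglongrightarrow> t" by real_asymp
  show "eventually (\<lambda>r. t \<le> grid_up r t) sequentially"
    by (intro always_eventually allI grid_up_bounds)
  show "eventually (\<lambda>r. grid_up r t \<le> t + 1 / real (Suc r)) sequentially"
    by (intro always_eventually allI less_imp_le[OF grid_up_bounds(2)])
qed simp

lemma grid_up_eq:
  assumes "real c / real (Suc r) < t" "t \<le> real (Suc c) / real (Suc r)"
  shows "grid_up r t = real (Suc c) / real (Suc r)"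
proof -
  have "\<lceil>t * real (Suc r)\<rceil> = int (Suc c)"
    using assms by (intro ceiling_unique) (auto simp: field_simps simp del: of_nat_Suc)
  thus ?thesis by (simp add: grid_up_def)
qed

lemma grid_cell:
  assumes "t > 0"
  obtains c where "real c / real (Suc r) < t" "t \<le> real (Suc c) / real (Suc r)"
proof -
  have pos: "t * real (Suc r) > 0" using assms by simp
  define c where "c = nat (\<lceil>t * real (Suc r)\<rceil> - 1)"
  have "\<lceil>t * real (Suc r)\<rceil> \<ge> 1" using pos by (simp add: less_ceiling_iff)
  hence "real c = of_int \<lceil>t * real (Suc r)\<rceil> - 1" by (simp add: c_def)
  hence "real c < t * real (Suc r)" "t * real (Suc r) \<le> real (Suc c)" by linarith+
  thus ?thesis using that[of c] by (simp add: field_simps del: of_nat_Suc)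
qed

text \<open>
  If the other paths are read off at the next grid point instead of the hitting time itself, the event splits
  according to the grid cell of the hitting time, and within a cell everything happens at two fixed times.
\<close>

lemma hit_event_grid:
  fixes m i :: nat and I :: "nat set" and S :: "nat \<Rightarrow> nat set"
  assumes i: "i \<ge> 1" and I: "finite I" "i \<notin> I" "\<And>h. h \<in> I \<Longrightarrow> h \<ge> 1"
  defines "E \<equiv> \<lambda>r. {\<omega>\<in>space M. hits m i \<omega> \<and> (\<forall>h\<in>I. X h (grid_up r (hit m (path i \<omega>))) \<omega> \<in> S h)}"
  shows "E r \<in> events"
    and "emeasure M (E r) = (\<integral>\<^sup>+t. ennreal (poi t m * (\<Prod>h\<in>I. pois (grid_up r t) (S h))) * indicator {0<..} t \<partial>lborel)"
proof -
  define a where "a c = real c / real (Suc r)" for c :: nat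
  have a0: "a c \<ge> 0" and a_le: "a c \<le> a (Suc c)" for c
    by (auto simp: a_def divide_right_mono)
  have grid_a: "a c < t \<Longrightarrow> t \<le> a (Suc c) \<Longrightarrow> grid_up r t = a (Suc c)" for c t
    unfolding a_def by (rule grid_up_eq)
  define G where "G c = {\<omega>\<in>space M. X i (a c) \<omega> \<le> m \<and> m < X i (a (Suc c)) \<omega> \<and> (\<forall>h\<in>I. X h (a (Suc c)) \<omega> \<in> S h)}" for c
  have G_iff: "\<omega> \<in> G c \<longleftrightarrow> \<omega> \<in> space M \<and> hits m i \<omega> \<and> a c < hit m (path i \<omega>) \<and> hit m (path i \<omega>) \<le> a (Suc c)
      \<and> (\<forall>h\<in>I. X h (grid_up r (hit m (path i \<omega>))) \<omega> \<in> S h)" for \<omega> c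
  proof (cases "\<omega> \<in> space M \<and> hits m i \<omega>")
    case True
    hence iff: "t \<ge> 0 \<Longrightarrow> hit m (path i \<omega>) \<le> t \<longleftrightarrow> X i t \<omega> > m" for t
      using hit_le_iff[OF counting_path[OF i]] by (auto simp: hits_def)
    show ?thesis
      using True iff[OF a0[of c]] iff[OF a0[of "Suc c"]] grid_a[of c "hit m (path i \<omega>)"]
      by (auto simp: G_def not_less not_le)
  next
    case False
    thus ?thesis using a0[of "Suc c"] by (auto simp: G_def hits_def)
  qed
  have E_eq: "E r = (\<Union>c. G c)"
  proof (intro equalityI subsetI)
    fix \<omega> assume w: "\<omega> \<in> E r"
    hence "hit m (path i \<omega>) > 0" using hit_pos[OF counting_path[OF i]] by (auto simp: E_def hits_def)
    then obtain c where "a c < hit m (path i \<omega>)" "hit m (path i \<omega>) \<le> a (Suc c)"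
      using grid_cell unfolding a_def by blast
    thus "\<omega> \<in> (\<Union>c. G c)" using w by (auto simp: E_def G_iff)
  qed (auto simp: E_def G_iff)
  have G_events [measurable]: "G c \<in> events" for c
  proof -
    have [measurable]: "X h (a c) \<in> measurable M (count_space UNIV)" if "h \<ge> 1" for h c using that a0 by measurable
    have "G c = {\<omega>\<in>space M. X i (a c) \<omega> \<le> m \<and> m < X i (a (Suc c)) \<omega>} \<inter> {\<omega>\<in>space M. \<forall>h\<in>I. X h (a (Suc c)) \<omega> \<in> S h}"
      by (auto simp: G_def)
    also have "\<dots> \<in> events"
    proof (intro sets.Int)
      show "{\<omega>\<in>space M. X i (a c) \<omega> \<le> m \<and> m < X i (a (Suc c)) \<omega>} \<in> events" using i by measurable
      show "{\<omega>\<in>space M. \<forall>h\<in>I. X h (a (Suc c)) \<omega> \<in> S h} \<in> events"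
      proof (intro sets.sets_Collect_finite_All I(1))
        fix h assume "h \<in> I"
        thus "{\<omega>\<in>space M. X h (a (Suc c)) \<omega> \<in> S h} \<in> events" using I(3)[of h] by measurable
      qed
    qed
    finally show ?thesis .
  qed
  show "E r \<in> events" unfolding E_eq by measurable
  have cell_unique: "c = d" if "a c < t" "t \<le> a (Suc c)" "a d < t" "t \<le> a (Suc d)" for c d t
    using grid_a[OF that(1,2)] grid_a[OF that(3,4)] by (simp add: a_def divide_eq_eq del: of_nat_Suc)
  have disj: "disjoint_family G"
    unfolding disjoint_family_on_def using cell_unique by (auto simp: G_iff)
  have mG: "emeasure M (G c) = (\<integral>\<^sup>+t. ennreal (poi t m * (\<Prod>h\<in>I. pois (grid_up r t) (S h))) * indicator {a c<..a (Suc c)} t \<partial>lborel)" for c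
  proof -
    have pos: "(\<Prod>h\<in>I. pois (a (Suc c)) (S h)) \<ge> 0" by (intro prod_nonneg) (auto intro: pois_nonneg)
    have "emeasure M (G c) = ennreal ((poi_low (a c) m - poi_low (a (Suc c)) m) * (\<Prod>h\<in>I. pois (a (Suc c)) (S h)))"
      unfolding emeasure_eq_measure G_def by (subst prob_crossing_indep[OF i I a0 a_le]) auto
    also have "\<dots> = ennreal (poi_low (a c) m - poi_low (a (Suc c)) m) * ennreal (\<Prod>h\<in>I. pois (a (Suc c)) (S h))"
      by (rule ennreal_mult'') (rule pos)
    also have "\<dots> = (\<integral>\<^sup>+t. ennreal (poi t m) * indicator {a c<..a (Suc c)} t \<partial>lborel) * ennreal (\<Prod>h\<in>I. pois (a (Suc c)) (S h))"
      by (subst nn_integral_poi_interval[OF a0 a_le]) simp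
    also have "\<dots> = (\<integral>\<^sup>+t. ennreal (poi t m) * indicator {a c<..a (Suc c)} t * ennreal (\<Prod>h\<in>I. pois (a (Suc c)) (S h)) \<partial>lborel)"
      by (rule nn_integral_multc [symmetric]) measurable
    also have "\<dots> = (\<integral>\<^sup>+t. ennreal (poi t m * (\<Prod>h\<in>I. pois (grid_up r t) (S h))) * indicator {a c<..a (Suc c)} t \<partial>lborel)"
    proof (rule nn_integral_cong)
      fix t
      show "ennreal (poi t m) * indicator {a c<..a (Suc c)} t * ennreal (\<Prod>h\<in>I. pois (a (Suc c)) (S h)) =
            ennreal (poi t m * (\<Prod>h\<in>I. pois (grid_up r t) (S h))) * indicator {a c<..a (Suc c)} t"
      proof (cases "t \<in> {a c<..a (Suc c)}")
        case True
        hence "grid_up r t = a (Suc c)" using grid_a[of c t] by simp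
        thus ?thesis using True pos by (simp add: ennreal_mult'')
      qed auto
    qed
    finally show ?thesis .
  qed
  have "emeasure M (E r) = (\<Sum>c. emeasure M (G c))"
    unfolding E_eq by (rule suminf_emeasure [symmetric]) (use G_events disj in auto)
  also have "\<dots> = (\<integral>\<^sup>+t. (\<Sum>c. ennreal (poi t m * (\<Prod>h\<in>I. pois (grid_up r t) (S h))) * indicator {a c<..a (Suc c)} t) \<partial>lborel)"
    unfolding mG
  proof (rule nn_integral_suminf [symmetric])
    fix c
    have "(\<lambda>t. ennreal (poi t m * (\<Prod>h\<in>I. pois (grid_up r t) (S h))) * indicator {a c<..a (Suc c)} t) =
          (\<lambda>t. ennreal (poi t m * (\<Prod>h\<in>I. pois (a (Suc c)) (S h))) * indicator {a c<..a (Suc c)} t)"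
      using grid_a[of c] by (auto simp: fun_eq_iff indicator_def)
    thus "(\<lambda>t. ennreal (poi t m * (\<Prod>h\<in>I. pois (grid_up r t) (S h))) * indicator {a c<..a (Suc c)} t) \<in> borel_measurable lborel"
      by simp
  qed
  also have "\<dots> = (\<integral>\<^sup>+t. ennreal (poi t m * (\<Prod>h\<in>I. pois (grid_up r t) (S h))) * indicator {0<..} t \<partial>lborel)"
  proof (rule nn_integral_cong)
    fix t
    have dis: "disjoint_family (\<lambda>c. {a c<..a (Suc c)})"
    proof -
      have "c = d" if "y \<in> {a c<..a (Suc c)}" "y \<in> {a d<..a (Suc d)}" for c d y
        using cell_unique[of c y d] that by simp
      thus ?thesis unfolding disjoint_family_on_def by blast
    qed
    have un: "(\<Union>c. {a c<..a (Suc c)}) = {0<..}"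
    proof (intro equalityI subsetI)
      fix y :: real assume "y \<in> {0<..}"
      then obtain c where "a c < y" "y \<le> a (Suc c)" using grid_cell[of y] unfolding a_def by auto
      thus "y \<in> (\<Union>c. {a c<..a (Suc c)})" by auto
    qed (use a0 in \<open>auto intro: le_less_trans\<close>)
    show "(\<Sum>c. ennreal (poi t m * (\<Prod>h\<in>I. pois (grid_up r t) (S h))) * indicator {a c<..a (Suc c)} t) =
       ennreal (poi t m * (\<Prod>h\<in>I. pois (grid_up r t) (S h))) * indicator {0<..} t"
      unfolding ennreal_suminf_cmult suminf_indicator[OF dis] un ..
  qed
  finally show "emeasure M (E r) = (\<integral>\<^sup>+t. ennreal (poi t m * (\<Prod>h\<in>I. pois (grid_up r t) (S h))) * indicator {0<..} t \<partial>lborel)" .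
qed

text \<open>
  Evaluating independent paths at the hitting time of another path amounts to integrating their fixed time
  probabilities against the density \<open>poi t m\<close> of that hitting time. Evaluation at a random time is
  not measurable for the product sigma-algebra on paths, so Fubini's theorem does not apply
  directly; instead both sides are limits of their versions on a grid, by right continuity of the paths
  and by continuity of the probabilities in \<open>t\<close>.
\<close>

lemma hit_event_integral:
  assumes i: "i \<ge> 1" and I: "finite I" "i \<notin> I" "\<And>h. h \<in> I \<Longrightarrow> h \<ge> 1"
    and cont: "\<And>h. h \<in> I \<Longrightarrow> continuous_on {0..} (\<lambda>t. pois t (S h))"
  shows "hit_event m i I S \<in> events"
    and "emeasure M (hit_event m i I S) = (\<integral>\<^sup>+t. ennreal (poi t m * (\<Prod>h\<in>I. pois t (S h))) * indicator {0..} t \<partial>lborel)"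
proof -
  define E where "E r = {\<omega>\<in>space M. hits m i \<omega> \<and> (\<forall>h\<in>I. X h (grid_up r (hit m (path i \<omega>))) \<omega> \<in> S h)}" for r
  note grid = hit_event_grid[OF i I, where m = m and S = S, folded E_def]
  define g where "g r t = ennreal (poi t m * (\<Prod>h\<in>I. pois (grid_up r t) (S h))) * indicator {0<..} t" for r t
  have ev: "eventually (\<lambda>r. \<omega> \<in> E r \<longleftrightarrow> \<omega> \<in> hit_event m i I S) sequentially" if w: "\<omega> \<in> space M" for \<omega>
  proof (cases "hits m i \<omega>")
    case True
    define T where "T = hit m (path i \<omega>)"
    have T0: "T \<ge> 0" using hit_pos[OF counting_path[OF i w]] True by (simp add: T_def hits_def less_imp_le)
    have "eventually (\<lambda>r. X h (grid_up r T) \<omega> = X h T \<omega>) sequentially" if h: "h \<in> I" for h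
    proof -
      obtain d where d: "d > 0" "\<And>s. T \<le> s \<Longrightarrow> s < T + d \<Longrightarrow> path h \<omega> s = path h \<omega> T"
        using counting_path_right_constant[OF counting_path[OF I(3)[OF h] w] T0] by blast
      have "eventually (\<lambda>r. grid_up r T < T + d) sequentially"
        by (rule order_tendstoD(2)[OF grid_up_tendsto]) (use d in auto)
      thus ?thesis by eventually_elim (use d(2) grid_up_bounds(1) in auto)
    qed
    hence "eventually (\<lambda>r. \<forall>h\<in>I. X h (grid_up r T) \<omega> = X h T \<omega>) sequentially"
      using I(1) by (simp add: eventually_ball_finite)
    thus ?thesis by eventually_elim (auto simp: E_def hit_event_def T_def)
  next
    case False
    thus ?thesis by (auto simp: E_def hit_event_def)
  qed
  have lim_ind: "(\<lambda>r. indicator (E r) \<omega> :: ennreal) \<longlonglongrightarrow> indicator (hit_event m i I S) \<omega>" if "\<omega> \<in> space M" for \<omega>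
    by (rule tendsto_eventually) (use ev[OF that] in eventually_elim, auto simp: indicator_def)
  have meas: "(indicator (hit_event m i I S) :: 'a \<Rightarrow> ennreal) \<in> borel_measurable M"
    by (rule borel_measurable_LIMSEQ_order[OF lim_ind]) (use grid(1) in auto)
  have sub: "hit_event m i I S \<subseteq> space M" by (auto simp: hit_event_def)
  show ev_h: "hit_event m i I S \<in> events"
    using meas sub by (simp add: borel_measurable_indicator_iff Int_absorb2 Int_absorb1)
  have "(\<lambda>r. \<integral>\<^sup>+\<omega>. indicator (E r) \<omega> \<partial>M) \<longlonglongrightarrow> (\<integral>\<^sup>+\<omega>. indicator (hit_event m i I S) \<omega> \<partial>M)"
  proof (rule nn_integral_dominated_convergence[where w = "\<lambda>_. 1"])
    show "AE \<omega> in M. indicator (E r) \<omega> \<le> (1::ennreal)" for r by (simp add: indicator_def)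
    show "AE \<omega> in M. (\<lambda>r. indicator (E r) \<omega> :: ennreal) \<longlonglongrightarrow> indicator (hit_event m i I S) \<omega>"
      by (intro AE_I2 lim_ind)
  qed (use grid(1) meas in \<open>simp_all add: emeasure_space_1\<close>)
  hence 1: "(\<lambda>r. emeasure M (E r)) \<longlonglongrightarrow> emeasure M (hit_event m i I S)"
    using grid(1) ev_h by simp
  have pois_grid: "(\<lambda>r. pois (grid_up r t) (S h)) \<longlonglongrightarrow> pois t (S h)" if "h \<in> I" "t > 0" for h t
  proof (rule continuous_on_tendsto_compose[OF cont[OF that(1)] grid_up_tendsto])
    show "eventually (\<lambda>r. grid_up r t \<in> {0..}) sequentially"
    proof (intro always_eventually allI)
      fix r show "grid_up r t \<in> {0..}" using grid_up_bounds(1)[of t r] that(2) by simp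
    qed
  qed (use that in auto)
  \<comment> \<open>Extended to negative \<open>t\<close> by the value at \<open>0\<close>, to have a Borel function on the whole line.\<close>
  have pois_cont_ext: "(\<lambda>t. pois (max 0 t) (S h)) \<in> borel_measurable borel" if "h \<in> I" for h
  proof (rule borel_measurable_continuous_onI)
    show "continuous_on UNIV (\<lambda>t. pois (max 0 t) (S h))"
      by (rule continuous_on_compose2[OF cont[OF that], where f = "\<lambda>t. max 0 t" and s = UNIV])
         (auto intro!: continuous_intros)
  qed
  have g_eq: "g r = (\<lambda>t. ennreal (poi t m * (\<Prod>h\<in>I. pois (max 0 (grid_up r t)) (S h))) * indicator {0<..} t)" for r
  proof
    fix t
    show "g r t = ennreal (poi t m * (\<Prod>h\<in>I. pois (max 0 (grid_up r t)) (S h))) * indicator {0<..} t"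
      using grid_up_bounds(1)[of t r] by (cases "t > 0") (auto simp: g_def max_def)
  qed
  have g_meas: "g r \<in> borel_measurable lborel" for r
  proof -
    have [measurable]: "grid_up r \<in> borel_measurable borel" unfolding grid_up_def[abs_def] by measurable
    have [measurable]: "(\<lambda>t. pois (max 0 (grid_up r t)) (S h)) \<in> borel_measurable borel" if "h \<in> I" for h
      using measurable_compose[OF \<open>grid_up r \<in> borel_measurable borel\<close> pois_cont_ext[OF that]] by simp
    show ?thesis unfolding g_eq by measurable
  qed
  define g0 where "g0 t = ennreal (poi t m * (\<Prod>h\<in>I. pois t (S h))) * indicator {0<..} t" for t
  have g0_eq: "g0 = (\<lambda>t. ennreal (poi t m * (\<Prod>h\<in>I. pois (max 0 t) (S h))) * indicator {0<..} t)"
    by (auto simp: fun_eq_iff g0_def indicator_def max_def)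
  have [measurable]: "g0 \<in> borel_measurable lborel"
    unfolding g0_eq using pois_cont_ext by measurable
  have "(\<lambda>r. \<integral>\<^sup>+t. g r t \<partial>lborel) \<longlonglongrightarrow> (\<integral>\<^sup>+t. g0 t \<partial>lborel)"
  proof (rule nn_integral_dominated_convergence[where w = "\<lambda>t. ennreal (poi t m) * indicator {0..} t"])
    show "AE t in lborel. g r t \<le> ennreal (poi t m) * indicator {0..} t" for r
    proof (intro AE_I2)
      fix t
      have "poi t m * (\<Prod>h\<in>I. pois (grid_up r t) (S h)) \<le> poi t m" if "t > 0"
        using that by (intro mult_left_le poi_nonneg prod_le_1) (auto intro: pois_nonneg pois_le_1)
      thus "g r t \<le> ennreal (poi t m) * indicator {0..} t"
        by (auto simp: g_def indicator_def intro!: ennreal_leI)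
    qed
    show "AE t in lborel. (\<lambda>r. g r t) \<longlonglongrightarrow> g0 t"
    proof (intro AE_I2)
      fix t :: real
      show "(\<lambda>r. g r t) \<longlonglongrightarrow> g0 t"
      proof (cases "t > 0")
        case True
        have "(\<lambda>r. poi t m * (\<Prod>h\<in>I. pois (grid_up r t) (S h))) \<longlonglongrightarrow> poi t m * (\<Prod>h\<in>I. pois t (S h))"
          by (intro tendsto_intros pois_grid True)
        thus ?thesis using True by (simp add: g_def g0_def tendsto_ennrealI)
      qed (auto simp: g_def g0_def)
    qed
  qed (use g_meas nn_integral_poi[of m] in auto)
  hence "(\<lambda>r. emeasure M (E r)) \<longlonglongrightarrow> (\<integral>\<^sup>+t. g0 t \<partial>lborel)"
    using grid(2) by (simp add: g_def)
  hence "emeasure M (hit_event m i I S) = (\<integral>\<^sup>+t. g0 t \<partial>lborel)"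
    using 1 LIMSEQ_unique by blast
  also have "\<dots> = (\<integral>\<^sup>+t. ennreal (poi t m * (\<Prod>h\<in>I. pois t (S h))) * indicator {0..} t \<partial>lborel)"
    by (rule nn_integral_cong_AE) (use AE_lborel_singleton[of 0] in eventually_elim, auto simp: g0_def indicator_def)
  finally show "emeasure M (hit_event m i I S) = (\<integral>\<^sup>+t. ennreal (poi t m * (\<Prod>h\<in>I. pois t (S h))) * indicator {0..} t \<partial>lborel)" .
qed

end

section \<open>The stopping time along a path\<close>

text \<open>The index set \<open>{1..n}\<close> is kept in this form during simplification.\<close>

declare One_nat_def [simp del]

lemma common_right_constant:
  assumes x: "\<And>i. i \<in> {1..n} \<Longrightarrow> counting_path (x i)" and t: "t \<ge> 0"
  obtains d where "d > 0" "\<And>i s. i \<in> {1..n::nat} \<Longrightarrow> t \<le> s \<Longrightarrow> s < t + d \<Longrightarrow> x i s = x i t"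
proof -
  have "\<forall>i\<in>{1..n}. \<exists>d>0. \<forall>s. t \<le> s \<longrightarrow> s < t + d \<longrightarrow> x i s = x i t"
    using counting_path_right_constant[OF x t] by metis
  then obtain D where D: "\<And>i. i \<in> {1..n} \<Longrightarrow> D i > 0" "\<And>i s. i \<in> {1..n} \<Longrightarrow> t \<le> s \<Longrightarrow> s < t + D i \<Longrightarrow> x i s = x i t"
    by metis
  show ?thesis
  proof (rule that[of "Min (insert 1 (D ` {1..n}))"])
    show "Min (insert 1 (D ` {1..n})) > 0" using D(1) by (subst Min_gr_iff) auto
    fix i s assume "i \<in> {1..n}" "t \<le> s" "s < t + Min (insert 1 (D ` {1..n}))"
    moreover from this(1) have "Min (insert 1 (D ` {1..n})) \<le> D i" by (intro Min_le) auto
    ultimately have "s < t + D i" by linarith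
    with \<open>i \<in> {1..n}\<close> \<open>t \<le> s\<close> show "x i s = x i t" by (rule D(2))
  qed
qed

definition below :: "nat \<Rightarrow> (nat \<Rightarrow> real \<Rightarrow> nat) \<Rightarrow> nat \<Rightarrow> real \<Rightarrow> nat" where
  "below m x n t = card {i\<in>{1..n}. \<not> x i t > m}"

definition mult_at :: "(nat \<Rightarrow> real \<Rightarrow> nat) \<Rightarrow> nat \<Rightarrow> real \<Rightarrow> nat" where
  "mult_at x n t = card {i \<in> {1..n}. x i t = Max ((\<lambda>h. x h t) ` {1..n})}"

lemma below_antimono:
  assumes "\<And>i. i \<in> {1..n} \<Longrightarrow> counting_path (x i)" "0 \<le> s" "s \<le> t"
  shows "below m x n t \<le> below m x n s"
proof -
  have "{i\<in>{1..n}. \<not> x i t > m} \<subseteq> {i\<in>{1..n}. \<not> x i s > m}"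
  proof safe
    fix i assume "i \<in> {1..n}" "\<not> x i t > m" "x i s > m"
    thus False using counting_path_mono[OF assms(1) assms(2,3), of i] by linarith
  qed
  thus ?thesis unfolding below_def by (intro card_mono) auto
qed

lemma below_cong: "(\<And>i. i \<in> {1..n} \<Longrightarrow> x i s = x i t) \<Longrightarrow> below m x n s = below m x n t"
  unfolding below_def by (intro arg_cong[where f = card]) auto

lemma mult_at_cong:
  assumes "\<And>i. i \<in> {1..n} \<Longrightarrow> x i s = x i t" shows "mult_at x n s = mult_at x n t"
proof -
  have "(\<lambda>h. x h s) ` {1..n} = (\<lambda>h. x h t) ` {1..n}" using assms by (intro image_cong) auto
  thus ?thesis unfolding mult_at_def using assms by (intro arg_cong[where f = card]) auto
qed

text \<open>
  The number of paths that are still at most \<open>m\<close> is a nonincreasing, right continuous step function of time.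
\<close>

lemma stop_time_attained:
  assumes x: "\<And>i. i \<in> {1..n} \<Longrightarrow> counting_path (x i)" and ex: "\<exists>t\<ge>0. all_but_exceed m l x n t"
  shows "stop_time m l x n \<ge> 0" "below m x n (stop_time m l x n) = l"
    "\<And>t. t \<ge> 0 \<Longrightarrow> below m x n t \<le> l \<longleftrightarrow> stop_time m l x n \<le> t"
proof -
  have abe: "all_but_exceed m l x n t \<longleftrightarrow> below m x n t = l" for t
    by (simp add: all_but_exceed_def below_def)
  define S where "S = {t. t \<ge> 0 \<and> below m x n t = l}"
  have S: "S \<noteq> {}" "bdd_below S" using ex by (auto simp: S_def abe intro: bdd_belowI[of _ 0])
  have I0: "Inf S \<ge> 0" by (rule cInf_greatest) (use S in \<open>auto simp: S_def\<close>)
  obtain d where d: "d > 0" "\<And>i s. i \<in> {1..n} \<Longrightarrow> Inf S \<le> s \<Longrightarrow> s < Inf S + d \<Longrightarrow> x i s = x i (Inf S)"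
    using common_right_constant[of n x, OF x I0] by blast
  obtain t where t: "t \<in> S" "t < Inf S + d"
    using cInf_lessD[OF S(1), of "Inf S + d"] d(1) by auto
  have "Inf S \<le> t" using t S by (intro cInf_lower) auto
  hence "below m x n t = below m x n (Inf S)" using t(2) by (intro below_cong d(2))
  hence bI: "below m x n (Inf S) = l" using t by (simp add: S_def)
  have eq: "stop_time m l x n = Inf S"
    unfolding stop_time_def
  proof (rule Least_equality)
    show "0 \<le> Inf S \<and> all_but_exceed m l x n (Inf S)" using I0 bI by (simp add: abe)
    show "Inf S \<le> y" if "0 \<le> y \<and> all_but_exceed m l x n y" for y
      using that S by (intro cInf_lower) (auto simp: S_def abe)
  qed
  show "stop_time m l x n \<ge> 0" "below m x n (stop_time m l x n) = l" using eq I0 bI by auto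
  fix t :: real assume t: "t \<ge> 0"
  show "below m x n t \<le> l \<longleftrightarrow> stop_time m l x n \<le> t"
  proof
    assume le: "below m x n t \<le> l"
    show "stop_time m l x n \<le> t"
    proof (rule ccontr)
      assume "\<not> stop_time m l x n \<le> t"
      hence "below m x n (Inf S) \<le> below m x n t" using below_antimono[where x = x and s = t and t = "Inf S" and n = n and m = m] x t eq by auto
      hence "t \<in> S" using le bI t by (simp add: S_def)
      hence "Inf S \<le> t" using S by (intro cInf_lower) auto
      thus False using \<open>\<not> stop_time m l x n \<le> t\<close> eq by simp
    qed
  next
    assume "stop_time m l x n \<le> t"
    thus "below m x n t \<le> l" using below_antimono[where x = x and s = "Inf S" and t = t and n = n and m = m] x I0 bI eq by auto
  qed
qed

lemma max_mult_eq_mult_at: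
  "max_mult m l x n = (if \<exists>t\<ge>0. all_but_exceed m l x n t then mult_at x n (stop_time m l x n) else 0)"
  by (simp only: max_mult_def mult_at_def)

text \<open>
  A description by countably many fixed times, for measurability. Given that the stopping condition is met,
  \<open>below \<le> l\<close> says that the stopping time has been reached. The second condition asks that the multiplicity be
  \<open>j\<close> at all rational times from the stopping time up to some later \<open>q\<close>; by right continuity this is
  the multiplicity at the stopping time itself.
\<close>

lemma max_mult_rational:
  assumes x: "\<And>i. i \<in> {1..n} \<Longrightarrow> counting_path (x i)" and j: "j \<ge> 1"
  shows "max_mult m l x n = j \<longleftrightarrow>
    (\<exists>p::rat. p \<ge> 0 \<and> below m x n (of_rat p) = l) \<and>
    (\<exists>q::rat. (\<exists>p::rat. 0 \<le> p \<and> p < q \<and> below m x n (of_rat p) \<le> l) \<and>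
        (\<forall>p::rat. 0 \<le> p \<and> p < q \<longrightarrow> below m x n (of_rat p) \<le> l \<longrightarrow> mult_at x n (of_rat p) = j))"
    (is "_ \<longleftrightarrow> ?E \<and> ?Q")
proof -
  define \<tau> where "\<tau> = stop_time m l x n"
  have rat_between: "\<exists>p::rat. 0 \<le> p \<and> a < of_rat p \<and> of_rat p < b" if ab: "0 \<le> a" "a < b" for a b :: real
  proof -
    obtain p :: rat where p: "a < of_rat p" "of_rat p < b" using of_rat_dense[OF ab(2)] by blast
    have "0 < (of_rat p :: real)" using p ab by linarith
    hence "0 \<le> p" by (simp add: less_imp_le)
    thus ?thesis using p by blast
  qed
  have ex_iff: "(\<exists>t\<ge>0. all_but_exceed m l x n t) \<longleftrightarrow> ?E"
  proof
    assume "\<exists>t\<ge>0. all_but_exceed m l x n t"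
    then obtain t where t: "t \<ge> 0" "below m x n t = l" by (auto simp: all_but_exceed_def below_def)
    obtain d where d: "d > 0" "\<And>i s. i \<in> {1..n} \<Longrightarrow> t \<le> s \<Longrightarrow> s < t + d \<Longrightarrow> x i s = x i t"
      using common_right_constant[of n x, OF x t(1)] by blast
    obtain p :: rat where p: "0 \<le> p" "t < of_rat p" "of_rat p < t + d" using rat_between[OF t(1), of "t + d"] d by auto
    have "below m x n (of_rat p) = below m x n t" using p by (intro below_cong d(2)) auto
    thus ?E using p t by auto
  next
    assume ?E
    then obtain p where "p \<ge> 0" "below m x n (of_rat p) = l" by blast
    thus "\<exists>t\<ge>0. all_but_exceed m l x n t"
      by (intro exI[of _ "of_rat p"]) (auto simp: all_but_exceed_def below_def)
  qed
  show ?thesis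
  proof (cases "\<exists>t\<ge>0. all_but_exceed m l x n t")
    case False
    hence "max_mult m l x n = 0" by (simp only: max_mult_def if_False)
    thus ?thesis using j ex_iff False by auto
  next
    case True
    note st = stop_time_attained[OF x True, folded \<tau>_def]
    obtain d where d: "d > 0" "\<And>i s. i \<in> {1..n} \<Longrightarrow> \<tau> \<le> s \<Longrightarrow> s < \<tau> + d \<Longrightarrow> x i s = x i \<tau>"
      using common_right_constant[of n x, OF x st(1)] by blast
    have near: "mult_at x n s = mult_at x n \<tau>" if "\<tau> \<le> s" "s < \<tau> + d" for s
      using that by (intro mult_at_cong d(2)) auto
    have "mult_at x n \<tau> = j \<longleftrightarrow> ?Q"
    proof
      assume eq: "mult_at x n \<tau> = j"
      obtain q :: rat where q: "0 \<le> q" "\<tau> < of_rat q" "of_rat q < \<tau> + d" using rat_between[OF st(1), of "\<tau> + d"] d(1) by auto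
      obtain p :: rat where p: "0 \<le> p" "\<tau> < of_rat p" "of_rat p < (of_rat q :: real)" using rat_between[OF st(1) q(2)] by auto
      have "below m x n (of_rat p) \<le> l" using st(3)[of "of_rat p"] p by auto
      moreover have "p < q" using p by (simp add: of_rat_less)
      moreover have "mult_at x n (of_rat u) = j" if u: "0 \<le> u \<and> u < q" "below m x n (of_rat u) \<le> l" for u :: rat
      proof -
        have "of_rat u < (of_rat q :: real)" using u by (simp add: of_rat_less)
        thus ?thesis using near[of "of_rat u"] st(3)[of "of_rat u"] u q eq by auto
      qed
      ultimately show ?Q using p(1) by blast
    next
      assume ?Q
      then obtain q p :: rat where q: "0 \<le> p" "p < q" "below m x n (of_rat p) \<le> l"
        "\<And>p. 0 \<le> p \<Longrightarrow> p < q \<Longrightarrow> below m x n (of_rat p) \<le> l \<Longrightarrow> mult_at x n (of_rat p) = j" by blast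
      have "\<tau> \<le> of_rat p" using st(3)[of "of_rat p"] q by simp
      moreover have "(of_rat p :: real) < of_rat q" using q(2) by (simp add: of_rat_less)
      ultimately have "\<tau> < of_rat q" by linarith
      then obtain u :: rat where u: "0 \<le> u" "\<tau> < of_rat u" "of_rat u < min (of_rat q) (\<tau> + d)"
        using rat_between[OF st(1), of "min (of_rat q) (\<tau> + d)"] d(1) by auto
      have "u < q" using u(3) by (simp add: of_rat_less)
      hence "mult_at x n (of_rat u) = j" using q(4)[of u] u st(3)[of "of_rat u"] by auto
      thus "mult_at x n \<tau> = j" using near[of "of_rat u"] u by auto
    qed
    thus ?thesis using True ex_iff by (simp add: max_mult_eq_mult_at \<tau>_def)
  qed
qed

text \<open>
  The values allowed for process \<open>h\<close> at the stopping time, if \<open>A\<close> are the late processes, \<open>J\<close> those attaining the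
  maximum, and \<open>k\<close> is the maximum.
\<close>

definition slot :: "nat \<Rightarrow> nat set \<Rightarrow> nat set \<Rightarrow> nat \<Rightarrow> nat \<Rightarrow> nat set" where
  "slot m A J k h = (if h \<in> A then {..m} else if h \<in> J then {k} else {m<..<k})"

text \<open>
  The properties of almost every outcome on which the stopped configuration can be read off.
\<close>

locale good_paths =
  fixes m n :: nat and x :: "nat \<Rightarrow> real \<Rightarrow> nat" and T :: "nat \<Rightarrow> real"
  defines "T \<equiv> \<lambda>i. hit m (x i)"
  assumes path: "\<And>i. i \<in> {1..n} \<Longrightarrow> counting_path (x i)"
    and exceeds: "\<And>i. i \<in> {1..n} \<Longrightarrow> \<exists>t\<ge>0. x i t > m"
    and unit_jump: "\<And>i. i \<in> {1..n} \<Longrightarrow> x i (T i) = Suc m"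
    and no_ties: "inj_on T {1..n}"
begin

definition later :: "real \<Rightarrow> nat set" where "later t = {h\<in>{1..n}. T h > t}"

lemma T_pos: "i \<in> {1..n} \<Longrightarrow> T i > 0"
  unfolding T_def by (rule hit_pos[OF path exceeds])

lemma le_iff_later: "t \<ge> 0 \<Longrightarrow> h \<in> {1..n} \<Longrightarrow> x h t \<le> m \<longleftrightarrow> h \<in> later t"
  using hit_le_iff[OF path exceeds, of h t] by (auto simp: later_def T_def not_le)

lemma below_eq_later: "t \<ge> 0 \<Longrightarrow> below m x n t = card (later t)"
proof -
  assume t: "t \<ge> 0"
  have "{i\<in>{1..n}. \<not> x i t > m} = later t"
    using le_iff_later[OF t] unfolding not_less by (auto simp only: later_def mem_Collect_eq)
  thus ?thesis by (simp only: below_def)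
qed

lemma card_later_less:
  assumes "h \<in> {1..n}" "t < T h"
  shows "card (later (T h)) < card (later t)"
  by (rule psubset_card_mono) (use assms in \<open>auto simp: later_def\<close>)

lemma rank_inj:
  assumes i: "i \<in> {1..n}" and h: "h \<in> {1..n}" and eq: "card (later (T i)) = card (later (T h))"
  shows "i = h"
proof (rule inj_onD[OF no_ties _ i h])
  have "\<not> T i < T h" using card_later_less[OF h, of "T i"] eq less_irrefl by metis
  moreover have "\<not> T h < T i" using card_later_less[OF i, of "T h"] eq less_irrefl by metis
  ultimately show "T i = T h" by (meson linorder_less_linear)
qed

text \<open>
  The ranks of the \<open>n\<close> hitting times are distinct numbers below \<open>n\<close>, so every such number occurs.
\<close>

lemma rank_exists:
  assumes "l < n"
  obtains i where "i \<in> {1..n}" "card (later (T i)) = l"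
proof -
  have "card (later (T i)) < n" if "i \<in> {1..n}" for i
  proof -
    have "card (later (T i)) \<le> card ({1..n} - {i})"
      by (rule card_mono) (auto simp: later_def)
    also have "\<dots> = n - 1" using that by simp
    finally show ?thesis using that by auto
  qed
  hence sub: "(\<lambda>i. card (later (T i))) ` {1..n} \<subseteq> {..<n}" by auto
  have "inj_on (\<lambda>i. card (later (T i))) {1..n}" using rank_inj by (auto simp: inj_on_def)
  hence "card ((\<lambda>i. card (later (T i))) ` {1..n}) = card {..<n}" by (simp add: card_image)
  hence "(\<lambda>i. card (later (T i))) ` {1..n} = {..<n}" using sub by (intro card_subset_eq) auto
  hence "l \<in> (\<lambda>i. card (later (T i))) ` {1..n}" using assms by simp
  thus ?thesis using that by blast
qed

lemma stop_time_eq: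
  assumes i: "i \<in> {1..n}" and l: "card (later (T i)) = l"
  shows "stop_time m l x n = T i" "all_but_exceed m l x n (T i)"
proof -
  have abe: "all_but_exceed m l x n t \<longleftrightarrow> card (later t) = l" if "t \<ge> 0" for t
    using below_eq_later[OF that] by (simp add: all_but_exceed_def below_def)
  show 1: "all_but_exceed m l x n (T i)" using abe[of "T i"] T_pos[OF i] l by simp
  show "stop_time m l x n = T i"
    unfolding stop_time_def
  proof (rule Least_equality)
    show "0 \<le> T i \<and> all_but_exceed m l x n (T i)" using 1 T_pos[OF i] by simp
    show "T i \<le> t" if "0 \<le> t \<and> all_but_exceed m l x n t" for t
      using card_later_less[OF i, of t] abe[of t] that l by (cases "t < T i") auto
  qed
qed

lemma max_mult_at_T:
  assumes i: "i \<in> {1..n}" and l: "card (later (T i)) = l"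
  shows "max_mult m l x n = card {h\<in>{1..n}. x h (T i) = Max ((\<lambda>h. x h (T i)) ` {1..n})}"
proof -
  have "\<exists>t\<ge>0. all_but_exceed m l x n t"
    using stop_time_eq(2)[OF assms] T_pos[OF i] by (intro exI[of _ "T i"]) simp
  thus ?thesis by (simp add: max_mult_def stop_time_eq(1)[OF assms])
qed

text \<open>
  The bound on \<open>n\<close> leaves at least one process for the open interval between \<open>m\<close> and \<open>k\<close>. Hence \<open>k > m + 1\<close>, and
  process \<open>i\<close>, which is at \<open>m + 1\<close>, does not attain the maximum.
\<close>

lemma configuration_imp:
  assumes n: "l + j + 2 \<le> n" and j: "1 \<le> j" and i: "i \<in> {1..n}"
    and A: "A \<subseteq> {1..n} - {i}" "card A = l" and J: "J \<subseteq> {1..n} - {i} - A" "card J = j"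
    and conf: "\<forall>h\<in>{1..n} - {i}. x h (T i) \<in> slot m A J k h"
  shows "max_mult m l x n = j" "A = later (T i)" "k = Max ((\<lambda>h. x h (T i)) ` {1..n})" "J = {h\<in>{1..n}. x h (T i) = k}"
proof -
  have fin: "finite A" "finite J" using A J by (auto intro: finite_subset)
  have "{1..n} - {i} - A - J \<noteq> {}"
  proof
    assume "{1..n} - {i} - A - J = {}"
    hence "{1..n} \<subseteq> insert i (A \<union> J)" by auto
    hence "card {1..n} \<le> card (insert i (A \<union> J))" using fin by (intro card_mono) auto
    also have "\<dots> \<le> Suc (card (A \<union> J))" by (rule card_insert_le_m1) auto
    also have "\<dots> \<le> Suc (l + j)" using card_Un_le[of A J] A J by simp
    finally show False using n by simp
  qed
  then obtain h0 where h0: "h0 \<in> {1..n} - {i}" "h0 \<notin> A" "h0 \<notin> J" by blast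
  hence "x h0 (T i) \<in> {m<..<k}" using bspec[OF conf h0(1)] by (simp only: slot_def if_False)
  hence k: "k > Suc m" by auto
  have in_A: "x h (T i) \<le> m" if "h \<in> A" for h using conf A that by (force simp: slot_def)
  have in_J: "x h (T i) = k" if "h \<in> J" for h using conf J that by (force simp: slot_def)
  have in_rest: "m < x h (T i) \<and> x h (T i) < k" if "h \<in> {1..n} - {i}" "h \<notin> A" "h \<notin> J" for h
    using conf that by (force simp: slot_def)
  have at_i: "x i (T i) = Suc m" using unit_jump[OF i] .
  show "A = later (T i)"
  proof (intro equalityI subsetI)
    fix h assume "h \<in> A"
    thus "h \<in> later (T i)" using in_A[of h] le_iff_later[of "T i" h] A T_pos[OF i] by auto
  next
    fix h assume h: "h \<in> later (T i)"
    hence "x h (T i) \<le> m" "h \<in> {1..n}" "h \<noteq> i" using le_iff_later[of "T i" h] T_pos[OF i] by (auto simp: later_def)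
    thus "h \<in> A" using in_J[of h] in_rest[of h] k by (cases "h \<in> A"; cases "h \<in> J") auto
  qed
  hence card_l: "card (later (T i)) = l" using A by simp
  have J_eq: "J = {h\<in>{1..n}. x h (T i) = k}"
  proof (intro equalityI subsetI)
    fix h assume "h \<in> {h\<in>{1..n}. x h (T i) = k}"
    hence h: "h \<in> {1..n}" "x h (T i) = k" by auto
    show "h \<in> J"
      using in_A[of h] in_rest[of h] at_i k h by (cases "h = i"; cases "h \<in> A"; cases "h \<in> J") auto
  qed (use J in_J in auto)
  show "J = {h\<in>{1..n}. x h (T i) = k}" by (rule J_eq)
  have "J \<noteq> {}" using J j by auto
  then obtain h1 where h1: "h1 \<in> J" by auto
  show k_Max: "k = Max ((\<lambda>h. x h (T i)) ` {1..n})"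
  proof (rule Max_eqI [symmetric])
    show "k \<in> (\<lambda>h. x h (T i)) ` {1..n}" using h1 in_J[OF h1] J by (auto intro!: image_eqI[of _ _ h1])
    fix y assume "y \<in> (\<lambda>h. x h (T i)) ` {1..n}"
    then obtain h where h: "h \<in> {1..n}" "y = x h (T i)" by auto
    thus "y \<le> k" using in_A[of h] in_J[of h] in_rest[of h] at_i k
      by (cases "h = i"; cases "h \<in> A"; cases "h \<in> J") auto
  qed auto
  show "max_mult m l x n = j"
    unfolding max_mult_at_T[OF i card_l] using J_eq J(2) k_Max by simp
qed

text \<open>
  The maximum exceeds \<open>m + 1\<close>, for otherwise all \<open>n - l > j\<close> processes that are not late would attain it.
\<close>

lemma configuration_exists:
  assumes n: "l + j + 2 \<le> n" and j: "1 \<le> j" and mult: "max_mult m l x n = j"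
    and i: "i \<in> {1..n}" "card (later (T i)) = l"
  defines "k \<equiv> Max ((\<lambda>h. x h (T i)) ` {1..n})"
  defines "J \<equiv> {h\<in>{1..n}. x h (T i) = k}"
  shows "later (T i) \<subseteq> {1..n} - {i}" "J \<subseteq> {1..n} - {i} - later (T i)" "card J = j"
    "\<forall>h\<in>{1..n} - {i}. x h (T i) \<in> slot m (later (T i)) J k h"
proof -
  show sub: "later (T i) \<subseteq> {1..n} - {i}" by (auto simp: later_def)
  show cJ: "card J = j" using max_mult_at_T[OF i] mult by (simp add: J_def k_def)
  have le_k: "x h (T i) \<le> k" if "h \<in> {1..n}" for h unfolding k_def using that by (intro Max_ge) auto
  have at_i: "x i (T i) = Suc m" using unit_jump[OF i(1)] .
  have T0: "T i \<ge> 0" using T_pos[OF i(1)] by simp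
  have k: "k > Suc m"
  proof (rule ccontr)
    assume "\<not> k > Suc m"
    hence "k = Suc m" using le_k[OF i(1)] at_i by simp
    hence "x h (T i) = k" if "h \<in> {1..n} - later (T i)" for h
      using that le_k[of h] le_iff_later[OF T0, of h] by auto
    hence "{1..n} - later (T i) \<subseteq> J" by (auto simp: J_def)
    hence "card ({1..n} - later (T i)) \<le> card J" by (intro card_mono) (auto simp: J_def)
    moreover have "card ({1..n} - later (T i)) = n - l"
      using sub i(2) by (subst card_Diff_subset) (auto simp: later_def)
    ultimately show False using cJ n by simp
  qed
  show "J \<subseteq> {1..n} - {i} - later (T i)"
  proof
    fix h assume h: "h \<in> J"
    hence "h \<in> {1..n}" "x h (T i) = k" by (auto simp: J_def)
    thus "h \<in> {1..n} - {i} - later (T i)" using k at_i le_iff_later[OF T0, of h] by auto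
  qed
  show "\<forall>h\<in>{1..n} - {i}. x h (T i) \<in> slot m (later (T i)) J k h"
  proof
    fix h assume h: "h \<in> {1..n} - {i}"
    thus "x h (T i) \<in> slot m (later (T i)) J k h"
      using le_iff_later[OF T0, of h] le_k[of h] by (auto simp: slot_def J_def not_le)
  qed
qed

lemma rank_configuration:
  assumes i: "i \<in> {1..n}" and A: "A \<subseteq> {1..n} - {i}"
  shows "(\<forall>h\<in>{1..n} - {i}. x h (T i) \<in> (if h \<in> A then {..m} else {m<..})) \<longleftrightarrow> A = later (T i)"
proof
  have T0: "T i \<ge> 0" using T_pos[OF i] by simp
  {
    assume *: "\<forall>h\<in>{1..n} - {i}. x h (T i) \<in> (if h \<in> A then {..m} else {m<..})"
    show "A = later (T i)"
    proof (intro equalityI subsetI)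
      fix h assume "h \<in> A"
      thus "h \<in> later (T i)" using * A le_iff_later[OF T0, of h] by force
    next
      fix h assume h: "h \<in> later (T i)"
      hence "x h (T i) \<le> m" "h \<in> {1..n}" "h \<noteq> i" using le_iff_later[OF T0, of h] by (auto simp: later_def)
      thus "h \<in> A" using * by (force split: if_splits)
    qed
  next
    assume "A = later (T i)"
    thus "\<forall>h\<in>{1..n} - {i}. x h (T i) \<in> (if h \<in> A then {..m} else {m<..})"
      using le_iff_later[OF T0] by (auto simp: not_le simp flip: not_le)
  }
qed

end

section \<open>The exact law of the multiplicity\<close>

definition configs :: "nat \<Rightarrow> nat \<Rightarrow> nat \<Rightarrow> (nat \<times> nat set \<times> nat set) set" where
  "configs n l j = (SIGMA i:{1..n}. SIGMA A:{A. A \<subseteq> {1..n} - {i} \<and> card A = l}.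
      {J. J \<subseteq> {1..n} - {i} - A \<and> card J = j})"

definition rank_configs :: "nat \<Rightarrow> nat \<Rightarrow> (nat \<times> nat set) set" where
  "rank_configs n l = (SIGMA i:{1..n}. {A. A \<subseteq> {1..n} - {i} \<and> card A = l})"

lemma finite_rank_configs: "finite (rank_configs n l)"
  unfolding rank_configs_def by (rule finite_SigmaI) auto

lemma card_rank_configs: "card (rank_configs n l) = n * ((n - 1) choose l)"
  unfolding rank_configs_def by (subst card_SigmaI) (auto simp: n_subsets)

lemma finite_configs: "finite (configs n l j)"
  unfolding configs_def by (intro finite_SigmaI) (auto intro: finite_subset[of _ "Pow {1..n}"])

lemma card_configs: "card (configs n l j) = n * ((n - 1) choose l) * ((n - 1 - l) choose j)"
proof -
  have "card (SIGMA A:{A. A \<subseteq> {1..n} - {i} \<and> card A = l}. {J. J \<subseteq> {1..n} - {i} - A \<and> card J = j})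
      = ((n - 1) choose l) * ((n - 1 - l) choose j)" if i: "i \<in> {1..n}" for i
  proof -
    have "card {J. J \<subseteq> {1..n} - {i} - A \<and> card J = j} = (n - 1 - l) choose j" if "A \<subseteq> {1..n} - {i}" "card A = l" for A
    proof -
      have "card ({1..n} - {i} - A) = n - 1 - l"
        using that i by (subst card_Diff_subset) (auto intro: finite_subset)
      thus ?thesis by (subst n_subsets) auto
    qed
    thus ?thesis using i by (subst card_SigmaI) (auto simp: n_subsets)
  qed
  thus ?thesis unfolding configs_def by (subst card_SigmaI) (auto intro!: finite_SigmaI)
qed

lemma prod_pois_slot:
  assumes i: "i \<in> {1..n}" and A: "A \<subseteq> {1..n} - {i}" "card A = l" and J: "J \<subseteq> {1..n} - {i} - A" "card J = j" and t: "t \<ge> 0"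
  shows "(\<Prod>h\<in>{1..n} - {i}. pois t (slot m A J k h)) = poi_low t m ^ l * poi t k ^ j * poi_mid m t k ^ (n - 1 - l - j)"
proof -
  define R where "R = {1..n} - {i} - A - J"
  have fin: "finite A" "finite J" using A J by (auto intro: finite_subset)
  have split: "{1..n} - {i} = A \<union> (J \<union> R)" using A J by (auto simp: R_def)
  have "card ({1..n} - {i} - A - J) = n - 1 - l - j"
    using A J i fin by (subst card_Diff_subset; (subst card_Diff_subset)?) auto
  hence cR: "card R = n - 1 - l - j" by (simp add: R_def)
  have "(\<Prod>h\<in>{1..n} - {i}. pois t (slot m A J k h)) =
     (\<Prod>h\<in>A. pois t (slot m A J k h)) * ((\<Prod>h\<in>J. pois t (slot m A J k h)) * (\<Prod>h\<in>R. pois t (slot m A J k h)))"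
    unfolding split using J fin by (subst prod.union_disjoint; (subst prod.union_disjoint)?) (auto simp: R_def)
  also have "(\<Prod>h\<in>A. pois t (slot m A J k h)) = poi_low t m ^ l"
    using A t by (simp add: slot_def pois_atMost)
  also have "(\<Prod>h\<in>J. pois t (slot m A J k h)) = (\<Prod>h\<in>J. poi t k)"
    using J t by (intro prod.cong refl) (auto simp: slot_def pois_finite)
  also have "(\<Prod>h\<in>R. pois t (slot m A J k h)) = (\<Prod>h\<in>R. poi_mid m t k)"
    using t by (intro prod.cong refl) (auto simp: R_def slot_def pois_finite poi_mid_def)
  finally show ?thesis using J cR by (simp add: mult.assoc)
qed

lemma prod_pois_rank:
  assumes i: "i \<in> {1..n}" and A: "A \<subseteq> {1..n} - {i}" "card A = l" and t: "t \<ge> 0"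
  shows "(\<Prod>h\<in>{1..n} - {i}. pois t (if h \<in> A then {..m} else {m<..})) = poi_low t m ^ l * (1 - poi_low t m) ^ (n - 1 - l)"
proof -
  define R where "R = {1..n} - {i} - A"
  have fin: "finite A" using A by (auto intro: finite_subset)
  have split: "{1..n} - {i} = A \<union> R" using A by (auto simp: R_def)
  have "card ({1..n} - {i} - A) = n - 1 - l"
    using A i fin by (subst card_Diff_subset) auto
  hence cR: "card R = n - 1 - l" by (simp add: R_def)
  have "(\<Prod>h\<in>{1..n} - {i}. pois t (if h \<in> A then {..m} else {m<..})) =
     (\<Prod>h\<in>A. pois t (if h \<in> A then {..m} else {m<..})) * (\<Prod>h\<in>R. pois t (if h \<in> A then {..m} else {m<..}))"
    unfolding split using fin by (subst prod.union_disjoint) (auto simp: R_def)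
  also have "(\<Prod>h\<in>A. pois t (if h \<in> A then {..m} else {m<..})) = poi_low t m ^ l"
    using A t by (simp add: pois_atMost)
  also have "(\<Prod>h\<in>R. pois t (if h \<in> A then {..m} else {m<..})) = (\<Prod>h\<in>R. 1 - poi_low t m)"
    using t by (intro prod.cong refl) (auto simp: R_def pois_greaterThan)
  finally show ?thesis using cR by simp
qed

lemma continuous_on_pois_greaterThan: "continuous_on {0..} (\<lambda>t. pois t {m<..})"
  by (subst continuous_on_cong[OF refl pois_greaterThan])
     (auto intro!: continuous_intros continuous_on_poi simp: poi_low_def)

context iid_paths
begin

lemma AE_hits:
  assumes i: "i \<ge> 1"
  shows "AE \<omega> in M. hits m i \<omega>"
proof -
  have "emeasure M (hit_event m i {} (\<lambda>_. {})) = 1"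
    using hit_event_integral(2)[OF i, of "{}"] nn_integral_poi[of m] by simp
  hence "prob (hit_event m i {} (\<lambda>_. {})) = 1" by (simp add: emeasure_eq_measure ennreal_eq_1)
  hence "AE \<omega> in M. \<omega> \<in> hit_event m i {} (\<lambda>_. {})" by (rule AE_prob_1)
  thus ?thesis by eventually_elim (auto simp: hit_event_def)
qed

text \<open>
  The probability that process \<open>i\<close> is strictly first is the integral of \<open>- q' q\<close> with \<open>q = poi_low\<close>, that is \<open>1/2\<close>. By
  symmetry the two strict orders have total probability one.
\<close>

lemma AE_hit_distinct:
  assumes i: "i \<ge> 1" and h: "h \<ge> 1" and ne: "i \<noteq> h"
  shows "AE \<omega> in M. hit m (path i \<omega>) \<noteq> hit m (path h \<omega>)"
proof -
  define A where "A i h = hit_event m i {h} (\<lambda>_. {..m})" for i h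
  have A: "A i h \<in> events" "prob (A i h) = 1 / 2" if "i \<ge> 1" "h \<ge> 1" "i \<noteq> h" for i h
  proof -
    note H = hit_event_integral[OF that(1), of "{h}" "\<lambda>_. {..m}" m]
    show "A i h \<in> events" unfolding A_def by (rule H(1)) (use that in \<open>auto intro: continuous_on_pois_finite\<close>)
    have "emeasure M (A i h) = (\<integral>\<^sup>+t. ennreal (poi t m * (\<Prod>h\<in>{h}. pois t {..m})) * indicator {0..} t \<partial>lborel)"
      unfolding A_def by (rule H(2)) (use that in \<open>auto intro: continuous_on_pois_finite\<close>)
    also have "\<dots> = (\<integral>\<^sup>+t. ennreal (poi t m * poi_low t m) * indicator {0..} t \<partial>lborel)"
      by (rule nn_integral_cong) (auto simp: indicator_def pois_atMost)
    also have "\<dots> = ennreal (1/2)" by (rule nn_integral_poi_low)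
    finally show "prob (A i h) = 1/2" by (intro measure_eq_emeasure_eq_ennreal) simp_all
  qed
  have A_iff: "\<omega> \<in> A i h \<Longrightarrow> hits m h \<omega> \<Longrightarrow> hit m (path i \<omega>) < hit m (path h \<omega>)"
    if "i \<ge> 1" "h \<ge> 1" for i h \<omega>
  proof -
    assume w: "\<omega> \<in> A i h" "hits m h \<omega>"
    hence sp: "\<omega> \<in> space M" "hits m i \<omega>" by (auto simp: A_def hit_event_def)
    have "0 < hit m (path i \<omega>)" using sp hit_pos[OF counting_path[OF that(1)]] by (auto simp: hits_def)
    thus ?thesis using hit_le_iff[OF counting_path[OF that(2) sp(1)], of m "hit m (path i \<omega>)"] w
      by (auto simp: A_def hit_event_def hits_def not_less not_le)
  qed
  have disj: "A i h \<inter> A h i = {}"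
  proof (rule ccontr)
    assume "A i h \<inter> A h i \<noteq> {}"
    then obtain \<omega> where w: "\<omega> \<in> A i h" "\<omega> \<in> A h i" by auto
    hence "hits m i \<omega>" "hits m h \<omega>" by (auto simp: A_def hit_event_def)
    thus False using A_iff[OF i h w(1)] A_iff[OF h i w(2)] by simp
  qed
  have "prob (A i h \<union> A h i) = 1"
    using A[OF i h ne] A[OF h i] ne disj by (subst finite_measure_Union) auto
  hence "AE \<omega> in M. \<omega> \<in> A i h \<union> A h i" by (rule AE_prob_1)
  thus ?thesis using AE_hits[OF i, of m] AE_hits[OF h, of m]
  proof eventually_elim
    case (elim \<omega>)
    thus ?case using A_iff[OF i h, of \<omega>] A_iff[OF h i, of \<omega>] by force
  qed
qed

lemma pois_ge_2:
  assumes "t \<ge> 0"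
  shows "pois t {2..} \<le> t\<^sup>2"
proof -
  have "{2::nat..} = - {0, 1}" by auto
  hence "pois t {2..} = 1 - (poi t 0 + poi t 1)" using assms by (simp add: pois_Compl pois_finite)
  also have "\<dots> = 1 - exp (- t) * (1 + t)" by (simp add: poi_def algebra_simps)
  also have "\<dots> \<le> 1 - (1 - t) * (1 + t)"
    using exp_ge_add_one_self[of "- t"] assms by (intro diff_mono mult_right_mono) auto
  also have "\<dots> = t\<^sup>2" by (simp add: algebra_simps power2_eq_square)
  finally show ?thesis .
qed

text \<open>
  A jump over \<open>m + 1\<close> before time \<open>K\<close> forces an increment of at least two in one of \<open>K (r + 1)\<close> grid cells, and each has
  probability at most \<open>1 / (r + 1)\<^sup>2\<close>. Let \<open>r\<close> tend to infinity.
\<close>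

lemma AE_unit_jump:
  assumes i: "i \<ge> 1"
  shows "AE \<omega> in M. hits m i \<omega> \<longrightarrow> X i (hit m (path i \<omega>)) \<omega> = Suc m"
proof -
  have AE_K: "AE \<omega> in M. hits m i \<omega> \<longrightarrow> hit m (path i \<omega>) \<le> real K \<longrightarrow> X i (hit m (path i \<omega>)) \<omega> = Suc m" for K :: nat
  proof -
    define a where "a r c = real c / real (Suc r)" for r c :: nat
    have a: "0 \<le> a r c" "a r c \<le> a r (Suc c)" "a r (Suc c) - a r c = 1 / real (Suc r)" for r c
      by (auto simp: a_def divide_right_mono simp flip: diff_divide_distrib)
    define D where "D r c = {\<omega>\<in>space M. X i (a r (Suc c)) \<omega> - X i (a r c) \<omega> \<in> {2..}}" for r c
    define C where "C r = (\<Union>c<K * Suc r. D r c)" for r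
    have D_events: "D r c \<in> events" for r c
    proof -
      have [measurable]: "X i (a r c) \<in> measurable M (count_space UNIV)" for c using a i by auto
      have "(\<lambda>\<omega>. X i (a r (Suc c)) \<omega> - X i (a r c) \<omega>) \<in> measurable M (count_space UNIV)" by measurable
      from measurable_sets[OF this, of "{2..}"] show ?thesis by (simp add: D_def vimage_def Int_def conj_commute)
    qed
    hence C_events: "C r \<in> events" for r unfolding C_def by auto
    have "prob (C r) \<le> real K / real (Suc r)" for r
    proof -
      have "prob (C r) \<le> (\<Sum>c<K * Suc r. prob (D r c))"
        unfolding C_def by (rule finite_measure_subadditive_finite) (use D_events in auto)
      also have "\<dots> \<le> (\<Sum>c<K * Suc r. (1 / real (Suc r))\<^sup>2)"
        unfolding D_def prob_increment[OF i a(1) a(2)] a(3) by (intro sum_mono pois_ge_2) auto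
      also have "\<dots> = real K / real (Suc r)" by (simp add: power2_eq_square del: of_nat_Suc mult_Suc_right)
      finally show ?thesis .
    qed
    moreover have "(\<lambda>r. real K / real (Suc r)) \<longlonglongrightarrow> 0" by real_asymp
    moreover have "prob (\<Inter>r. C r) \<le> prob (C r)" for r
      by (intro finite_measure_mono) (use C_events in auto)
    ultimately have "prob (\<Inter>r. C r) \<le> 0"
      by (intro LIMSEQ_le_const[where X = "\<lambda>r. real K / real (Suc r)"]) (auto intro: order_trans)
    hence "prob (\<Inter>r. C r) = 0" using measure_nonneg[of M "\<Inter>r. C r"] by linarith
    hence null: "(\<Inter>r. C r) \<in> null_sets M"
      using C_events by (intro null_setsI) (auto simp: emeasure_eq_measure intro!: sets.countable_INT)
    show ?thesis
    proof (rule AE_I'[OF null], intro subsetI INT_I)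
      fix \<omega> r
      assume "\<omega> \<in> {\<omega> \<in> space M. \<not> (hits m i \<omega> \<longrightarrow> hit m (path i \<omega>) \<le> real K \<longrightarrow> X i (hit m (path i \<omega>)) \<omega> = Suc m)}"
      hence w: "\<omega> \<in> space M" "hits m i \<omega>" "hit m (path i \<omega>) \<le> real K" "X i (hit m (path i \<omega>)) \<omega> \<noteq> Suc m"
        by auto
      define T where "T = hit m (path i \<omega>)"
      note cp = counting_path[OF i w(1)]
      have ex: "\<exists>t\<ge>0. X i t \<omega> > m" using w by (simp add: hits_def)
      have T0: "T > 0" unfolding T_def by (rule hit_pos[OF cp ex])
      have "m < X i T \<omega>" using hit_le_iff[OF cp ex, of T] T0 by (simp add: T_def)
      hence XT: "m + 2 \<le> X i T \<omega>" using w(4) by (simp add: T_def)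
      obtain c where c: "a r c < T" "T \<le> a r (Suc c)" using grid_cell[OF T0, of r] unfolding a_def by blast
      have "X i (a r c) \<omega> \<le> m" using hit_le_iff[OF cp ex a(1)[of r c]] c by (simp add: T_def not_less not_le)
      moreover have "X i T \<omega> \<le> X i (a r (Suc c)) \<omega>" using counting_path_mono[OF cp, of T "a r (Suc c)"] T0 c by simp
      ultimately have "\<omega> \<in> D r c" using XT w(1) by (simp add: D_def)
      moreover have "c < K * Suc r"
      proof -
        have "a r c < real K" using c w(3) by (simp add: T_def)
        hence "real c < real (K * Suc r)" by (simp add: a_def field_simps del: of_nat_Suc mult_Suc_right)
        thus ?thesis by (simp only: of_nat_less_iff)
      qed
      ultimately show "\<omega> \<in> C r" unfolding C_def by blast
    qed
  qed
  hence "AE \<omega> in M. \<forall>K::nat. hits m i \<omega> \<longrightarrow> hit m (path i \<omega>) \<le> real K \<longrightarrow> X i (hit m (path i \<omega>)) \<omega> = Suc m"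
    unfolding AE_all_countable by blast
  thus ?thesis by eventually_elim (use real_arch_simple in blast)
qed

lemma AE_good_paths: "AE \<omega> in M. good_paths m n (\<lambda>i t. X i t \<omega>)"
proof -
  have "AE \<omega> in M. \<forall>i\<in>{1..n}. hits m i \<omega> \<and> X i (hit m (path i \<omega>)) \<omega> = Suc m \<and>
      (\<forall>h\<in>{1..n}. h \<noteq> i \<longrightarrow> hit m (path i \<omega>) \<noteq> hit m (path h \<omega>))"
  proof (intro AE_finite_allI)
    fix i assume "i \<in> {1..n}"
    hence i: "i \<ge> 1" by simp
    have "AE \<omega> in M. \<forall>h\<in>{1..n}. h \<noteq> i \<longrightarrow> hit m (path i \<omega>) \<noteq> hit m (path h \<omega>)"
    proof (intro AE_finite_allI)
      fix h assume "h \<in> {1..n}"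
      thus "AE \<omega> in M. h \<noteq> i \<longrightarrow> hit m (path i \<omega>) \<noteq> hit m (path h \<omega>)"
        using AE_hit_distinct[OF i, of h m] by (cases "h = i") auto
    qed simp
    thus "AE \<omega> in M. hits m i \<omega> \<and> X i (hit m (path i \<omega>)) \<omega> = Suc m \<and>
      (\<forall>h\<in>{1..n}. h \<noteq> i \<longrightarrow> hit m (path i \<omega>) \<noteq> hit m (path h \<omega>))"
      using AE_hits[OF i, of m] AE_unit_jump[OF i, of m] by eventually_elim auto
  qed simp
  thus ?thesis using AE_space
  proof eventually_elim
    case (elim \<omega>)
    thus ?case using counting_path by unfold_locales (auto simp: hits_def inj_on_def)
  qed
qed

lemma finite_dim_event:
  assumes t: "t \<ge> 0" and dep: "\<And>x y. (\<And>i. i \<in> {1..n} \<Longrightarrow> x i = y i) \<Longrightarrow> P x = P y"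
  shows "{\<omega>\<in>space M. P (\<lambda>i. X i t \<omega>)} \<in> events"
proof -
  have "{\<omega>\<in>space M. P (\<lambda>i. X i t \<omega>)} =
    (\<Union>v\<in>{v\<in>PiE {1..n} (\<lambda>_. UNIV). P v}. {\<omega>\<in>space M. \<forall>i\<in>{1..n}. X i t \<omega> \<in> {v i}})" (is "?L = ?R")
  proof (intro equalityI subsetI)
    fix \<omega> assume w: "\<omega> \<in> ?L"
    define v where "v = restrict (\<lambda>i. X i t \<omega>) {1..n}"
    have "P v" using w dep[of v "\<lambda>i. X i t \<omega>"] by (simp add: v_def)
    thus "\<omega> \<in> ?R" using w by (intro UN_I[of v]) (auto simp: v_def)
  next
    fix \<omega> assume "\<omega> \<in> ?R"
    then obtain v where "P v" "\<omega> \<in> space M" "\<forall>i\<in>{1..n}. X i t \<omega> = v i" by auto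
    thus "\<omega> \<in> ?L" using dep[of v "\<lambda>i. X i t \<omega>"] by auto
  qed
  also have "\<dots> \<in> events"
  proof (rule sets.countable_UN'')
    show "countable {v\<in>PiE {1..n} (\<lambda>_. UNIV :: nat set). P v}"
      by (rule countable_subset[of _ "PiE {1..n} (\<lambda>_. UNIV)"]) (auto intro: countable_PiE)
    show "{\<omega>\<in>space M. \<forall>i\<in>{1..n}. X i t \<omega> \<in> {v i}} \<in> events" for v
      by (intro sets.sets_Collect_finite_All events_X t) auto
  qed
  finally show ?thesis .
qed

lemma max_mult_event:
  assumes j: "j \<ge> 1"
  shows "{\<omega>\<in>space M. max_mult m l (\<lambda>i t. X i t \<omega>) n = j} \<in> events"
proof -
  have below: "{\<omega>\<in>space M. Q (below m (\<lambda>i t. X i t \<omega>) n t)} \<in> events" if "t \<ge> 0" for t and Q :: "nat \<Rightarrow> bool"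
    unfolding below_def
  proof (rule finite_dim_event[OF that, of n "\<lambda>x. Q (card {i \<in> {1..n}. \<not> m < x i})"])
    fix x y :: "nat \<Rightarrow> nat" assume "\<And>i. i \<in> {1..n} \<Longrightarrow> x i = y i"
    hence "{i \<in> {1..n}. \<not> m < x i} = {i \<in> {1..n}. \<not> m < y i}" by auto
    thus "Q (card {i \<in> {1..n}. \<not> m < x i}) = Q (card {i \<in> {1..n}. \<not> m < y i})" by simp
  qed
  have mult: "{\<omega>\<in>space M. mult_at (\<lambda>i t. X i t \<omega>) n t = j} \<in> events" if "t \<ge> 0" for t
    unfolding mult_at_def
  proof (rule finite_dim_event[OF that, of n "\<lambda>x. card {i \<in> {1..n}. x i = Max (x ` {1..n})} = j"])
    fix x y :: "nat \<Rightarrow> nat" assume eq: "\<And>i. i \<in> {1..n} \<Longrightarrow> x i = y i"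
    hence "x ` {1..n} = y ` {1..n}" by (intro image_cong) auto
    hence "{i \<in> {1..n}. x i = Max (x ` {1..n})} = {i \<in> {1..n}. y i = Max (y ` {1..n})}" using eq by auto
    thus "(card {i \<in> {1..n}. x i = Max (x ` {1..n})} = j) = (card {i \<in> {1..n}. y i = Max (y ` {1..n})} = j)" by simp
  qed
  have "{\<omega>\<in>space M. max_mult m l (\<lambda>i t. X i t \<omega>) n = j} = {\<omega>\<in>space M.
    (\<exists>p::rat. p \<ge> 0 \<and> below m (\<lambda>i t. X i t \<omega>) n (of_rat p) = l) \<and>
    (\<exists>q::rat. (\<exists>p::rat. (0 \<le> p \<and> p < q) \<and> below m (\<lambda>i t. X i t \<omega>) n (of_rat p) \<le> l) \<and>
        (\<forall>p::rat. 0 \<le> p \<and> p < q \<longrightarrow> below m (\<lambda>i t. X i t \<omega>) n (of_rat p) \<le> l \<longrightarrow> mult_at (\<lambda>i t. X i t \<omega>) n (of_rat p) = j))}"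
    using max_mult_rational[OF counting_path j] by (intro Collect_cong conj_cong refl) (auto simp: conj_assoc)
  also have "\<dots> \<in> events"
  proof -
    have 1: "{\<omega>\<in>space M. p \<ge> 0 \<and> below m (\<lambda>i t. X i t \<omega>) n (of_rat p) = l} \<in> events" for p :: rat
      using below[of "of_rat p" "\<lambda>b. b = l"] by (cases "p \<ge> 0") simp_all
    have 2: "{\<omega>\<in>space M. (0 \<le> p \<and> p < q) \<and> below m (\<lambda>i t. X i t \<omega>) n (of_rat p) \<le> l} \<in> events" for p q :: rat
      using below[of "of_rat p" "\<lambda>b. b \<le> l"] by (cases "0 \<le> p \<and> p < q") simp_all
    have 3: "{\<omega>\<in>space M. 0 \<le> p \<and> p < q \<longrightarrow> below m (\<lambda>i t. X i t \<omega>) n (of_rat p) \<le> l \<longrightarrow> mult_at (\<lambda>i t. X i t \<omega>) n (of_rat p) = j} \<in> events" for p q :: rat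
      using sets.sets_Collect_imp[OF mult[of "of_rat p"] below[of "of_rat p" "\<lambda>b. b \<le> l"]] by (cases "0 \<le> p \<and> p < q") auto
    show ?thesis
      by (rule sets.sets_Collect_conj[OF
            sets.sets_Collect_countable_Ex[OF sets.sets_Collect_conj[OF sets.sets_Collect_countable_All[OF 3] sets.sets_Collect_countable_Ex[OF 2]]]
            sets.sets_Collect_countable_Ex[OF 1]])
  qed
  finally show ?thesis .
qed

lemma emeasure_configuration:
  assumes q: "(i, A, J) \<in> configs n l j"
  shows "hit_event m i ({1..n} - {i}) (slot m A J k) \<in> events"
    "emeasure M (hit_event m i ({1..n} - {i}) (slot m A J k)) =
      (\<integral>\<^sup>+t. ennreal (poi t m * poi_low t m ^ l * (poi t k ^ j * poi_mid m t k ^ (n - 1 - l - j))) * indicator {0..} t \<partial>lborel)"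
proof -
  have i: "i \<in> {1..n}" and A: "A \<subseteq> {1..n} - {i}" "card A = l" and J: "J \<subseteq> {1..n} - {i} - A" "card J = j"
    using q by (auto simp: configs_def)
  have cont: "continuous_on {0..} (\<lambda>t. pois t (slot m A J k h))" for h
    by (rule continuous_on_pois_finite) (auto simp: slot_def)
  note H = hit_event_integral[of i "{1..n} - {i}" "slot m A J k" m]
  show "hit_event m i ({1..n} - {i}) (slot m A J k) \<in> events"
    by (rule H(1)) (use i cont in auto)
  have "emeasure M (hit_event m i ({1..n} - {i}) (slot m A J k)) =
     (\<integral>\<^sup>+t. ennreal (poi t m * (\<Prod>h\<in>{1..n} - {i}. pois t (slot m A J k h))) * indicator {0..} t \<partial>lborel)"
    by (rule H(2)) (use i cont in auto)
  also have "\<dots> = (\<integral>\<^sup>+t. ennreal (poi t m * poi_low t m ^ l * (poi t k ^ j * poi_mid m t k ^ (n - 1 - l - j))) * indicator {0..} t \<partial>lborel)"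
  proof (rule nn_integral_cong)
    fix t :: real
    show "ennreal (poi t m * (\<Prod>h\<in>{1..n} - {i}. pois t (slot m A J k h))) * indicator {0..} t =
          ennreal (poi t m * poi_low t m ^ l * (poi t k ^ j * poi_mid m t k ^ (n - 1 - l - j))) * indicator {0..} t"
      using prod_pois_slot[OF i A J, of t m k] by (cases "t \<ge> 0") (simp_all add: mult.assoc)
  qed
  finally show "emeasure M (hit_event m i ({1..n} - {i}) (slot m A J k)) =
      (\<integral>\<^sup>+t. ennreal (poi t m * poi_low t m ^ l * (poi t k ^ j * poi_mid m t k ^ (n - 1 - l - j))) * indicator {0..} t \<partial>lborel)" .
qed

lemma emeasure_rank_configuration:
  assumes q: "(i, A) \<in> rank_configs n l"
  shows "hit_event m i ({1..n} - {i}) (\<lambda>h. if h \<in> A then {..m} else {m<..}) \<in> events"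
    "emeasure M (hit_event m i ({1..n} - {i}) (\<lambda>h. if h \<in> A then {..m} else {m<..})) =
      (\<integral>\<^sup>+t. ennreal (poi t m * poi_low t m ^ l * (1 - poi_low t m) ^ (n - 1 - l)) * indicator {0..} t \<partial>lborel)"
proof -
  have i: "i \<in> {1..n}" and A: "A \<subseteq> {1..n} - {i}" "card A = l"
    using q by (auto simp: rank_configs_def)
  have cont: "continuous_on {0..} (\<lambda>t. pois t (if h \<in> A then {..m} else {m<..}))" for h
    by (auto intro: continuous_on_pois_finite continuous_on_pois_greaterThan)
  note H = hit_event_integral[of i "{1..n} - {i}" "\<lambda>h. if h \<in> A then {..m} else {m<..}" m]
  show "hit_event m i ({1..n} - {i}) (\<lambda>h. if h \<in> A then {..m} else {m<..}) \<in> events"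
    by (rule H(1)) (use i cont in auto)
  have "emeasure M (hit_event m i ({1..n} - {i}) (\<lambda>h. if h \<in> A then {..m} else {m<..})) =
     (\<integral>\<^sup>+t. ennreal (poi t m * (\<Prod>h\<in>{1..n} - {i}. pois t (if h \<in> A then {..m} else {m<..}))) * indicator {0..} t \<partial>lborel)"
    by (rule H(2)) (use i cont in auto)
  also have "\<dots> = (\<integral>\<^sup>+t. ennreal (poi t m * poi_low t m ^ l * (1 - poi_low t m) ^ (n - 1 - l)) * indicator {0..} t \<partial>lborel)"
  proof (rule nn_integral_cong)
    fix t :: real
    show "ennreal (poi t m * (\<Prod>h\<in>{1..n} - {i}. pois t (if h \<in> A then {..m} else {m<..}))) * indicator {0..} t =
          ennreal (poi t m * poi_low t m ^ l * (1 - poi_low t m) ^ (n - 1 - l)) * indicator {0..} t"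
      using prod_pois_rank[OF i A, of t m] by (cases "t \<ge> 0") (simp_all add: mult.assoc)
  qed
  finally show "emeasure M (hit_event m i ({1..n} - {i}) (\<lambda>h. if h \<in> A then {..m} else {m<..})) =
      (\<integral>\<^sup>+t. ennreal (poi t m * poi_low t m ^ l * (1 - poi_low t m) ^ (n - 1 - l)) * indicator {0..} t \<partial>lborel)" .
qed

text \<open>
  On good paths the event is a disjoint union over configurations and levels: at most one term is nonzero.
\<close>

lemma good_paths_configuration:
  assumes good: "good_paths m n (\<lambda>i t. X i t \<omega>)" and w: "\<omega> \<in> space M"
    and n: "l + j + 2 \<le> n" and j: "1 \<le> j"
  shows "(\<Sum>q\<in>configs n l j. \<Sum>k. indicator (case q of (i, A, J) \<Rightarrow> hit_event m i ({1..n} - {i}) (slot m A J k)) \<omega>) =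
     (indicator {\<omega>\<in>space M. max_mult m l (\<lambda>i t. X i t \<omega>) n = j} \<omega> :: ennreal)"
proof -
  interpret good_paths m n "\<lambda>i t. X i t \<omega>" "\<lambda>i. hit m (path i \<omega>)" by fact
  define E where "E q k = (case q of (i, A, J) \<Rightarrow> hit_event m i ({1..n} - {i}) (slot m A J k))" for q k
  have E_iff: "\<omega> \<in> E (i, A, J) k \<longleftrightarrow> (\<forall>h\<in>{1..n} - {i}. X h (hit m (path i \<omega>)) \<omega> \<in> slot m A J k h)" if "i \<in> {1..n}" for i A J k
    using exceeds[OF that] w by (simp add: E_def hit_event_def hits_def)
  obtain i where i: "i \<in> {1..n}" "card (later (hit m (path i \<omega>))) = l" using rank_exists[of l] n by auto
  define T where "T = hit m (path i \<omega>)"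
  define k where "k = Max ((\<lambda>h. X h T \<omega>) ` {1..n})"
  define J where "J = {h\<in>{1..n}. X h T \<omega> = k}"
  have unique: "q = (i, later T, J) \<and> k' = k \<and> max_mult m l (\<lambda>i t. X i t \<omega>) n = j"
    if "q \<in> configs n l j" "\<omega> \<in> E q k'" for q k'
  proof -
    obtain i' A' J' where q: "q = (i', A', J')" by (cases q) auto
    have i': "i' \<in> {1..n}" and A': "A' \<subseteq> {1..n} - {i'}" "card A' = l" and J': "J' \<subseteq> {1..n} - {i'} - A'" "card J' = j"
      using that(1) by (auto simp: configs_def q)
    note C = configuration_imp[OF n j i' A' J', of k']
    have conf: "\<forall>h\<in>{1..n} - {i'}. X h (hit m (path i' \<omega>)) \<omega> \<in> slot m A' J' k' h"
      using that(2) E_iff[OF i'] by (simp add: q)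
    have "i' = i" using rank_inj[OF i' i(1)] C(2)[OF conf] A'(2) i(2) by simp
    thus ?thesis using C[OF conf] by (simp add: q T_def k_def J_def)
  qed
  show ?thesis
  proof (cases "max_mult m l (\<lambda>i t. X i t \<omega>) n = j")
    case True
    note C = configuration_exists[OF n j True i, folded T_def, folded k_def, folded J_def]
    have q0: "(i, later T, J) \<in> configs n l j" using C i by (auto simp: configs_def T_def)
    have ev: "\<omega> \<in> E (i, later T, J) k" using E_iff[OF i(1)] C(4) by (simp add: T_def)
    have "indicator (E q k') \<omega> = (if k' = k then (if q = (i, later T, J) then 1 else 0) else 0 :: ennreal)" if "q \<in> configs n l j" for q k'
    proof (cases "\<omega> \<in> E q k'")
      case True
      thus ?thesis using unique[OF that True] by simp
    next
      case False
      hence "\<not> (q = (i, later T, J) \<and> k' = k)" using ev by blast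
      thus ?thesis using False by simp
    qed
    hence "(\<Sum>k. indicator (E q k) \<omega>) = (if q = (i, later T, J) then 1 else 0 :: ennreal)" if "q \<in> configs n l j" for q
      using that by (simp add: sums_single[THEN sums_unique, symmetric])
    hence "(\<Sum>q\<in>configs n l j. \<Sum>k. indicator (E q k) \<omega>) = (\<Sum>q\<in>configs n l j. if q = (i, later T, J) then 1 else 0 :: ennreal)"
      by (rule sum.cong[OF refl])
    also have "\<dots> = 1" using q0 finite_configs by simp
    finally show ?thesis using True w by (simp add: E_def)
  next
    case False
    hence "indicator (E q k') \<omega> = (0 :: ennreal)" if "q \<in> configs n l j" for q k'
      using unique[OF that, of k'] by (auto simp: indicator_def)
    thus ?thesis using False by (simp add: E_def)
  qed
qed

lemma good_paths_rank_configuration: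
  assumes good: "good_paths m n (\<lambda>i t. X i t \<omega>)" and w: "\<omega> \<in> space M" and n: "l < n"
  shows "(\<Sum>q\<in>rank_configs n l. indicator (case q of (i, A) \<Rightarrow>
       hit_event m i ({1..n} - {i}) (\<lambda>h. if h \<in> A then {..m} else {m<..})) \<omega>) = (1 :: ennreal)"
proof -
  interpret good_paths m n "\<lambda>i t. X i t \<omega>" "\<lambda>i. hit m (path i \<omega>)" by fact
  define E where "E q = (case q of (i, A) \<Rightarrow> hit_event m i ({1..n} - {i}) (\<lambda>h. if h \<in> A then {..m} else {m<..}))" for q
  have E_iff: "\<omega> \<in> E (i, A) \<longleftrightarrow> A = later (hit m (path i \<omega>))" if "i \<in> {1..n}" "A \<subseteq> {1..n} - {i}" for i A
    using exceeds[OF that(1)] w rank_configuration[OF that] unfolding E_def hit_event_def hits_def by auto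
  obtain i where i: "i \<in> {1..n}" "card (later (hit m (path i \<omega>))) = l" using rank_exists[of l] n by auto
  have q0: "(i, later (hit m (path i \<omega>))) \<in> rank_configs n l"
    using i by (auto simp: rank_configs_def later_def)
  have "indicator (E q) \<omega> = (if q = (i, later (hit m (path i \<omega>))) then 1 else 0 :: ennreal)" if "q \<in> rank_configs n l" for q
  proof -
    obtain i' A' where q: "q = (i', A')" by (cases q) auto
    have i': "i' \<in> {1..n}" and A': "A' \<subseteq> {1..n} - {i'}" "card A' = l"
      using that(1) by (auto simp: rank_configs_def q)
    have "\<omega> \<in> E q \<longleftrightarrow> q = (i, later (hit m (path i \<omega>)))"
      using E_iff[OF i' A'(1)] rank_inj[OF i' i(1)] A'(2) i(2) by (auto simp: q)
    thus ?thesis by (simp add: indicator_def)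
  qed
  hence "(\<Sum>q\<in>rank_configs n l. indicator (E q) \<omega>) = (\<Sum>q\<in>rank_configs n l. if q = (i, later (hit m (path i \<omega>))) then 1 else 0 :: ennreal)"
    by (rule sum.cong[OF refl])
  also have "\<dots> = 1" using q0 finite_rank_configs by simp
  finally show ?thesis by (simp add: E_def)
qed

text \<open>
  The integrand is the density of the stopping time; its total mass is the probability that some process
  has exactly \<open>l\<close> later ones.
\<close>

lemma stop_density_integral:
  assumes n: "l < n"
  shows "(\<integral>\<^sup>+t. ennreal (real (n * ((n - 1) choose l)) * (poi t m * poi_low t m ^ l * (1 - poi_low t m) ^ (n - 1 - l))) * indicator {0..} t \<partial>lborel) = 1"
proof -
  define E where "E q = (case q of (i, A) \<Rightarrow> hit_event m i ({1..n} - {i}) (\<lambda>h. if h \<in> A then {..m} else {m<..}))" for q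
  define I where "I = (\<integral>\<^sup>+t. ennreal (poi t m * poi_low t m ^ l * (1 - poi_low t m) ^ (n - 1 - l)) * indicator {0..} t \<partial>lborel)"
  have E: "E q \<in> events" "emeasure M (E q) = I" if "q \<in> rank_configs n l" for q
    using emeasure_rank_configuration[of "fst q" "snd q" n l m] that by (auto simp: E_def I_def split: prod.splits)
  have "1 = (\<integral>\<^sup>+\<omega>. 1 \<partial>M)" by (simp add: emeasure_space_1)
  also have "\<dots> = (\<integral>\<^sup>+\<omega>. (\<Sum>q\<in>rank_configs n l. indicator (E q) \<omega>) \<partial>M)"
    by (rule nn_integral_cong_AE, use AE_good_paths[of m n] AE_space in eventually_elim)
       (use good_paths_rank_configuration n in \<open>simp add: E_def\<close>)
  also have "\<dots> = (\<Sum>q\<in>rank_configs n l. \<integral>\<^sup>+\<omega>. indicator (E q) \<omega> \<partial>M)"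
    by (rule nn_integral_sum) (use E in auto)
  also have "\<dots> = (\<Sum>q\<in>rank_configs n l. I)" using E by (intro sum.cong refl) simp
  also have "\<dots> = ennreal (real (n * ((n - 1) choose l))) * I" by (simp add: card_rank_configs ennreal_of_nat_eq_real_of_nat)
  also have "\<dots> = (\<integral>\<^sup>+t. ennreal (real (n * ((n - 1) choose l))) * (ennreal (poi t m * poi_low t m ^ l * (1 - poi_low t m) ^ (n - 1 - l)) * indicator {0..} t) \<partial>lborel)"
    unfolding I_def by (rule nn_integral_cmult [symmetric]) measurable
  also have "\<dots> = (\<integral>\<^sup>+t. ennreal (real (n * ((n - 1) choose l)) * (poi t m * poi_low t m ^ l * (1 - poi_low t m) ^ (n - 1 - l))) * indicator {0..} t \<partial>lborel)"
    by (intro nn_integral_cong) (simp add: ennreal_mult' mult.assoc)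
  finally show ?thesis by simp
qed

text \<open>
  All configurations \<open>(i, A, J)\<close> have the same probability by \<open>hit_event_integral\<close>, and there are
  \<open>n (n-1 choose l) (n-1-l choose j)\<close> of them.
\<close>

lemma emeasure_max_mult:
  assumes n: "l + j + 2 \<le> n" and j: "1 \<le> j"
  shows "emeasure M {\<omega>\<in>space M. max_mult m l (\<lambda>i t. X i t \<omega>) n = j} =
    (\<integral>\<^sup>+t. ennreal (real (n * ((n - 1) choose l)) * (poi t m * poi_low t m ^ l) * max_mult_series m (n - 1 - l) j t) * indicator {0..} t \<partial>lborel)"
proof -
  define E where "E q k = (case q of (i, A, J) \<Rightarrow> hit_event m i ({1..n} - {i}) (slot m A J k))" for q k
  define g where "g k t = ennreal (poi t m * poi_low t m ^ l * (poi t k ^ j * poi_mid m t k ^ (n - 1 - l - j))) * indicator {0..} t" for k t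
  have [measurable]: "(\<lambda>t. poi_mid m t k) \<in> borel_measurable borel" for k unfolding poi_mid_def by measurable
  have [measurable]: "g k \<in> borel_measurable borel" for k unfolding g_def by measurable
  have E: "E q k \<in> events" "emeasure M (E q k) = (\<integral>\<^sup>+t. g k t \<partial>lborel)" if "q \<in> configs n l j" for q k
    using emeasure_configuration[of "fst q" "fst (snd q)" "snd (snd q)" n l j m k] that by (auto simp: E_def g_def split: prod.splits)
  have "emeasure M {\<omega>\<in>space M. max_mult m l (\<lambda>i t. X i t \<omega>) n = j} =
      (\<integral>\<^sup>+\<omega>. indicator {\<omega>\<in>space M. max_mult m l (\<lambda>i t. X i t \<omega>) n = j} \<omega> \<partial>M)"
    using max_mult_event[OF j] by simp
  also have "\<dots> = (\<integral>\<^sup>+\<omega>. (\<Sum>q\<in>configs n l j. \<Sum>k. indicator (E q k) \<omega>) \<partial>M)"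
    by (rule nn_integral_cong_AE, use AE_good_paths[of m n] AE_space in eventually_elim)
       (use good_paths_configuration[OF _ _ n j] in \<open>simp add: E_def\<close>)
  also have "\<dots> = (\<Sum>q\<in>configs n l j. \<integral>\<^sup>+\<omega>. (\<Sum>k. indicator (E q k) \<omega>) \<partial>M)"
    by (rule nn_integral_sum) (use E in auto)
  also have "\<dots> = (\<Sum>q\<in>configs n l j. \<Sum>k. \<integral>\<^sup>+\<omega>. indicator (E q k) \<omega> \<partial>M)"
    by (intro sum.cong refl nn_integral_suminf) (use E in auto)
  also have "\<dots> = (\<Sum>q\<in>configs n l j. \<Sum>k. \<integral>\<^sup>+t. g k t \<partial>lborel)"
    by (intro sum.cong refl suminf_cong) (use E in simp)
  also have "\<dots> = ennreal (real (n * ((n - 1) choose l) * ((n - 1 - l) choose j))) * (\<integral>\<^sup>+t. (\<Sum>k. g k t) \<partial>lborel)"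
    by (simp add: card_configs ennreal_of_nat_eq_real_of_nat nn_integral_suminf)
  also have "\<dots> = (\<integral>\<^sup>+t. ennreal (real (n * ((n - 1) choose l) * ((n - 1 - l) choose j))) * (\<Sum>k. g k t) \<partial>lborel)"
    by (rule nn_integral_cmult [symmetric]) measurable
  also have "\<dots> = (\<integral>\<^sup>+t. ennreal (real (n * ((n - 1) choose l)) * (poi t m * poi_low t m ^ l) * max_mult_series m (n - 1 - l) j t) * indicator {0..} t \<partial>lborel)"
  proof (rule nn_integral_cong)
    fix t :: real
    show "ennreal (real (n * ((n - 1) choose l) * ((n - 1 - l) choose j))) * (\<Sum>k. g k t) =
      ennreal (real (n * ((n - 1) choose l)) * (poi t m * poi_low t m ^ l) * max_mult_series m (n - 1 - l) j t) * indicator {0..} t"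
    proof (cases "t \<ge> 0")
      case True
      define c where "c = real (n * ((n - 1) choose l)) * (poi t m * poi_low t m ^ l)"
      have c: "c \<ge> 0" using True by (auto simp: c_def intro!: mult_nonneg_nonneg poi_nonneg poi_low_nonneg zero_le_power)
      define f where "f k = real ((n - 1 - l) choose j) * poi t k ^ j * poi_mid m t k ^ (n - 1 - l - j)" for k
      have jN: "j < n - 1 - l" using n by simp
      note B = max_mult_term_bounds[OF True j jN, where m = m, folded f_def]
      have "ennreal (real (n * ((n - 1) choose l) * ((n - 1 - l) choose j))) * (\<Sum>k. g k t) =
         (\<Sum>k. ennreal (real (n * ((n - 1) choose l) * ((n - 1 - l) choose j))) * g k t)"
        by simp
      also have "\<dots> = (\<Sum>k. ennreal (c * f k))"
        using True by (intro suminf_cong) (simp add: g_def c_def f_def ennreal_mult' [symmetric] mult_ac)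
      also have "\<dots> = ennreal (\<Sum>k. c * f k)"
        by (rule suminf_ennreal2) (use B c in \<open>auto intro!: summable_mult sums_summable\<close>)
      also have "(\<Sum>k. c * f k) = c * max_mult_series m (n - 1 - l) j t"
        using sums_mult[OF B(4), of c] by (simp add: sums_iff)
      finally show ?thesis using True by (simp add: c_def)
    qed (simp add: g_def)
  qed
  finally show ?thesis .
qed

end

declare One_nat_def [simp]

section \<open>Convergence and the Fourier series of the limit\<close>

lemma gumbel_density_eq: "gumbel_density l s = log_gamma_kernel (real (Suc l)) s / fact l"
  by (simp add: gumbel_density_def log_gamma_kernel_def algebra_simps)

lemma gumbel_density_nonneg: "gumbel_density l s \<ge> 0" by (simp add: gumbel_density_def)

lemma gumbel_integral: "integrable lborel (gumbel_density l)" "integral\<^sup>L lborel (gumbel_density l) = 1"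
proof -
  have eq: "gumbel_density l = (\<lambda>s. log_gamma_kernel (real (Suc l)) s / fact l)" by (auto simp: gumbel_density_eq)
  show "integrable lborel (gumbel_density l)"
    unfolding eq by (intro integrable_divide log_gamma_integrable(1)) auto
  have "integral\<^sup>L lborel (log_gamma_kernel (real (Suc l))) = fact l"
    using log_gamma_integrable(2)[of "real (Suc l)"] Gamma_fact[of l, where 'a = real] by (simp add: add.commute)
  thus "integral\<^sup>L lborel (gumbel_density l) = 1" unfolding eq by simp
qed

lemma lattice_sum_periodic: "1 \<le> j \<Longrightarrow> lattice_sum j (v + 1) = lattice_sum j v"
  by (simp add: lattice_sum_eq_log_gamma log_gamma_lattice(2))

context limit_vars
begin

lemma chi_range: "range (chi \<xi> \<tau> j) \<subseteq> {0..1}"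
  by (auto simp: chi_def)

lemma chi_periodic: "1 \<le> j \<Longrightarrow> chi \<xi> \<tau> j (u + 1) = chi \<xi> \<tau> j u"
  using lattice_sum_periodic[of j] by (simp add: chi_eq_expectation(1) add.assoc [symmetric])

lemma chi_continuous:
  assumes j: "1 \<le> j"
  shows "continuous_on UNIV (chi \<xi> \<tau> j)"
proof -
  have isCont_lattice: "isCont (lattice_sum j) v" for v
    using continuous_on_lattice_sum[OF j] by (simp add: continuous_on_eq_continuous_at)
  have "(\<lambda>n. chi \<xi> \<tau> j (x n)) \<longlonglongrightarrow> chi \<xi> \<tau> j u" if x: "x \<longlonglongrightarrow> u" for x u
    unfolding chi_eq_expectation(1)[OF j]
  proof (rule integral_dominated_convergence[where w = "gumbel_density l"])
    show "integrable lborel (gumbel_density l)" by (rule gumbel_integral)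
    show "AE s in lborel. (\<lambda>n. gumbel_density l s * lattice_sum j ((exp 1 - 1) * s + x n)) \<longlonglongrightarrow> gumbel_density l s * lattice_sum j ((exp 1 - 1) * s + u)"
      by (intro AE_I2 tendsto_intros isCont_tendsto_compose[OF isCont_lattice] x)
    show "AE s in lborel. norm (gumbel_density l s * lattice_sum j ((exp 1 - 1) * s + x n)) \<le> gumbel_density l s" for n
      using gumbel_density_nonneg lattice_sum_nonneg lattice_sum_le_1[OF j] by (auto simp: abs_mult intro!: mult_left_le)
  qed (use chi_eq_expectation(2)[OF j] in auto)
  thus ?thesis by (auto simp: continuous_on_sequentially o_def)
qed

text \<open>
  Integrate the uniformly convergent Fourier series of the lattice sum against the Gumbel density. The term
  with \<open>k = 0\<close> equals \<open>1\<close> because \<open>\<Gamma>(j) = (j-1)!\<close> and \<open>\<Gamma>(l+1) = l!\<close>.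
\<close>

lemma chi_fourier:
  assumes j: "1 \<le> j"
  obtains S where "(fourier_term l j u has_sum S) (UNIV - {0})"
    "complex_of_real (chi \<xi> \<tau> j u) = of_real ((1 - exp (-1)) ^ j / real j) * (1 + S)"
proof -
  define g where "g = gumbel_density l"
  define P where "P = log_gamma_lattice j"
  define e where "e s = (exp 1 - 1) * s + u" for s :: real
  define A where "A k = of_real (fact (j - 1)) * fourier_term l j u k" for k
  have g: "integrable lborel g" "integral\<^sup>L lborel g = 1" "\<And>s. g s \<ge> 0"
    unfolding g_def by (rule gumbel_integral gumbel_density_nonneg)+
  have A: "integrable lborel (\<lambda>s. of_real (g s) * (lattice_coeff j k * char_fun k (e s)))"
    "integral\<^sup>L lborel (\<lambda>s. of_real (g s) * (lattice_coeff j k * char_fun k (e s))) = A k" for k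
  proof -
    define w where "w = 2 * pi * of_int k * (exp 1 - 1)"
    have eq: "(\<lambda>s. of_real (g s) * (lattice_coeff j k * char_fun k (e s))) =
       (\<lambda>s. (lattice_coeff j k * char_fun k u / of_real (fact l)) * (of_real (log_gamma_kernel (real (Suc l)) s) * exp (\<i> * of_real (w * s))))"
    proof
      fix s
      have "char_fun k (e s) = char_fun k u * exp (\<i> * of_real (w * s))"
        unfolding e_def w_def by (simp add: char_fun_def algebra_simps flip: exp_add)
      thus "of_real (g s) * (lattice_coeff j k * char_fun k (e s)) =
        (lattice_coeff j k * char_fun k u / of_real (fact l)) * (of_real (log_gamma_kernel (real (Suc l)) s) * exp (\<i> * of_real (w * s)))"
        by (simp add: g_def gumbel_density_eq)
    qed
    have pos: "0 < real (Suc l)" by simp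
    show "integrable lborel (\<lambda>s. of_real (g s) * (lattice_coeff j k * char_fun k (e s)))"
      unfolding eq by (intro integrable_mult_right log_gamma_fourier(1) pos)
    have "integral\<^sup>L lborel (\<lambda>s. of_real (g s) * (lattice_coeff j k * char_fun k (e s))) =
       (lattice_coeff j k * char_fun k u / of_real (fact l)) * Gamma (of_real (real (Suc l)) - \<i> * of_real w)"
      unfolding eq integral_mult_right_zero log_gamma_fourier(2)[OF pos] ..
    also have "\<dots> = A k"
    proof -
      have "of_real (real (Suc l)) - \<i> * of_real w = of_nat l + 1 - 2 * of_real pi * of_real (exp 1 - 1) * of_int k * \<i>"
        by (simp add: w_def algebra_simps)
      moreover have "complex_of_nat j - \<i> * of_real (2 * pi * of_int k) = of_nat j - 2 * of_real pi * \<i> * of_int k"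
        by (simp add: algebra_simps)
      ultimately show ?thesis
        unfolding A_def fourier_term_def lattice_coeff_def char_fun_def by (simp only:) simp
    qed
    finally show "integral\<^sup>L lborel (\<lambda>s. of_real (g s) * (lattice_coeff j k * char_fun k (e s))) = A k" .
  qed
  have P_meas [measurable]: "P \<in> borel_measurable borel"
    unfolding P_def by (intro borel_measurable_continuous_onI log_gamma_lattice(1) j)
  have lat: "lattice_sum j v = (1 - exp (-1)) ^ j / fact j * P v" for v
    using lattice_sum_eq_log_gamma[OF j] by (simp add: P_def)
  have c_pos: "(1 - exp (-1 :: real)) ^ j / fact j > 0" by simp
  have intP: "integrable lborel (\<lambda>s. g s * P (e s))"
  proof -
    have "integrable lborel (\<lambda>s. g s * ((1 - exp (-1)) ^ j / fact j * P (e s)))"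
      using chi_eq_expectation(2)[OF j, of u] by (simp add: lat g_def e_def)
    hence "integrable lborel (\<lambda>s. (g s * ((1 - exp (-1)) ^ j / fact j * P (e s))) / ((1 - exp (-1)) ^ j / fact j))"
      by (rule integrable_divide)
    thus ?thesis using c_pos by simp
  qed
  define I where "I = integral\<^sup>L lborel (\<lambda>s. g s * P (e s))"
  have chi_I: "chi \<xi> \<tau> j u = (1 - exp (-1)) ^ j / fact j * I"
  proof -
    have "chi \<xi> \<tau> j u = integral\<^sup>L lborel (\<lambda>s. (1 - exp (-1)) ^ j / fact j * (g s * P (e s)))"
      unfolding chi_eq_expectation(1)[OF j] lat by (simp add: g_def e_def mult_ac)
    also have "\<dots> = (1 - exp (-1)) ^ j / fact j * I" unfolding I_def by (rule integral_mult_right_zero)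
    finally show ?thesis .
  qed
  have "(A has_sum of_real I) UNIV"
    unfolding has_sum_def
  proof (rule tendstoI)
    fix \<epsilon> :: real assume \<epsilon>: "\<epsilon> > 0"
    have "eventually (\<lambda>F. \<forall>v\<in>UNIV. dist (\<Sum>k\<in>F. lattice_coeff j k * char_fun k v) (of_real (P v)) < \<epsilon> / 2) (finite_subsets_at_top UNIV)"
      using log_gamma_lattice_fourier(2)[OF j] \<epsilon> unfolding P_def by (intro uniform_limitD) auto
    thus "eventually (\<lambda>F. dist (sum A F) (of_real I) < \<epsilon>) (finite_subsets_at_top UNIV)"
    proof eventually_elim
      case (elim F)
      define Q where "Q v = (\<Sum>k\<in>F. lattice_coeff j k * char_fun k v)" for v
      have sum_eq: "(\<lambda>s. of_real (g s) * Q (e s)) = (\<lambda>s. \<Sum>k\<in>F. of_real (g s) * (lattice_coeff j k * char_fun k (e s)))"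
        by (simp add: Q_def sum_distrib_left)
      have iQ: "integrable lborel (\<lambda>s. of_real (g s) * Q (e s))"
        unfolding sum_eq by (intro Bochner_Integration.integrable_sum A(1))
      have sA: "sum A F = integral\<^sup>L lborel (\<lambda>s. of_real (g s) * Q (e s))"
        unfolding sum_eq using A by (subst Bochner_Integration.integral_sum) auto
      have iP: "integrable lborel (\<lambda>s. complex_of_real (g s * P (e s)))" using intP by (simp only: complex_of_real_integrable_eq)
      have "of_real I = integral\<^sup>L lborel (\<lambda>s. complex_of_real (g s * P (e s)))" unfolding I_def by (simp only: integral_complex_of_real)
      hence "sum A F - of_real I = integral\<^sup>L lborel (\<lambda>s. of_real (g s) * Q (e s) - complex_of_real (g s * P (e s)))"
        using sA iQ iP by simp
      also have "norm \<dots> \<le> integral\<^sup>L lborel (\<lambda>s. g s * (\<epsilon> / 2))"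
      proof (rule Bochner_Integration.integral_norm_bound_integral)
        fix s :: real
        have "norm (of_real (g s) * Q (e s) - complex_of_real (g s * P (e s))) = g s * norm (Q (e s) - of_real (P (e s)))"
          using g(3)[of s] by (simp flip: right_diff_distrib add: norm_mult)
        also have "\<dots> \<le> g s * (\<epsilon> / 2)"
          using elim g(3)[of s] by (intro mult_left_mono) (auto simp: dist_norm Q_def less_imp_le)
        finally show "norm (of_real (g s) * Q (e s) - complex_of_real (g s * P (e s))) \<le> g s * (\<epsilon> / 2)" .
      qed (use iQ iP g(1) in auto)
      also have "\<dots> = \<epsilon> / 2" using g(2) by simp
      finally show ?case using \<epsilon> by (simp add: dist_norm)
    qed
  qed
  hence "((\<lambda>k. A k / of_real (fact (j - 1))) has_sum of_real I / of_real (fact (j - 1))) UNIV"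
    by (rule has_sum_divide_const)
  hence ft: "(fourier_term l j u has_sum of_real I / of_real (fact (j - 1))) UNIV"
    by (simp add: A_def)
  have ft0: "fourier_term l j u 0 = 1"
  proof -
    have "Gamma (of_nat j :: complex) = fact (j - 1)"
      using Gamma_fact[of "j - 1", where 'a = complex] j by (simp add: of_nat_diff)
    moreover have "Gamma (of_nat l + 1 :: complex) = fact l"
      using Gamma_fact[of l, where 'a = complex] by (simp add: add.commute)
    ultimately show ?thesis by (simp add: fourier_term_def)
  qed
  have "(fourier_term l j u has_sum 1) {0}"
    using has_sum_finite[of "{0}" "fourier_term l j u"] ft0 by simp
  hence "(fourier_term l j u has_sum (of_real I / of_real (fact (j - 1)) - 1)) (UNIV - {0})"
    by (intro has_sum_Diff ft) auto
  moreover have "complex_of_real (chi \<xi> \<tau> j u) = of_real ((1 - exp (-1)) ^ j / real j) * (1 + (of_real I / of_real (fact (j - 1)) - 1))"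
  proof -
    have "(fact j :: real) = real j * fact (j - 1)" using j by (simp add: fact_reduce)
    hence "chi \<xi> \<tau> j u = (1 - exp (-1)) ^ j / real j * (I / fact (j - 1))" by (simp add: chi_I)
    thus ?thesis by simp
  qed
  ultimately show ?thesis using that by blast
qed

end

lemma stop_density_limit:
  fixes s :: real
  shows "(\<lambda>n. real (n * ((n - 1) choose l)) * (poi (stop_scale m n + s) m * poi_low (stop_scale m n + s) m ^ l)) \<longlonglongrightarrow> exp (- (real l + 1) * s) / fact l"
    and "(\<lambda>n. (1 - poi_low (stop_scale m n + s) m) ^ (n - 1 - l)) \<longlonglongrightarrow> exp (- exp (- s))"
proof -
  define T where "T n = stop_scale m n + s" for n
  have T_top: "filterlim T at_top sequentially" unfolding T_def by (rule stop_scale_at_top)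
  hence ev_T: "eventually (\<lambda>n. T n > 0) sequentially" by (auto simp: filterlim_at_top_dense)
  have p: "(\<lambda>n. real n * poi (T n) m) \<longlonglongrightarrow> exp (- s)" unfolding T_def using poi_stop_scale_le[of m m s] by simp
  have q: "(\<lambda>n. real n * poi_low (T n) m) \<longlonglongrightarrow> exp (- s)" unfolding T_def by (rule poi_low_stop_scale)
  have "(\<lambda>n. (real n * poi (T n) m) * (real ((n - 1) choose l) / real n ^ l) * (real n * poi_low (T n) m) ^ l) \<longlonglongrightarrow> exp (- s) * (1 / fact l) * exp (- s) ^ l"
    by (intro tendsto_intros p q binomial_shift_limit)
  moreover have "eventually (\<lambda>n. (real n * poi (T n) m) * (real ((n - 1) choose l) / real n ^ l) * (real n * poi_low (T n) m) ^ l =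
     real (n * ((n - 1) choose l)) * (poi (T n) m * poi_low (T n) m ^ l)) sequentially"
    using eventually_gt_at_top[of 0] by eventually_elim (simp add: power_mult_distrib field_simps)
  moreover have "exp (- s) * (1 / fact l) * exp (- s) ^ l = exp (- (real l + 1) * s) / fact l"
    by (simp add: algebra_simps flip: exp_add exp_of_nat_mult)
  ultimately show "(\<lambda>n. real (n * ((n - 1) choose l)) * (poi (stop_scale m n + s) m * poi_low (stop_scale m n + s) m ^ l)) \<longlonglongrightarrow> exp (- (real l + 1) * s) / fact l"
    unfolding T_def [symmetric] using Lim_transform_eventually by fastforce
  have "(\<lambda>n. (1 - poi_low (T n) m) ^ (n - (1 + l)) - exp (- exp (- s))) \<longlonglongrightarrow> 0"
  proof (rule power_one_minus_limit[where B = "exp (- s)"])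
    show "eventually (\<lambda>n. 0 \<le> poi_low (T n) m \<and> poi_low (T n) m \<le> 1) sequentially"
      using ev_T by eventually_elim (simp add: poi_low_nonneg poi_low_le_1)
    show "(\<lambda>n. real n * poi_low (T n) m - exp (- s)) \<longlonglongrightarrow> 0" using q by (rule LIM_zero)
  qed simp
  hence "(\<lambda>n. (1 - poi_low (T n) m) ^ (n - (1 + l))) \<longlonglongrightarrow> exp (- exp (- s))" by (rule LIM_zero_cancel)
  thus "(\<lambda>n. (1 - poi_low (stop_scale m n + s) m) ^ (n - 1 - l)) \<longlonglongrightarrow> exp (- exp (- s))" by (simp add: T_def)
qed

lemma max_mult_series_measurable [measurable]: "max_mult_series m N j \<in> borel_measurable borel"
proof -
  have [measurable]: "(\<lambda>t. poi_mid m t k) \<in> borel_measurable borel" for k unfolding poi_mid_def by measurable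
  show ?thesis unfolding max_mult_series_def[abs_def] by measurable
qed

text \<open>
  Since \<open>\<bar>h - g\<bar> \<le> a + f \<le> \<bar>a - f\<bar> + 2 f\<close>, the integrand splits into \<open>\<bar>a - f\<bar>\<close>, which is small in \<open>L\<^sup>1\<close> by
  Scheffe's lemma, and \<open>min \<bar>h - g\<bar> (2 f)\<close>, to which dominated convergence applies.
\<close>

lemma expectation_difference_limit:
  fixes h a g :: "nat \<Rightarrow> real \<Rightarrow> real" and f :: "real \<Rightarrow> real"
  assumes h [measurable]: "\<And>n. h n \<in> borel_measurable lborel" and a [measurable]: "\<And>n. a n \<in> borel_measurable lborel"
    and g [measurable]: "\<And>n. g n \<in> borel_measurable lborel"
    and h_le: "\<And>n s. 0 \<le> h n s \<and> h n s \<le> a n s" and g_le: "\<And>n s. 0 \<le> g n s \<and> g n s \<le> f s"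
    and a_int: "\<And>n. (\<integral>\<^sup>+s. ennreal (a n s) \<partial>lborel) \<le> 1"
    and f: "integrable lborel f" "integral\<^sup>L lborel f = 1"
    and lim_a: "\<And>s. (\<lambda>n. a n s) \<longlonglongrightarrow> f s" and lim: "\<And>s. (\<lambda>n. h n s - g n s) \<longlonglongrightarrow> 0"
  shows "(\<lambda>n. integral\<^sup>L lborel (h n) - integral\<^sup>L lborel (g n)) \<longlonglongrightarrow> 0"
proof -
  have f0: "f s \<ge> 0" for s using g_le[of 0 s] by simp
  have a0: "a n s \<ge> 0" for n s using h_le[of n s] by simp
  have [measurable]: "f \<in> borel_measurable lborel" using f(1) by simp
  have ia: "integrable lborel (a n)" for n
    using a_int[of n] a0 by (intro integrableI_nonneg) (auto intro: le_less_trans)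
  have ih: "integrable lborel (h n)" for n
    by (rule Bochner_Integration.integrable_bound[OF ia[of n]]) (use h_le[of n] a0[of n] in auto)
  have ig: "integrable lborel (g n)" for n
    by (rule Bochner_Integration.integrable_bound[OF f(1)]) (use g_le[of n] f0 in auto)
  have "(\<integral>\<^sup>+s. ennreal (f s) \<partial>lborel) = 1" using nn_integral_eq_integral[OF f(1)] f0 f(2) by simp
  hence "(\<lambda>n. \<integral>\<^sup>+s. norm (a n s - f s) \<partial>lborel) \<longlonglongrightarrow> 0"
    using a_int a0 f0 by (intro Scheffe_lemma2 f(1)) (auto intro!: lim_a)
  moreover have "(\<integral>\<^sup>+s. norm (a n s - f s) \<partial>lborel) = ennreal (\<integral>s. \<bar>a n s - f s\<bar> \<partial>lborel)" for n
    using ia[of n] f(1) by (subst nn_integral_eq_integral) auto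
  ultimately have lim1: "(\<lambda>n. \<integral>s. \<bar>a n s - f s\<bar> \<partial>lborel) \<longlonglongrightarrow> 0"
    by (simp add: ennreal_tendsto_0_iff)
  have lim2: "(\<lambda>n. \<integral>s. min \<bar>h n s - g n s\<bar> (2 * f s) \<partial>lborel) \<longlonglongrightarrow> integral\<^sup>L lborel (\<lambda>_::real. 0)"
  proof (rule integral_dominated_convergence[where w = "\<lambda>s. 2 * f s"])
    show "AE s in lborel. (\<lambda>n. min \<bar>h n s - g n s\<bar> (2 * f s)) \<longlonglongrightarrow> 0"
    proof (intro AE_I2)
      fix s
      have "(\<lambda>n. min \<bar>h n s - g n s\<bar> (2 * f s)) \<longlonglongrightarrow> min \<bar>0\<bar> (2 * f s)" by (intro tendsto_intros lim)
      thus "(\<lambda>n. min \<bar>h n s - g n s\<bar> (2 * f s)) \<longlonglongrightarrow> 0" using f0[of s] by simp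
    qed
  qed (use f f0 in auto)
  have imin: "integrable lborel (\<lambda>s. min \<bar>h n s - g n s\<bar> (2 * f s))" for n
    by (rule Bochner_Integration.integrable_bound[of _ "\<lambda>s. 2 * f s"]) (use f f0 in auto)
  have bound: "\<bar>integral\<^sup>L lborel (h n) - integral\<^sup>L lborel (g n)\<bar> \<le>
      (\<integral>s. min \<bar>h n s - g n s\<bar> (2 * f s) \<partial>lborel) + (\<integral>s. \<bar>a n s - f s\<bar> \<partial>lborel)" for n
  proof -
    have "\<bar>integral\<^sup>L lborel (h n) - integral\<^sup>L lborel (g n)\<bar> = \<bar>\<integral>s. h n s - g n s \<partial>lborel\<bar>"
      using ih ig by simp
    also have "\<dots> \<le> (\<integral>s. \<bar>h n s - g n s\<bar> \<partial>lborel)" by (rule integral_abs_bound)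
    also have "\<dots> \<le> (\<integral>s. min \<bar>h n s - g n s\<bar> (2 * f s) + \<bar>a n s - f s\<bar> \<partial>lborel)"
    proof (rule integral_mono)
      fix s
      show "\<bar>h n s - g n s\<bar> \<le> min \<bar>h n s - g n s\<bar> (2 * f s) + \<bar>a n s - f s\<bar>"
        using h_le[of n s] g_le[of n s] by (auto simp: min_def abs_if)
    qed (use ih ig ia f(1) imin in auto)
    also have "\<dots> = (\<integral>s. min \<bar>h n s - g n s\<bar> (2 * f s) \<partial>lborel) + (\<integral>s. \<bar>a n s - f s\<bar> \<partial>lborel)"
      using ia f(1) imin by (subst Bochner_Integration.integral_add) auto
    finally show ?thesis .
  qed
  have "(\<lambda>n. (\<integral>s. min \<bar>h n s - g n s\<bar> (2 * f s) \<partial>lborel) + (\<integral>s. \<bar>a n s - f s\<bar> \<partial>lborel)) \<longlonglongrightarrow> 0"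
    using tendsto_add[OF lim2 lim1] by simp
  thus ?thesis
    by (rule Lim_null_comparison[rotated]) (intro always_eventually allI, use bound in simp)
qed

lemma nn_integral_shift:
  fixes f :: "real \<Rightarrow> ennreal"
  assumes [measurable]: "f \<in> borel_measurable borel"
  shows "(\<integral>\<^sup>+t. f t \<partial>lborel) = (\<integral>\<^sup>+s. f (c + s) \<partial>lborel)"
  using nn_integral_real_affine[of f 1 c] by simp

text \<open>
  In the variable \<open>s = t - stop_scale m n\<close> the exact formula is the integral of \<open>h n\<close>, dominated by the density
  \<open>a n\<close> of the stopping time, and the pointwise limits are known. For small \<open>n\<close>, where the formula may
  fail, \<open>\<beta>\<close> is set to \<open>0\<close>.
\<close>

lemma (in iid_paths) max_mult_limit:
  assumes j: "1 \<le> j"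
  shows "(\<lambda>n. prob_max_mult m l X n j - (\<integral>s. gumbel_density l s * lattice_sum j ((exp 1 - 1) * s + a_seq m n) \<partial>lborel)) \<longlonglongrightarrow> 0"
proof -
  \<comment> \<open>From \<open>n = l + j + 2\<close> on, at least one process is left strictly between \<open>m\<close> and the maximum.\<close>
  define N0 where "N0 = l + j + 2"
  define \<beta> where "\<beta> n t = (if n \<ge> N0 \<and> t \<ge> 0 then real (n * ((n - 1) choose l)) * (poi t m * poi_low t m ^ l) else 0)" for n t
  define a where "a n s = \<beta> n (stop_scale m n + s) * (1 - poi_low (stop_scale m n + s) m) ^ (n - 1 - l)" for n s
  define h where "h n s = \<beta> n (stop_scale m n + s) * max_mult_series m (n - 1 - l) j (stop_scale m n + s)" for n s
  define g where "g n s = gumbel_density l s * lattice_sum j ((exp 1 - 1) * s + a_seq m n)" for n s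
  have [measurable]: "(\<lambda>t. \<beta> n t) \<in> borel_measurable borel" for n unfolding \<beta>_def by measurable
  have \<beta>0: "\<beta> n t \<ge> 0" for n t
    unfolding \<beta>_def by (auto intro!: mult_nonneg_nonneg poi_nonneg zero_le_power poi_low_nonneg)
  have [measurable]: "(\<lambda>s. lattice_sum j ((exp 1 - 1) * s + a_seq m n)) \<in> borel_measurable borel" for n
    using measurable_compose[OF _ lattice_sum_borel[OF j], of "\<lambda>s. (exp 1 - 1) * s + a_seq m n" borel] by measurable
  have gd [measurable]: "gumbel_density l \<in> borel_measurable borel" unfolding gumbel_density_def[abs_def] by measurable
  have meas [measurable]: "a n \<in> borel_measurable borel" "h n \<in> borel_measurable borel" "g n \<in> borel_measurable borel" for n
    unfolding a_def[abs_def] h_def[abs_def] g_def[abs_def] by measurable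
  have "(\<lambda>n. integral\<^sup>L lborel (h n) - integral\<^sup>L lborel (g n)) \<longlonglongrightarrow> 0"
  proof (rule expectation_difference_limit[where a = a and f = "gumbel_density l"])
    show "integrable lborel (gumbel_density l)" "integral\<^sup>L lborel (gumbel_density l) = 1" by (rule gumbel_integral)+
    show "0 \<le> g n s \<and> g n s \<le> gumbel_density l s" for n s
      unfolding g_def using gumbel_density_nonneg lattice_sum_nonneg lattice_sum_le_1[OF j] by (auto intro!: mult_left_le)
    show "0 \<le> h n s \<and> h n s \<le> a n s" for n s
    proof (cases "n \<ge> N0 \<and> stop_scale m n + s \<ge> 0")
      case True
      hence "j < n - 1 - l" unfolding N0_def by arith
      thus ?thesis using max_mult_term_bounds(5,6)[of "stop_scale m n + s" j "n - 1 - l" m] True j \<beta>0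
        unfolding h_def a_def by (auto intro!: mult_left_mono mult_nonneg_nonneg)
    next
      case False
      hence "\<beta> n (stop_scale m n + s) = 0" by (auto simp: \<beta>_def)
      thus ?thesis by (simp add: h_def a_def)
    qed
    show "(\<integral>\<^sup>+s. ennreal (a n s) \<partial>lborel) \<le> 1" for n
    proof (cases "n \<ge> N0")
      case True
      define F where "F t = ennreal (\<beta> n t * (1 - poi_low t m) ^ (n - 1 - l))" for t
      have [measurable]: "F \<in> borel_measurable borel" unfolding F_def by measurable
      have "(\<integral>\<^sup>+s. ennreal (a n s) \<partial>lborel) = (\<integral>\<^sup>+t. F t \<partial>lborel)"
        by (subst nn_integral_shift[of F "stop_scale m n"]) (simp_all add: F_def a_def)
      also have "\<dots> = (\<integral>\<^sup>+t. ennreal (real (n * ((n - 1) choose l)) * (poi t m * poi_low t m ^ l * (1 - poi_low t m) ^ (n - 1 - l))) * indicator {0..} t \<partial>lborel)"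
        by (intro nn_integral_cong) (use True in \<open>auto simp: F_def \<beta>_def indicator_def mult_ac\<close>)
      also have "\<dots> = 1" by (rule stop_density_integral) (use True in \<open>simp add: N0_def\<close>)
      finally show ?thesis by simp
    qed (simp add: a_def \<beta>_def)
    have ev: "eventually (\<lambda>n. \<beta> n (stop_scale m n + s) = real (n * ((n - 1) choose l)) * (poi (stop_scale m n + s) m * poi_low (stop_scale m n + s) m ^ l)) sequentially" for s
    proof -
      have "eventually (\<lambda>n. stop_scale m n + s \<ge> 0) sequentially"
        using stop_scale_at_top[of m s] by (auto simp: filterlim_at_top)
      thus ?thesis using eventually_ge_at_top[of N0] by eventually_elim (simp add: \<beta>_def)
    qed
    have lim_\<beta>: "(\<lambda>n. \<beta> n (stop_scale m n + s)) \<longlonglongrightarrow> exp (- (real l + 1) * s) / fact l" for s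
      by (rule Lim_transform_eventually[OF stop_density_limit(1)], rule eventually_mono[OF ev[of s]]) (rule sym)
    have gum: "exp (- (real l + 1) * s) / fact l * exp (- exp (- s)) = gumbel_density l s" for s
      unfolding gumbel_density_def diff_conv_add_uminus exp_add by simp
    show "(\<lambda>n. a n s) \<longlonglongrightarrow> gumbel_density l s" for s
      unfolding a_def gum[of s, symmetric] by (intro tendsto_mult lim_\<beta> stop_density_limit(2))
    show "(\<lambda>n. h n s - g n s) \<longlonglongrightarrow> 0" for s
    proof -
      have "(\<lambda>n. \<beta> n (stop_scale m n + s) - exp (- (real l + 1) * s) / fact l) \<longlonglongrightarrow> 0"
        using lim_\<beta> by (rule LIM_zero)
      hence "(\<lambda>n. \<beta> n (stop_scale m n + s) * max_mult_series m (n - 1 - l) j (stop_scale m n + s)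
         - exp (- (real l + 1) * s) / fact l * (exp (- exp (- s)) * lattice_sum j (a_seq m n + (exp 1 - 1) * s))) \<longlonglongrightarrow> 0"
      proof (rule lim_diff_mult[OF _ max_mult_series_limit[OF j]])
        show "\<bar>exp (- exp (- s)) * lattice_sum j (a_seq m n + (exp 1 - 1) * s)\<bar> \<le> 1" for n
          using lattice_sum_nonneg lattice_sum_le_1[OF j] by (auto simp: abs_mult intro!: mult_le_one)
      qed (rule order_refl)
      thus ?thesis unfolding h_def g_def gum[of s, symmetric] by (simp add: mult.assoc add.commute)
    qed
  qed simp_all
  moreover have "eventually (\<lambda>n. integral\<^sup>L lborel (h n) = prob_max_mult m l X n j) sequentially"
    using eventually_ge_at_top[of N0]
  proof eventually_elim
    case (elim n)
    define F where "F t = ennreal (\<beta> n t * max_mult_series m (n - 1 - l) j t)" for t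
    have [measurable]: "F \<in> borel_measurable borel" unfolding F_def by measurable
    have h0: "h n s \<ge> 0" for s
    proof (cases "stop_scale m n + s \<ge> 0")
      case True
      thus ?thesis using max_mult_term_bounds(6)[of "stop_scale m n + s" j "n - 1 - l" m] j elim \<beta>0
        by (auto simp: h_def N0_def intro!: mult_nonneg_nonneg)
    qed (simp add: h_def \<beta>_def)
    have "ennreal (prob_max_mult m l X n j) =
      (\<integral>\<^sup>+t. ennreal (real (n * ((n - 1) choose l)) * (poi t m * poi_low t m ^ l) * max_mult_series m (n - 1 - l) j t) * indicator {0..} t \<partial>lborel)"
      unfolding prob_max_mult_def emeasure_eq_measure [symmetric]
      by (rule emeasure_max_mult) (use elim j in \<open>auto simp: N0_def\<close>)
    also have "\<dots> = (\<integral>\<^sup>+t. F t \<partial>lborel)"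
      by (intro nn_integral_cong) (use elim in \<open>auto simp: F_def \<beta>_def indicator_def\<close>)
    also have "\<dots> = (\<integral>\<^sup>+s. ennreal (h n s) \<partial>lborel)"
      by (subst nn_integral_shift[of F "stop_scale m n"]) (simp_all add: F_def h_def)
    finally have "(\<integral>\<^sup>+s. ennreal (h n s) \<partial>lborel) = ennreal (prob_max_mult m l X n j)" by simp
    thus ?case
      by (intro integral_eq_nn_integral[THEN trans]) (use h0 in \<open>auto simp: prob_max_mult_def\<close>)
  qed
  hence "eventually (\<lambda>n. integral\<^sup>L lborel (h n) - integral\<^sup>L lborel (g n) = prob_max_mult m l X n j - integral\<^sup>L lborel (g n)) sequentially"
    by eventually_elim simp
  ultimately have "(\<lambda>n. prob_max_mult m l X n j - integral\<^sup>L lborel (g n)) \<longlonglongrightarrow> 0"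
    by (rule Lim_transform_eventually)
  thus ?thesis unfolding g_def .
qed

theorem theorem10p1:
  fixes m l j :: nat
    and M :: "'a measure" and X :: "nat \<Rightarrow> real \<Rightarrow> 'a \<Rightarrow> nat"
    and N :: "'b measure" and \<xi> :: "nat \<Rightarrow> 'b \<Rightarrow> real" and \<tau> :: "'b \<Rightarrow> real"
  assumes "prob_space M"
    and "prob_space.iid_unit_poisson_processes M X"
    and "prob_space N"
    and "prob_space.limit_variables N l \<xi> \<tau>"
    and "j \<ge> 1"
  shows "((\<lambda>n. prob_space.prob_max_mult M m l X n j - prob_space.chi N \<xi> \<tau> j (a_seq m n)) \<longlonglongrightarrow> 0) \<and>
    ((\<lambda>n. prob_space.prob_max_mult M m l X n j - prob_space.chi N \<xi> \<tau> j (c_seq m n)) \<longlonglongrightarrow> 0) \<and>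
    range (prob_space.chi N \<xi> \<tau> j) \<subseteq> {0..1} \<and>
    continuous_on UNIV (prob_space.chi N \<xi> \<tau> j) \<and>
    (\<forall>u. prob_space.chi N \<xi> \<tau> j (u + 1) = prob_space.chi N \<xi> \<tau> j u) \<and>
    (\<forall>u. \<exists>S. (fourier_term l j u has_sum S) (UNIV - {0}) \<and>
       complex_of_real (prob_space.chi N \<xi> \<tau> j u) =
         of_real ((1 - exp (-1)) ^ j / real j) * (1 + S))"
proof -
  interpret P: iid_paths M X by (intro iid_paths.intro iid_paths_axioms.intro assms)
  interpret L: limit_vars N l \<xi> \<tau> by (intro limit_vars.intro limit_vars_axioms.intro assms)
  note j = \<open>j \<ge> 1\<close>
  have lim: "(\<lambda>n. P.prob_max_mult m l X n j - L.chi \<xi> \<tau> j (a_seq m n)) \<longlonglongrightarrow> 0"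
    unfolding L.chi_eq_expectation(1)[OF j] by (rule P.max_mult_limit[OF j])
  have shift: "L.chi \<xi> \<tau> j (u + of_int z) = L.chi \<xi> \<tau> j u" for u and z :: int
    by (rule periodic_of_int) (rule L.chi_periodic[OF j])
  have "L.chi \<xi> \<tau> j (c_seq m n) = L.chi \<xi> \<tau> j (a_seq m n)" for n
    using shift[of "c_seq m n" "\<lfloor>a_seq m n\<rfloor>"] by (simp add: c_seq_def)
  hence lim': "(\<lambda>n. P.prob_max_mult m l X n j - L.chi \<xi> \<tau> j (c_seq m n)) \<longlonglongrightarrow> 0"
    using lim by simp
  have "\<exists>S. (fourier_term l j u has_sum S) (UNIV - {0}) \<and>
       complex_of_real (L.chi \<xi> \<tau> j u) = of_real ((1 - exp (-1)) ^ j / real j) * (1 + S)" for u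
    using L.chi_fourier[OF j, of u] by blast
  thus ?thesis
    by (intro conjI allI lim lim' L.chi_range L.chi_continuous[OF j] L.chi_periodic[OF j])
qed

end
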